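(* Let $m,n,\alpha,\beta,\gamma$ be nonnegative integers with $2\alpha+2\gamma+1\geq \beta$, and put $N=m+n+\alpha+\gamma$. Let $L_1,R_1,B\subseteq\{-N,-N+1,\dots,N\}$ with $0\notin L_1$. Let $F_L\subseteq L_1\setminus R_1$ be a set with $F_L=-F_L$ and $|F_L|=2m$, and let $F_R\subseteq R_1\setminus L_1$ be a set with $F_R=-F_R$ and $|F_R|=2n$. Put $L_2=(L_1\setminus F_L)\cup F_R$ and $R_2=(R_1\setminus F_R)\cup F_L$ (i.e. the removed left-pointing triangles labeled by $F_L$ and the removed right-pointing triangles labeled by $F_R$ are flipped across the vertical diagonal). If $\operatorname{M}_q(H_{m,n,\alpha,\beta,\gamma}(L_1,R_1,B))\neq 0$, then \[ \frac{\operatorname{M}_{q}(H_{n,m,\alpha,\beta,\gamma}(L_2, R_2, B))}{\operatorname{M}_{q}(H_{m,n,\alpha,\beta,\gamma}(L_1, R_1, B))}=\frac{\Big[\prod_{i=1}^{m+\alpha}\langle 2i-1\rangle_q!\Big]^2}{\Big[\prod_{i=1}^{n+\alpha}\langle 2i-1\rangle_q!\Big]^{2}}\cdot\frac{\prod_{i=1}^{2n+\beta-1}\langle i\rangle_{q}!}{\prod_{i=1}^{2m+\beta-1}\langle i\rangle_{q}!}\cdot\sqrt{\frac{\prod_{z\in L_{2}}\frac{\langle 2|z|\rangle_{q}}{4}}{\prod_{z\in L_{1}}\frac{\langle 2|z|\rangle_{q}}{4}}}\cdot\frac{\Delta_{1,1,q}(L_{2})\Delta_{1,1,q}(R_{2})}{\Delta_{1,1,q}(L_{1})\Delta_{1,1,q}(R_{1})},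 \] where the square root (whose argument is the square of a ratio of Laurent polynomials in $q$ after cancellation) is taken with the sign making the leading coefficients of numerator and denominator positive.
   Context: Work on the triangular lattice of unit triangles (side length $1$) with one family of lattice lines vertical. A left-pointing (resp. right-pointing) unit triangle has a vertical side on its right (resp. left) and a vertex pointing left (resp. right). A lozenge is the union of two unit triangles sharing an edge; it is horizontal if the shared edge is vertical (its long diagonal is horizontal). A lozenge tiling of a region covers it by lozenges without gaps or overlaps. A unit segment declared a barrier may not be crossed by a lozenge (the two unit triangles on either side of it may not form a lozenge). Weights: given a region with a distinguished horizontal line $\ell$, the $i$-coordinate of a point is twice its signed vertical distance above $\ell$. A horizontal lozenge whose center has $i$-coordinate $n$ gets weight $\frac{q^n+q^{-n}}{2}$; all other lozenges get weight $1$. The weight of a tiling is the product of its lozenge weights, and $\operatorname{M}_q(R)$ is the sum of the weights of all lozenge tilings of $R$. Region $H_{m,n,\alpha,\beta,\gamma}(L,R,B)$: take the hexagon whose sides, clockwise starting from the (vertical) left side, have lengths $2n+2\gamma$, $2m+2\alpha+1$, $2n+\beta$, $2m+2\alpha+2\gamma-\beta+1$, $2n+\beta$, $2m+2\alpha+1$; it is symmetric about a horizontal line $\ell$ (the perpendicular bisector of its left side). Remove the intrusion consisting of the $2m+2\alpha+1$ unit triangles crossed by $\ell$ that are nearest to the left side (the first is left-pointing with its left vertex at the midpoint of the left side, orientations alternate). The vertical diagonal joining the top and bottom vertices of the hexagon consists of $2(m+n+\alpha+\gamma)+1$ unit segments, labeled $-(m+n+\alpha+\gamma),\dots,m+n+\alpha+\gamma$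 from bottom to top (label $=$ signed height of its midpoint above $\ell$); the last triangle of the intrusion is the left-pointing unit triangle whose right side is the segment labeled $0$. Remove the left-pointing unit triangles whose right side is a diagonal segment with label in $L$, remove the right-pointing unit triangles whose left side is a diagonal segment with label in $R$, and make the diagonal segments with labels in $B$ barriers. Weights are with respect to $\ell$. Notation: $\langle n\rangle_q=\frac{q^n-q^{-n}}{q-q^{-1}}$, $\langle n\rangle_q!=\langle 1\rangle_q\cdots\langle n\rangle_q$ (empty product $=1$), $\langle n\rangle_q^+=\frac{q^n+q^{-n}}{2}$, and for a finite set $S$ of integers (or of elements of $\mathbb{Z}+\frac12$), $\Delta_{1,1,q}(S)=\prod_{s_1,s_2\in S,\,s_1<s_2}\langle s_2+s_1\rangle_q^+\langle s_2-s_1\rangle_q$. For a set $A$, $-A=\{-a:a\in A\}$. *)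

theory Defs
  imports "HOL-Computational_Algebra.Computational_Algebra"
begin

text \<open>
  The point \<open>(x, y)\<close> lies at horizontal distance \<open>x * sqrt 3 / 2\<close> to the right of a fixed
  vertical lattice line and at height \<open>y / 2\<close> above the horizontal line \<open>\<ell>\<close>; so \<open>y\<close> is its
  i-coordinate. The vertices of the lattice are the points with \<open>x + y\<close> even.

  In the vertical strip between \<open>x = c\<close> and \<open>x = c + 1\<close> there is, for each integer \<open>y\<close>, exactly
  one unit triangle whose horizontal axis of symmetry is at height \<open>y\<close>, and it is left-pointing
  iff \<open>c + y\<close> is even. The pair \<open>(c, y)\<close> stands for this triangle. A segment is given by its two
  end points, a lozenge by its two triangles.
\<close>

type_synonym point = "int \<times> int"
type_synonym segment = "point set"
type_synonym triangle = "int \<times> int"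
type_synonym lozenge = "triangle set"

definition left_pointing :: "triangle \<Rightarrow> bool" where
  "left_pointing = (\<lambda>(c, y). even (c + y))"

definition vertices :: "triangle \<Rightarrow> point set" where
  "vertices = (\<lambda>(c, y).
     if left_pointing (c, y) then {(c, y), (c + 1, y - 1), (c + 1, y + 1)}
     else {(c + 1, y), (c, y - 1), (c, y + 1)})"

definition lozenges :: "lozenge set" where
  "lozenges = {{s, t} | s t. s \<noteq> t \<and> card (vertices s \<inter> vertices t) = 2}"

definition shared_edge :: "lozenge \<Rightarrow> segment" where
  "shared_edge l = \<Inter> (vertices ` l)"

definition vertical_segment :: "point \<Rightarrow> segment" where
  "vertical_segment = (\<lambda>(x, y). {(x, y - 1), (x, y + 1)})"

definition horizontal :: "lozenge \<Rightarrow> bool" where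
  "horizontal l \<longleftrightarrow> (\<exists>p. shared_edge l = vertical_segment p)"

text \<open>The center of a lozenge is the midpoint of its shared edge (the division is exact for
  horizontal lozenges, the only ones for which this is used).\<close>

definition center_i_coordinate :: "lozenge \<Rightarrow> int" where
  "center_i_coordinate l = (\<Sum>p\<in>shared_edge l. snd p) div 2"

definition qnum :: "'a :: field \<Rightarrow> int \<Rightarrow> 'a" where
  "qnum q k = (q powi k - q powi (- k)) / (q - inverse q)"

definition qfact :: "'a :: field \<Rightarrow> nat \<Rightarrow> 'a" where
  "qfact q k = (\<Prod>i = 1..k. qnum q (int i))"

definition qplus :: "'a :: field \<Rightarrow> int \<Rightarrow> 'a" where
  "qplus q k = (q powi k + q powi (- k)) / 2"

definition Delta11 :: "'a :: field \<Rightarrow> int set \<Rightarrow> 'a" where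
  "Delta11 q S =
     (\<Prod>(s1, s2) \<in> {(s1, s2). s1 \<in> S \<and> s2 \<in> S \<and> s1 < s2}. qplus q (s2 + s1) * qnum q (s2 - s1))"

record region =
  ambient :: "triangle set"
  removed :: "triangle set"
  barriers :: "segment set"

text \<open>The lozenges of a tiling together with the removed triangles partition the ambient set.
  In particular there is no tiling if a triangle to be removed is not there in the first place.\<close>

definition tilings :: "region \<Rightarrow> lozenge set set" where
  "tilings G = {T. T \<subseteq> lozenges \<and> pairwise disjnt T \<and>
     \<Union> T \<inter> removed G = {} \<and> \<Union> T \<union> removed G = ambient G \<and>
     (\<forall>l\<in>T. shared_edge l \<notin> barriers G)}"

definition lozenge_weight :: "'a :: field \<Rightarrow> lozenge \<Rightarrow> 'a" where
  "lozenge_weight q l = (if horizontal l then qplus q (center_i_coordinate l) else 1)"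

definition tiling_gf :: "'a :: field \<Rightarrow> region \<Rightarrow> 'a" where
  "tiling_gf q G = (\<Sum>T\<in>tilings G. \<Prod>l\<in>T. lozenge_weight q l)"

text \<open>
  The hexagon with sides, clockwise from the left side, \<open>h, a, b, h + a - b, b, a\<close>, whose left
  side lies on \<open>x = 0\<close> and is bisected by \<open>\<ell>\<close>. Since heights are counted in half units, the left
  side has end points \<open>(0, - h)\<close> and \<open>(0, h)\<close>, the sides of length \<open>a\<close> have slope \<open>1\<close> and \<open>- 1\<close>,
  and the top and bottom vertices are \<open>(a, h + a)\<close> and \<open>(a, - h - a)\<close>.
\<close>

definition hexagon :: "int \<Rightarrow> int \<Rightarrow> int \<Rightarrow> point set" where
  "hexagon h a b =
     {(x, y). 0 \<le> x \<and> x \<le> a + b \<and> \<bar>y\<bar> \<le> h + x \<and> \<bar>y\<bar> \<le> h + a - (x - a)}"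

text \<open>The segment of the vertical diagonal \<open>x = a\<close> with label \<open>z\<close>, i.e. with midpoint at
  height \<open>z\<close> in lattice units.\<close>

definition diagonal_segment :: "int \<Rightarrow> int \<Rightarrow> segment" where
  "diagonal_segment a z = vertical_segment (a, 2 * z)"

text \<open>The triangles \<open>(c, 0)\<close> are those crossed by \<open>\<ell>\<close>.\<close>

definition H_region ::
  "nat \<Rightarrow> nat \<Rightarrow> nat \<Rightarrow> nat \<Rightarrow> nat \<Rightarrow> int set \<Rightarrow> int set \<Rightarrow> int set \<Rightarrow> region" where
  "H_region m n \<alpha> \<beta> \<gamma> L R B =
     (let h = 2 * int n + 2 * int \<gamma>;
          a = 2 * int m + 2 * int \<alpha> + 1;
          b = 2 * int n + int \<beta>
      in \<lparr> ambient = {t. vertices t \<subseteq> hexagon h a b},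
           removed =
             {(c, 0) | c. 0 \<le> c \<and> c < a} \<union>
             {t. left_pointing t \<and> (\<exists>z\<in>L. diagonal_segment a z \<subseteq> vertices t)} \<union>
             {t. \<not> left_pointing t \<and> (\<exists>z\<in>R. diagonal_segment a z \<subseteq> vertices t)},
           barriers = diagonal_segment a ` B \<rparr>)"

definition indet :: "rat poly fract" where
  "indet = Fraction_Field.Fract [:0, 1:] 1"

text \<open>The square root with positive leading coefficients of numerator and denominator; it is
  unique if it exists.\<close>

definition rfun_sqrt :: "rat poly fract \<Rightarrow> rat poly fract" where
  "rfun_sqrt f = (THE s. s\<^sup>2 = f \<and>
     (\<exists>u v. s = Fraction_Field.Fract u v \<and> lead_coeff u > 0 \<and> lead_coeff v > 0))"

end

theory Submission
  imports Defs "Jordan_Normal_Form.Determinant"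
begin

text \<open>
  Cutting along the vertical diagonal writes the generating function as a sum over the set S of labels
  of the lozenges crossing it. The intrusion splits the left half into two mirror images, and with
  x(z) = [2z]/2 the pieces have product formulas: the right half with dents A gives the Vandermonde
  product of x over A, and each left piece with dents P gives the Vandermonde product of the squares
  of x over P times the product of x over P. Since FL and FR are symmetric, the factor through which
  a label z in S interacts with them is the product of |x(f) - x(z)| over f in FL and FR, for both
  regions, so flipping FL and FR multiplies every summand by the same constant.

  The product formulas follow by peeling off vertical strips: the dents of neighbouring lines
  interlace, the weight of a lozenge at i-coordinate y is ([y + 1] - [y - 1]) / 2, and hence a
  Vandermonde determinant sums over interlacing sets to a Vandermonde determinant with one more row.

  Signs are controlled by the order on rational functions in which the indeterminate is infinitely
  large; there the normalised square root is the positive one.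
\<close>

section \<open>Determinants\<close>

text \<open>The [2|z|] / 4 under the square root comes from a mismatch between the two halves. The
  right half weighs a symmetric set F of dents by all differences of x. The left half compares only
  squares of x within each sign and multiplies by |x| over F. For F = -F without 0 the left weight
  exceeds the right one exactly by the product of |x(z)| / 2 over the positive labels of F, which is
  the square root of the product over all of F.

  The obstacle in the product formulas is the boundary along the intrusion: a trapezoid gains a dent
  with every column, a left piece only with every second one. Hence its formula alternates between
  two shapes, with and without the product of x over the dents, and two consecutive strips together
  account for one odd q-factorial.

  The numbers of dents look after themselves: each piece vanishes unless it has the right number,
  and the flip changes these numbers exactly as the exchange of m and n does.\<close>

lemma sum_PiE_det:
  fixes g :: "nat \<Rightarrow> 'b \<Rightarrow> 'a :: comm_ring_1"
  assumes "\<And>i. i < k \<Longrightarrow> finite (I i)"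
  shows "(\<Sum>d\<in>PiE {..<k} I. (\<Prod>i<k. w (d i)) * det (mat k k (\<lambda>(i, j). g j (d i)))) =
    det (mat k k (\<lambda>(i, j). \<Sum>y\<in>I i. w y * g j y))"
proof -
  \<comment> \<open>By the Leibniz formula each summand is a product over the rows, row
    \<open>i\<close> depending on \<open>d i\<close> only, so the sum over all choice functions
    factors.\<close>
  have "(\<Sum>d\<in>PiE {..<k} I. (\<Prod>i<k. w (d i)) * det (mat k k (\<lambda>(i, j). g j (d i)))) =
    (\<Sum>d\<in>PiE {..<k} I. \<Sum>p\<in>{p. p permutes {0..<k}}. signof p * (\<Prod>i<k. w (d i) * g (p i) (d i)))"
    by (intro sum.cong refl)
      (simp add: det_def' [of _ k] sum_distrib_left prod.distrib mult_ac atLeast0LessThan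
        permutes_in_image[of _ "{..<k}", simplified])
  also have "\<dots> = (\<Sum>p\<in>{p. p permutes {0..<k}}. signof p * (\<Sum>d\<in>PiE {..<k} I. \<Prod>i<k. w (d i) * g (p i) (d i)))"
    by (subst sum.swap) (simp add: sum_distrib_left)
  also have "\<dots> = (\<Sum>p\<in>{p. p permutes {0..<k}}. signof p * (\<Prod>i<k. \<Sum>y\<in>I i. w y * g (p i) y))"
    using assms by (intro sum.cong refl arg_cong2[where f = "(*)"] prod_sum_PiE[symmetric]) auto
  also have "\<dots> = det (mat k k (\<lambda>(i, j). \<Sum>y\<in>I i. w y * g j y))"
    by (simp add: det_def' [of _ k] atLeast0LessThan permutes_in_image[of _ "{..<k}", simplified])
  finally show ?thesis .
qed

lemma det_first_column_unit:
  fixes A :: "nat \<Rightarrow> nat \<Rightarrow> 'a :: comm_ring_1"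
  assumes "A 0 0 = 1" and "\<And>i. i < k \<Longrightarrow> A (Suc i) 0 = 0"
  shows "det (mat (Suc k) (Suc k) (\<lambda>(i, j). A i j)) = det (mat k k (\<lambda>(i, j). A (Suc i) (Suc j)))"
proof -
  let ?M = "mat (Suc k) (Suc k) (\<lambda>(i, j). A i j)"
  have "det ?M = (\<Sum>i<Suc k. ?M $$ (i, 0) * cofactor ?M i 0)"
    by (rule laplace_expansion_column) auto
  also have "\<dots> = cofactor ?M 0 0 + (\<Sum>i<k. ?M $$ (Suc i, 0) * cofactor ?M (Suc i) 0)"
    by (subst sum.lessThan_Suc_shift) (simp add: assms)
  also have "(\<Sum>i<k. ?M $$ (Suc i, 0) * cofactor ?M (Suc i) 0) = 0"
    by (rule sum.neutral) (simp add: assms)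
  also have "mat_delete ?M 0 0 = mat k k (\<lambda>(i, j). A (Suc i) (Suc j))"
    unfolding mat_delete_def by (rule eq_matI) auto
  then have "cofactor ?M 0 0 = det (mat k k (\<lambda>(i, j). A (Suc i) (Suc j)))"
    by (simp add: cofactor_def)
  finally show ?thesis by simp
qed

lemma det_first_row_unit:
  fixes A :: "nat \<Rightarrow> nat \<Rightarrow> 'a :: comm_ring_1"
  assumes "A 0 0 = 1" and "\<And>j. j < k \<Longrightarrow> A 0 (Suc j) = 0"
  shows "det (mat (Suc k) (Suc k) (\<lambda>(i, j). A i j)) = det (mat k k (\<lambda>(i, j). A (Suc i) (Suc j)))"
proof -
  have tr: "det (mat n n (\<lambda>(i, j). F j i)) = det (mat n n (\<lambda>(i, j). F i j))" for n and F :: "nat \<Rightarrow> nat \<Rightarrow> 'a"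
  proof -
    have "mat n n (\<lambda>(i, j). F j i) = transpose_mat (mat n n (\<lambda>(i, j). F i j))"
      by (rule eq_matI) auto
    then show ?thesis by (simp add: det_transpose[of _ n])
  qed
  show ?thesis
    using det_first_column_unit[of "\<lambda>i j. A j i" k] assms
      tr[of "Suc k" A] tr[of k "\<lambda>i j. A (Suc i) (Suc j)"] by simp
qed

text \<open>Subtracting from each row the one above it is multiplication by a unitriangular matrix,
  and it turns the column of ones into a unit column. Read from left to right, differences across
  gaps become values at the end points of the gaps; this is how a determinant gains a row when a
  column of triangles is added.\<close>

lemma det_row_differences:
  fixes G :: "nat \<Rightarrow> nat \<Rightarrow> 'a :: idom"
  shows "det (mat k k (\<lambda>(i, j). G j (Suc i) - G j i)) =
    det (mat (Suc k) (Suc k) (\<lambda>(i, j). if j = 0 then 1 else G (j - 1) i))"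
proof -
  define A where "A = (\<lambda>i j. if j = 0 then 1 else G (j - 1) i)"
  define L :: "'a mat" where
    "L = mat (Suc k) (Suc k) (\<lambda>(i, j). if i = j then 1 else if i = Suc j then - 1 else 0)"
  define M where "M = mat (Suc k) (Suc k) (\<lambda>(i, j). A i j)"
  define A' where "A' = (\<lambda>i j. case i of 0 \<Rightarrow> A 0 j | Suc i \<Rightarrow> A (Suc i) j - A i j)"
  have L: "L \<in> carrier_mat (Suc k) (Suc k)" and M: "M \<in> carrier_mat (Suc k) (Suc k)"
    by (auto simp: L_def M_def)
  have "L * M = mat (Suc k) (Suc k) (\<lambda>(i, j). A' i j)"
  proof (rule eq_matI, goal_cases)
    case (1 i j)
    then have ij: "i < Suc k" "j < Suc k" by auto
    have "(L * M) $$ (i, j) = (\<Sum>l<Suc k. (if i = l then A l j else 0) + (if i = Suc l then - A l j else 0))"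
      using ij unfolding L_def M_def
      by (auto simp: scalar_prod_def atLeast0LessThan intro!: sum.cong)
    also have "\<dots> = A' i j"
    proof (cases i)
      case 0
      then show ?thesis by (simp add: A'_def sum.distrib sum.delta)
    next
      case (Suc i')
      have "(\<Sum>l<Suc k. if i = Suc l then - A l j else 0) = (\<Sum>l<Suc k. if i' = l then - A l j else 0)"
        by (rule sum.cong) (auto simp: Suc)
      then show ?thesis using ij Suc by (simp add: A'_def sum.distrib sum.delta)
    qed
    finally show ?case using ij by simp
  qed (auto simp: L_def M_def)
  moreover have "det L = 1"
  proof -
    have "det L = prod_list (diag_mat L)"
      by (rule det_lower_triangular[OF _ L]) (auto simp: L_def)
    also have "diag_mat L = replicate (Suc k) 1"
      by (rule nth_equalityI) (auto simp: diag_mat_def L_def simp del: upt_Suc replicate_Suc)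
    finally show ?thesis by simp
  qed
  ultimately have "det M = det (mat (Suc k) (Suc k) (\<lambda>(i, j). A' i j))"
    using det_mult[OF L M] by simp
  also have "\<dots> = det (mat k k (\<lambda>(i, j). A' (Suc i) (Suc j)))"
    by (rule det_first_column_unit) (auto simp: A'_def A_def)
  finally show ?thesis by (simp add: M_def A'_def A_def)
qed

section \<open>Vandermonde determinants in a triangular polynomial basis\<close>

definition vandermonde :: "nat \<Rightarrow> (nat \<Rightarrow> 'a :: comm_ring_1) \<Rightarrow> 'a" where
  "vandermonde k x = (\<Prod>j<k. \<Prod>i<j. x j - x i)"

text \<open>The matrix is the power matrix times the upper triangular matrix of coefficients. The
  coefficient at \<open>j\<close> is used instead of the leading one, so that polynomials of smaller
  degree are covered.\<close>

lemma det_polys_aux: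
  fixes x :: "nat \<Rightarrow> 'a :: idom"
  assumes "\<And>j. j < k \<Longrightarrow> degree (p j) \<le> j"
  shows "det (mat k k (\<lambda>(i, j). poly (p j) (x i))) =
    det (mat k k (\<lambda>(i, j). x i ^ j)) * (\<Prod>j<k. coeff (p j) j)"
proof -
  define V where "V = mat k k (\<lambda>(i, j). x i ^ j)"
  define U where "U = mat k k (\<lambda>(i, j). coeff (p j) i)"
  have V: "V \<in> carrier_mat k k" and U: "U \<in> carrier_mat k k" by (auto simp: V_def U_def)
  have "mat k k (\<lambda>(i, j). poly (p j) (x i)) = V * U"
  proof (rule eq_matI, goal_cases)
    case (1 i j)
    then have ij: "i < k" "j < k" by (auto simp: V_def U_def)
    have "poly (p j) (x i) = (\<Sum>l<k. coeff (p j) l * x i ^ l)"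
      unfolding poly_altdef using assms[OF ij(2)] ij
      by (intro sum.mono_neutral_left) (auto simp: coeff_eq_0)
    then show ?case using ij
      by (simp add: V_def U_def scalar_prod_def atLeast0LessThan mult.commute)
  qed (auto simp: V_def U_def)
  moreover have "det U = (\<Prod>j<k. coeff (p j) j)"
  proof -
    have "det U = prod_list (diag_mat U)"
    proof (rule det_upper_triangular[OF _ U])
      show "upper_triangular U"
        using assms unfolding upper_triangular_def U_def
        by (auto intro!: coeff_eq_0) (meson le_less_trans order_less_trans)
    qed
    also have "\<dots> = (\<Prod>j<k. coeff (p j) j)"
      by (simp add: diag_mat_def U_def prod.list_conv_set_nth atLeast0LessThan)
    finally show ?thesis .
  qed
  ultimately show ?thesis using det_mult[OF V U] by (simp add: V_def)
qed

lemma det_polys: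
  fixes x :: "nat \<Rightarrow> 'a :: idom"
  assumes "\<And>j. j < k \<Longrightarrow> degree (p j) \<le> j"
  shows "det (mat k k (\<lambda>(i, j). poly (p j) (x i))) = vandermonde k x * (\<Prod>j<k. coeff (p j) j)"
proof -
  \<comment> \<open>The Newton basis: \<open>b j\<close> vanishes at \<open>x i\<close> for
    \<open>i < j\<close>, so its matrix is lower triangular with determinant
    \<open>vandermonde k x\<close>. As the basis is monic, \<open>det_polys_aux\<close> transfers
    this value to the power matrix.\<close>
  define b where "b = (\<lambda>j. \<Prod>l<j. [:- x l, 1:])"
  have deg: "degree (b j) = j" for j
    unfolding b_def by (subst degree_prod_eq_sum_degree) auto
  have lc: "coeff (b j) j = 1" for j
    using lead_coeff_prod[of "\<lambda>l. [:- x l, 1:]" "{..<j}"] deg[of j] by (simp add: b_def)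
  define M where "M = mat k k (\<lambda>(i, j). poly (b j) (x i))"
  have M: "M \<in> carrier_mat k k" by (simp add: M_def)
  have "det M = prod_list (diag_mat M)"
    by (rule det_lower_triangular[OF _ M]) (auto simp: M_def b_def poly_prod)
  also have "\<dots> = vandermonde k x"
    by (simp add: diag_mat_def M_def prod.list_conv_set_nth vandermonde_def b_def poly_prod
      atLeast0LessThan)
  finally have "det (mat k k (\<lambda>(i, j). x i ^ j)) = vandermonde k x"
    using det_polys_aux[of k b x] by (simp add: deg lc M_def)
  with det_polys_aux[OF assms] show ?thesis by simp
qed

lemma det_powers:
  fixes x :: "nat \<Rightarrow> 'a :: idom"
  shows "det (mat k k (\<lambda>(i, j). x i ^ j)) = vandermonde k x"
  using det_polys[of k "\<lambda>j. monom 1 j" x] by (simp add: poly_monom degree_monom_eq)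

lemma det_scale_rows:
  fixes A :: "nat \<Rightarrow> nat \<Rightarrow> 'a :: comm_ring_1"
  shows "det (mat k k (\<lambda>(i, j). c i * A i j)) = (\<Prod>i<k. c i) * det (mat k k (\<lambda>(i, j). A i j))"
  by (simp add: det_def' [of _ k] sum_distrib_left prod.distrib mult_ac atLeast0LessThan
    permutes_in_image[of _ "{..<k}", simplified])

section \<open>Polynomial antidifferences of the lozenge weight\<close>

text \<open>The argument is an i-coordinate, so the x(z) of a label is \<open>qx q (2 * z)\<close>.
  The factor 1/2 makes the lozenge weight \<open>qplus\<close> its exact central difference, see
  \<open>qx_diff\<close>.\<close>

definition qx :: "'a :: field \<Rightarrow> int \<Rightarrow> 'a" where
  "qx q y = qnum q y / 2"

context
  fixes q :: "'a :: field_char_0"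
  assumes q0: "q \<noteq> 0" and q1: "q - inverse q \<noteq> 0"
begin

lemma qpowi_add_1: "q powi (y + 1) = q powi y * q" and qpowi_diff_1: "q powi (y - 1) = q powi y / q"
  using q0 by (simp_all add: power_int_add power_int_diff)

lemma qnum_Suc_Suc: "qnum q (y + 2) = (q + inverse q) * qnum q (y + 1) - qnum q y"
proof -
  have "q powi (y + 2) = q powi y * q * q" "q powi (y + 1) = q powi y * q"
    using q0 by (simp_all add: power_int_add power2_eq_square)
  then show ?thesis using q0 q1
    unfolding qnum_def power_int_minus by (simp add: divide_simps) (simp add: algebra_simps)
qed

lemma qx_sum: "qx q (y + 1) + qx q (y - 1) = (q + inverse q) * qx q y"
  using qnum_Suc_Suc[of "y - 1"] by (simp add: qx_def field_simps)

lemma qx_diff: "qx q (y + 1) - qx q (y - 1) = qplus q y"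
proof -
  have "(q - inverse q) * (qx q (y + 1) - qx q (y - 1)) = (q - inverse q) * qplus q y"
    using q0 q1
    unfolding qnum_def qx_def qplus_def qpowi_add_1 qpowi_diff_1 power_int_minus
    by (simp add: divide_simps) (simp add: algebra_simps)
  then show ?thesis using q1 by simp
qed

text \<open>This is \<open>[y + 1] [y - 1] = [y]^2 - 1\<close>, proved by clearing the denominators
  \<open>2 * (q - inverse q)\<close>. Together with \<open>qx_sum\<close> it makes all symmetric
  polynomials in the two neighbours of \<open>qx q y\<close> polynomials in \<open>qx q y\<close>
  itself.\<close>

lemma qx_prod: "qx q (y + 1) * qx q (y - 1) = (qx q y)\<^sup>2 - 1 / 4"
proof -
  have "4 * (q - inverse q)\<^sup>2 * (qx q (y + 1) * qx q (y - 1)) = 4 * (q - inverse q)\<^sup>2 * ((qx q y)\<^sup>2 - 1 / 4)"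
  proof -
    have a: "2 * (q - inverse q) * qx q y = q powi y - inverse (q powi y)" for y
    proof -
      have "2 * k * (z / k / 2) = z" if "k \<noteq> 0" for k z :: 'a
        using that by simp
      with q1 show ?thesis unfolding qx_def qnum_def power_int_minus by blast
    qed
    have "4 * (q - inverse q)\<^sup>2 * (qx q (y + 1) * qx q (y - 1)) =
      (2 * (q - inverse q) * qx q (y + 1)) * (2 * (q - inverse q) * qx q (y - 1))"
      by (simp add: power2_eq_square algebra_simps)
    also have "\<dots> = (q powi y - inverse (q powi y))\<^sup>2 - (q - inverse q)\<^sup>2"
      using q0 unfolding a qpowi_add_1 qpowi_diff_1
      by (simp add: power2_eq_square divide_simps) (simp add: algebra_simps)
    also have "\<dots> = 4 * (q - inverse q)\<^sup>2 * ((qx q y)\<^sup>2 - 1 / 4)"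
      unfolding a[symmetric] by (simp add: power2_eq_square algebra_simps)
    finally show ?thesis .
  qed
  then show ?thesis using q1 by simp
qed

lemma qx_squares_sum:
  "(qx q (y + 1))\<^sup>2 + (qx q (y - 1))\<^sup>2 = ((q + inverse q)\<^sup>2 - 2) * (qx q y)\<^sup>2 + 1 / 2"
proof -
  have "(qx q (y + 1))\<^sup>2 + (qx q (y - 1))\<^sup>2 =
    (qx q (y + 1) + qx q (y - 1))\<^sup>2 - 2 * (qx q (y + 1) * qx q (y - 1))"
    by (simp add: power2_eq_square algebra_simps)
  also have "\<dots> = ((q + inverse q)\<^sup>2 - 2) * (qx q y)\<^sup>2 + 1 / 2"
    unfolding qx_sum qx_prod by (simp add: power2_eq_square algebra_simps)
  finally show ?thesis .
qed

end

lemma qnum_0 [simp]: "qnum q 0 = 0"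
  and qnum_minus: "qnum q (- y) = - qnum q y"
  by (simp_all add: qnum_def divide_simps)

lemma qx_0 [simp]: "qx q 0 = 0" and qx_minus: "qx q (- y) = - qx q y"
  by (simp_all add: qx_def qnum_minus)

lemma qnum_1: "q - inverse q \<noteq> 0 \<Longrightarrow> qnum q 1 = 1"
  by (simp add: qnum_def power_int_minus)

section \<open>Lucas sequences of polynomials\<close>

fun lucas_poly :: "'a :: comm_ring_1 poly \<Rightarrow> 'a poly \<Rightarrow> 'a poly \<Rightarrow> 'a poly \<Rightarrow> nat \<Rightarrow> 'a poly" where
  "lucas_poly s p a b 0 = a"
| "lucas_poly s p a b (Suc 0) = b"
| "lucas_poly s p a b (Suc (Suc j)) = s * lucas_poly s p a b (Suc j) - p * lucas_poly s p a b j"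

lemma degree_lucas_poly:
  assumes "degree a = 0" "degree b \<le> 1" "degree s \<le> 1" "degree p \<le> 2"
  shows "degree (lucas_poly s p a b j) \<le> j"
proof (induction j rule: induct_nat_012)
  case (ge2 j)
  have "degree (s * lucas_poly s p a b (Suc j)) \<le> 1 + Suc j"
    using degree_mult_le[of s "lucas_poly s p a b (Suc j)"] ge2 assms by linarith
  moreover have "degree (p * lucas_poly s p a b j) \<le> 2 + j"
    using degree_mult_le[of p "lucas_poly s p a b j"] ge2 assms by linarith
  ultimately show ?case by (simp add: degree_diff_le)
qed (use assms in auto)


lemma coeff_mult_degree_le:
  fixes f g :: "'a :: comm_semiring_0 poly"
  assumes "degree f \<le> m" "degree g \<le> n"
  shows "coeff (f * g) (m + n) = coeff f m * coeff g n"
proof -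
  have "coeff (f * g) (m + n) = (\<Sum>i\<le>m + n. if i = m then coeff f m * coeff g n else 0)"
    unfolding coeff_mult
  proof (rule sum.cong[OF refl])
    fix i assume "i \<in> {..m + n}"
    then consider "i = m" | "i > m" | "m + n - i > n" by fastforce
    then show "coeff f i * coeff g (m + n - i) = (if i = m then coeff f m * coeff g n else 0)"
      by cases (use assms in \<open>auto simp: coeff_eq_0\<close>)
  qed
  then show ?thesis by simp
qed

text \<open>Only top coefficients contribute at the maximal possible degree, so they obey the same
  recurrence with numbers in place of polynomials. The recurrence of \<open>c\<close> will be that
  of q-numbers.\<close>

lemma coeff_lucas_poly:
  fixes a b s p :: "'a :: comm_ring_1 poly" and c :: "nat \<Rightarrow> 'a"
  assumes "degree a = 0" "degree b \<le> 1" "degree s \<le> 1" "degree p \<le> 2"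
    and "c 0 = coeff a 0" "c 1 = coeff b 1"
    and "\<And>j. c (Suc (Suc j)) = coeff s 1 * c (Suc j) - coeff p 2 * c j"
  shows "coeff (lucas_poly s p a b j) j = c j"
proof (induction j rule: induct_nat_012)
  case (ge2 j)
  then show ?case
    using coeff_mult_degree_le[of s 1 "lucas_poly s p a b (Suc j)" "Suc j"]
      coeff_mult_degree_le[of p 2 "lucas_poly s p a b j" j] degree_lucas_poly[of a b s p] assms
    by simp
qed (use assms in auto)

text \<open>The factor \<open>v\<close> is the divisor of the intended quotient, multiplied over:
  \<open>d j\<close> is a difference of powers and \<open>v\<close> is a - b, or (a - b) x(y) for
  the even exponents.\<close>

lemma poly_lucas_poly:
  fixes z v :: "'a :: comm_ring_1"
  assumes "v * poly a z = d 0" "v * poly b z = d (Suc 0)"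
    and "\<And>j. d (Suc (Suc j)) = poly s z * d (Suc j) - poly p z * d j"
  shows "v * poly (lucas_poly s p a b j) z = d j"
proof -
  have "v * poly (lucas_poly s p a b j) z = d j \<and> v * poly (lucas_poly s p a b (Suc j)) z = d (Suc j)"
  proof (induction j)
    case (Suc j)
    then show ?case by (auto simp: assms(3) right_diff_distrib mult.left_commute[of v])
  qed (use assms in simp)
  then show ?thesis ..
qed

text \<open>Taken with \<open>r = 1\<close> for all exponents and with \<open>r = 2\<close> for the
  exponents of one parity.\<close>

lemma diff_powers_Lucas:
  fixes a b :: "'a :: comm_ring_1"
  shows "a ^ (m + r + r) - b ^ (m + r + r) =
    (a ^ r + b ^ r) * (a ^ (m + r) - b ^ (m + r)) - a ^ r * b ^ r * (a ^ m - b ^ m)"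
  by (simp add: power_add algebra_simps)

text \<open>With a = x(y + 1) and b = x(y - 1), where x is half the q-number, the quotients of
  \<open>a^(j + 1) - b^(j + 1)\<close>, \<open>a^(2 j + 1) - b^(2 j + 1)\<close> by a - b and of \<open>a^(2 j + 2) - b^(2 j + 2)\<close>
  by (a - b) x(y) are polynomials in x(y), respectively in its square, because a + b and a b are;
  they satisfy the Lucas recurrence of a and b, respectively of their squares.\<close>

definition step_poly :: "'a :: field \<Rightarrow> nat \<Rightarrow> 'a poly" where
  "step_poly q = lucas_poly [:0, q + inverse q:] [:- 1 / 4, 0, 1:] 1 [:0, q + inverse q:]"

definition step_poly_even :: "'a :: field \<Rightarrow> nat \<Rightarrow> 'a poly" where
  "step_poly_even q = lucas_poly [:1 / 2, (q + inverse q)\<^sup>2 - 2:] ([:- 1 / 4, 1:]\<^sup>2)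
    1 [:1 / 4, (q + inverse q)\<^sup>2 - 1:]"

definition step_poly_odd :: "'a :: field \<Rightarrow> nat \<Rightarrow> 'a poly" where
  "step_poly_odd q = lucas_poly [:1 / 2, (q + inverse q)\<^sup>2 - 2:] ([:- 1 / 4, 1:]\<^sup>2)
    [:q + inverse q:] [:(q + inverse q) / 2, (q + inverse q) * ((q + inverse q)\<^sup>2 - 2):]"

lemma degree_step_polys:
  "degree (step_poly q j) \<le> j" "degree (step_poly_even q j) \<le> j" "degree (step_poly_odd q j) \<le> j"
  unfolding step_poly_def step_poly_even_def step_poly_odd_def
  by (rule degree_lucas_poly; simp add: power2_eq_square)+

context
  fixes q :: "'a :: field_char_0"
  assumes q0: "q \<noteq> 0" and q1: "q - inverse q \<noteq> 0"
begin

text \<open>Eliminating the odd steps from three consecutive recurrences; the factor equals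
  \<open>q^2 + q^-2\<close>, which is the linear coefficient in the recurrence of squares.\<close>

lemma qnum_4: "qnum q (y + 4) = ((q + inverse q)\<^sup>2 - 2) * qnum q (y + 2) - qnum q y"
proof -
  define s where "s = q + inverse q"
  have "qnum q (y + 4) = s * qnum q (y + 3) - qnum q (y + 2)"
    and "qnum q (y + 3) = s * qnum q (y + 2) - qnum q (y + 1)"
    and "s * qnum q (y + 1) = qnum q (y + 2) + qnum q y"
    using qnum_Suc_Suc[OF q0 q1, of "y + 2"] qnum_Suc_Suc[OF q0 q1, of "y + 1"] qnum_Suc_Suc[OF q0 q1, of y]
    by (simp_all add: s_def add.assoc)
  then show ?thesis
    unfolding s_def[symmetric] by (simp add: power2_eq_square algebra_simps)
qed

lemma qnum_2: "qnum q 2 = q + inverse q" and qnum_3: "qnum q 3 = (q + inverse q)\<^sup>2 - 1"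
  using qnum_Suc_Suc[OF q0 q1, of 0] qnum_Suc_Suc[OF q0 q1, of 1] qnum_1[OF q1]
  by (simp_all add: power2_eq_square)

text \<open>Here the q-factorials originate: a Vandermonde product times these top coefficients is
  the determinant that telescopes, so every strip divides by their product.\<close>

lemma coeff_step_poly: "coeff (step_poly q j) j = qnum q (int j + 1)"
  unfolding step_poly_def
proof (rule coeff_lucas_poly)
  fix i
  show "qnum q (int (Suc (Suc i)) + 1) = coeff [:0, q + inverse q:] 1 * qnum q (int (Suc i) + 1) -
    coeff [:- 1 / 4, 0, 1:] 2 * qnum q (int i + 1)"
    using qnum_Suc_Suc[OF q0 q1, of "int i + 1"] by (simp add: numeral_2_eq_2 add_ac)
qed (use qnum_1[OF q1] qnum_2 in auto)

lemma coeff_step_poly_even: "coeff (step_poly_even q j) j = qnum q (2 * int j + 1)"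
  unfolding step_poly_even_def
proof (rule coeff_lucas_poly)
  fix i
  show "qnum q (2 * int (Suc (Suc i)) + 1) = coeff [:1 / 2, (q + inverse q)\<^sup>2 - 2:] 1 *
    qnum q (2 * int (Suc i) + 1) - coeff ([:- 1 / 4, 1:]\<^sup>2) 2 * qnum q (2 * int i + 1)"
    using qnum_4[of "2 * int i + 1"] by (simp add: power2_eq_square numeral_2_eq_2 algebra_simps)
qed (use qnum_1[OF q1] qnum_3 in \<open>auto simp: power2_eq_square\<close>)

lemma coeff_step_poly_odd: "coeff (step_poly_odd q j) j = qnum q (2 * int j + 2)"
  unfolding step_poly_odd_def
proof (rule coeff_lucas_poly)
  fix i
  show "qnum q (2 * int (Suc (Suc i)) + 2) = coeff [:1 / 2, (q + inverse q)\<^sup>2 - 2:] 1 *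
    qnum q (2 * int (Suc i) + 2) - coeff ([:- 1 / 4, 1:]\<^sup>2) 2 * qnum q (2 * int i + 2)"
    using qnum_4[of "2 * int i + 2"] by (simp add: power2_eq_square numeral_2_eq_2 algebra_simps)
qed (use qnum_2 qnum_4[of 0] in \<open>auto simp: power2_eq_square\<close>)

lemma poly_step_poly:
  "qplus q y * poly (step_poly q j) (qx q y) = qx q (y + 1) ^ (j + 1) - qx q (y - 1) ^ (j + 1)"
  unfolding step_poly_def
proof (rule poly_lucas_poly)
  fix i
  show "qx q (y + 1) ^ (Suc (Suc i) + 1) - qx q (y - 1) ^ (Suc (Suc i) + 1) =
    poly [:0, q + inverse q:] (qx q y) * (qx q (y + 1) ^ (Suc i + 1) - qx q (y - 1) ^ (Suc i + 1)) -
    poly [:- 1 / 4, 0, 1:] (qx q y) * (qx q (y + 1) ^ (i + 1) - qx q (y - 1) ^ (i + 1))"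
    using diff_powers_Lucas[of "qx q (y + 1)" "i + 1" 1 "qx q (y - 1)"]
      qx_sum[OF q0 q1, of y] qx_prod[OF q0 q1, of y]
    by (simp add: power2_eq_square mult.commute)
next
  show "qplus q y * poly [:0, q + inverse q:] (qx q y) =
    qx q (y + 1) ^ (Suc 0 + 1) - qx q (y - 1) ^ (Suc 0 + 1)"
    unfolding qx_diff[OF q0 q1, symmetric] using qx_sum[OF q0 q1, of y, symmetric]
    by (simp add: mult.commute power2_eq_square square_diff_square_factored)
qed (simp add: qx_diff[OF q0 q1])

lemma poly_squares:
  "poly [:1 / 2, (q + inverse q)\<^sup>2 - 2:] ((qx q y)\<^sup>2) = (qx q (y + 1))\<^sup>2 + (qx q (y - 1))\<^sup>2"
  "poly ([:- 1 / 4, 1:]\<^sup>2) ((qx q y)\<^sup>2) = (qx q (y + 1))\<^sup>2 * (qx q (y - 1))\<^sup>2"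
proof -
  show "poly [:1 / 2, (q + inverse q)\<^sup>2 - 2:] ((qx q y)\<^sup>2) = (qx q (y + 1))\<^sup>2 + (qx q (y - 1))\<^sup>2"
    unfolding qx_squares_sum[OF q0 q1] by (simp add: mult.commute)
  have "poly ([:- 1 / 4, 1:]\<^sup>2) ((qx q y)\<^sup>2) = ((qx q y)\<^sup>2 - 1 / 4)\<^sup>2"
    by simp
  then show "poly ([:- 1 / 4, 1:]\<^sup>2) ((qx q y)\<^sup>2) = (qx q (y + 1))\<^sup>2 * (qx q (y - 1))\<^sup>2"
    unfolding qx_prod[OF q0 q1, symmetric] by (simp only: power_mult_distrib)
qed

lemma poly_step_poly_even:
  "qplus q y * poly (step_poly_even q j) ((qx q y)\<^sup>2) =
    qx q (y + 1) ^ (2 * j + 1) - qx q (y - 1) ^ (2 * j + 1)"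
  unfolding step_poly_even_def
proof (rule poly_lucas_poly)
  fix i
  show "qx q (y + 1) ^ (2 * Suc (Suc i) + 1) - qx q (y - 1) ^ (2 * Suc (Suc i) + 1) =
    poly [:1 / 2, (q + inverse q)\<^sup>2 - 2:] ((qx q y)\<^sup>2) *
      (qx q (y + 1) ^ (2 * Suc i + 1) - qx q (y - 1) ^ (2 * Suc i + 1)) -
    poly ([:- 1 / 4, 1:]\<^sup>2) ((qx q y)\<^sup>2) * (qx q (y + 1) ^ (2 * i + 1) - qx q (y - 1) ^ (2 * i + 1))"
    using diff_powers_Lucas[of "qx q (y + 1)" "2 * i + 1" 2 "qx q (y - 1)"]
    unfolding poly_squares by (simp add: add_ac)
next
  let ?a = "qx q (y + 1)" and ?b = "qx q (y - 1)"
  \<comment> \<open>The second initial value is a^2 + a b + b^2, the quotient of a^3 - b^3 by a -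
    b.\<close>
  have "poly [:1 / 4, (q + inverse q)\<^sup>2 - 1:] ((qx q y)\<^sup>2) = (?a + ?b)\<^sup>2 - ?a * ?b"
    unfolding qx_sum[OF q0 q1] qx_prod[OF q0 q1] by (simp add: power_mult_distrib right_diff_distrib mult.commute)
  then show "qplus q y * poly [:1 / 4, (q + inverse q)\<^sup>2 - 1:] ((qx q y)\<^sup>2) =
      ?a ^ (2 * Suc 0 + 1) - ?b ^ (2 * Suc 0 + 1)"
    unfolding qx_diff[OF q0 q1, symmetric]
    by (simp add: power2_eq_square power3_eq_cube algebra_simps)
qed (simp add: qx_diff[OF q0 q1])

lemma poly_step_poly_odd:
  "qplus q y * qx q y * poly (step_poly_odd q j) ((qx q y)\<^sup>2) =
    qx q (y + 1) ^ (2 * j + 2) - qx q (y - 1) ^ (2 * j + 2)"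
  unfolding step_poly_odd_def
proof (rule poly_lucas_poly)
  fix i
  show "qx q (y + 1) ^ (2 * Suc (Suc i) + 2) - qx q (y - 1) ^ (2 * Suc (Suc i) + 2) =
    poly [:1 / 2, (q + inverse q)\<^sup>2 - 2:] ((qx q y)\<^sup>2) *
      (qx q (y + 1) ^ (2 * Suc i + 2) - qx q (y - 1) ^ (2 * Suc i + 2)) -
    poly ([:- 1 / 4, 1:]\<^sup>2) ((qx q y)\<^sup>2) * (qx q (y + 1) ^ (2 * i + 2) - qx q (y - 1) ^ (2 * i + 2))"
    using diff_powers_Lucas[of "qx q (y + 1)" "2 * i + 2" 2 "qx q (y - 1)"]
    unfolding poly_squares by (simp add: add_ac)
next
  let ?a = "qx q (y + 1)" and ?b = "qx q (y - 1)"
  have *: "qplus q y * qx q y * (q + inverse q) = ?a\<^sup>2 - ?b\<^sup>2"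
    unfolding qx_diff[OF q0 q1, symmetric] using qx_sum[OF q0 q1, of y, symmetric]
    by (simp add: mult_ac power2_eq_square square_diff_square_factored)
  then show "qplus q y * qx q y * poly [:q + inverse q:] ((qx q y)\<^sup>2) =
      ?a ^ (2 * 0 + 2) - ?b ^ (2 * 0 + 2)"
    by (simp add: power2_eq_square)
  have "poly [:(q + inverse q) / 2, (q + inverse q) * ((q + inverse q)\<^sup>2 - 2):] ((qx q y)\<^sup>2) =
    (q + inverse q) * (?a\<^sup>2 + ?b\<^sup>2)"
    unfolding qx_squares_sum[OF q0 q1] by (simp add: algebra_simps)
  then have "qplus q y * qx q y * poly [:(q + inverse q) / 2, (q + inverse q) * ((q + inverse q)\<^sup>2 - 2):] ((qx q y)\<^sup>2)
    = (qplus q y * qx q y * (q + inverse q)) * (?a\<^sup>2 + ?b\<^sup>2)"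
    by (simp only: mult.assoc)
  also have "\<dots> = ?a ^ (2 * Suc 0 + 2) - ?b ^ (2 * Suc 0 + 2)"
    unfolding * by (simp add: power2_eq_square numeral_eq_Suc algebra_simps)
  finally show "qplus q y * qx q y *
      poly [:(q + inverse q) / 2, (q + inverse q) * ((q + inverse q)\<^sup>2 - 2):] ((qx q y)\<^sup>2) =
      ?a ^ (2 * Suc 0 + 2) - ?b ^ (2 * Suc 0 + 2)" .
qed

end

section \<open>Tilings by sets\<close>

text \<open>The family of tiles is arbitrary because three of them occur: all lozenges, the lozenges
  that respect the barriers, and the dominoes on a line.\<close>

definition tilings_of :: "'a set set \<Rightarrow> 'a set \<Rightarrow> 'a set set set" where
  "tilings_of \<Lambda> U = {T. T \<subseteq> \<Lambda> \<and> pairwise disjnt T \<and> \<Union> T = U}"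

definition tilings_sum :: "'a set set \<Rightarrow> ('a set \<Rightarrow> 'b :: comm_semiring_1) \<Rightarrow> 'a set \<Rightarrow> 'b" where
  "tilings_sum \<Lambda> w U = (\<Sum>T\<in>tilings_of \<Lambda> U. \<Prod>l\<in>T. w l)"

lemma finite_tilings_of: "finite U \<Longrightarrow> finite (tilings_of \<Lambda> U)"
  by (rule finite_subset[of _ "Pow (Pow U)"]) (auto simp: tilings_of_def)

lemma tilings_of_empty: "{} \<notin> \<Lambda> \<Longrightarrow> tilings_of \<Lambda> {} = {{}}"
  by (auto simp: tilings_of_def)

lemma tilings_sum_empty: "{} \<notin> \<Lambda> \<Longrightarrow> tilings_sum \<Lambda> w {} = 1"
  by (simp add: tilings_sum_def tilings_of_empty)

lemma tilings_sum_cong: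
  assumes "{l \<in> \<Lambda>. l \<subseteq> U} = {l \<in> \<Lambda>'. l \<subseteq> U}" "\<And>l. l \<in> \<Lambda> \<Longrightarrow> l \<subseteq> U \<Longrightarrow> w l = w' l"
  shows "tilings_sum \<Lambda> w U = tilings_sum \<Lambda>' w' U"
proof -
  have "tilings_of \<Lambda> U = tilings_of \<Lambda>' U"
    using assms(1) unfolding tilings_of_def by blast
  moreover have "(\<Prod>l\<in>T. w l) = (\<Prod>l\<in>T. w' l)" if "T \<in> tilings_of \<Lambda> U" for T
    using that assms(2) by (intro prod.cong) (auto simp: tilings_of_def)
  ultimately show ?thesis
    unfolding tilings_sum_def by (intro sum.cong) auto
qed

text \<open>Serves both the reflections of the lattice and the embedding of a line of integers as a
  column of triangles.\<close>

lemma tilings_sum_image: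
  assumes f: "inj f" and w: "\<And>l. l \<in> \<Lambda> \<Longrightarrow> w' (f ` l) = w l"
  shows "tilings_sum ((`) f ` \<Lambda>) w' (f ` U) = tilings_sum \<Lambda> w U"
proof -
  have inj_image: "inj ((`) g)" if "inj g" for g :: "'x \<Rightarrow> 'y"
    using that by (meson injI inj_image_eq_iff)
  have inj: "inj ((`) f)" "inj ((`) ((`) f))"
    using inj_image[OF f] inj_image[OF inj_image[OF f]] by auto
  have "tilings_of ((`) f ` \<Lambda>) (f ` U) = (`) ((`) f) ` tilings_of \<Lambda> U"
  proof (intro equalityI subsetI)
    fix T assume T: "T \<in> tilings_of ((`) f ` \<Lambda>) (f ` U)"
    then obtain S where S: "S \<subseteq> \<Lambda>" "T = (`) f ` S"
      unfolding tilings_of_def by (auto simp: subset_image_iff)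
    have "pairwise disjnt S"
    proof (rule pairwiseI)
      fix a b assume ab: "a \<in> S" "b \<in> S" "a \<noteq> b"
      then have "disjnt (f ` a) (f ` b)"
        using T S inj(1) unfolding tilings_of_def by (auto simp: pairwise_def inj_eq)
      then show "disjnt a b" by (auto simp: disjnt_def)
    qed
    moreover have "f ` \<Union> S = f ` U"
      using T unfolding tilings_of_def S(2) by (simp add: image_Union)
    then have "\<Union> S = U" using f by (simp add: inj_image_eq_iff)
    ultimately show "T \<in> (`) ((`) f) ` tilings_of \<Lambda> U"
      using S by (auto simp: tilings_of_def)
  next
    fix T assume "T \<in> (`) ((`) f) ` tilings_of \<Lambda> U"
    then obtain S where S: "S \<subseteq> \<Lambda>" "pairwise disjnt S" "\<Union> S = U" "T = (`) f ` S"
      by (auto simp: tilings_of_def)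
    then have "T \<subseteq> (`) f ` \<Lambda>" "\<Union> T = f ` U" by (auto simp: image_Union)
    moreover have "pairwise disjnt T"
      unfolding S(4) pairwise_image
    proof (rule pairwiseI, rule impI)
      fix a b assume "a \<in> S" "b \<in> S" "a \<noteq> b"
      then have "a \<inter> b = {}" using S(2) by (auto simp: pairwise_def disjnt_def)
      then show "disjnt (f ` a) (f ` b)" by (simp add: disjnt_def flip: image_Int[OF f])
    qed
    ultimately show "T \<in> tilings_of ((`) f ` \<Lambda>) (f ` U)"
      by (auto simp: tilings_of_def)
  qed
  then have "tilings_sum ((`) f ` \<Lambda>) w' (f ` U) = (\<Sum>T\<in>tilings_of \<Lambda> U. \<Prod>l\<in>(`) f ` T. w' l)"
    unfolding tilings_sum_def using inj(2)
    by (simp add: sum.reindex inj_on_subset)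
  also have "\<dots> = tilings_sum \<Lambda> w U"
    unfolding tilings_sum_def
  proof (rule sum.cong[OF refl])
    fix T assume "T \<in> tilings_of \<Lambda> U"
    then have "T \<subseteq> \<Lambda>" by (auto simp: tilings_of_def)
    then show "(\<Prod>l\<in>(`) f ` T. w' l) = (\<Prod>l\<in>T. w l)"
      using w inj(1) by (subst prod.reindex) (auto intro: inj_on_subset intro!: prod.cong)
  qed
  finally show ?thesis .
qed

text \<open>A tiling amounts to its set \<open>C\<close> of tiles meeting both parts together with
  independent tilings of what \<open>C\<close> leaves of each part. A set \<open>C\<close> that
  cannot be completed contributes 0 by itself.\<close>

lemma tilings_sum_split:
  assumes fin: "finite P" "finite Q" and PQ: "P \<inter> Q = {}" and ne: "{} \<notin> \<Lambda>"
  shows "tilings_sum \<Lambda> w (P \<union> Q) =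
    (\<Sum>C\<in>{C. C \<subseteq> {l \<in> \<Lambda>. l \<subseteq> P \<union> Q \<and> l \<inter> P \<noteq> {} \<and> l \<inter> Q \<noteq> {}} \<and> pairwise disjnt C}.
      (\<Prod>l\<in>C. w l) * (tilings_sum \<Lambda> w (P - \<Union> C) * tilings_sum \<Lambda> w (Q - \<Union> C)))"
    (is "_ = sum _ ?\<C>")
proof -
  define X where "X = {l \<in> \<Lambda>. l \<subseteq> P \<union> Q \<and> l \<inter> P \<noteq> {} \<and> l \<inter> Q \<noteq> {}}"
  have \<C>: "?\<C> = {C. C \<subseteq> X \<and> pairwise disjnt C}" by (simp add: X_def)
  have "finite X" by (rule finite_subset[of _ "Pow (P \<union> Q)"]) (use fin in \<open>auto simp: X_def\<close>)
  then have fin\<C>: "finite ?\<C>" unfolding \<C> by (auto intro: finite_subset[of _ "Pow X"])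
  define \<S> where "\<S> = Sigma ?\<C> (\<lambda>C. tilings_of \<Lambda> (P - \<Union> C) \<times> tilings_of \<Lambda> (Q - \<Union> C))"
  have "(\<Sum>C\<in>?\<C>. (\<Prod>l\<in>C. w l) * (tilings_sum \<Lambda> w (P - \<Union> C) * tilings_sum \<Lambda> w (Q - \<Union> C))) =
    (\<Sum>C\<in>?\<C>. \<Sum>(T1, T2)\<in>tilings_of \<Lambda> (P - \<Union> C) \<times> tilings_of \<Lambda> (Q - \<Union> C).
      (\<Prod>l\<in>C. w l) * ((\<Prod>l\<in>T1. w l) * (\<Prod>l\<in>T2. w l)))"
    unfolding tilings_sum_def sum_product
    by (simp add: sum.cartesian_product sum_distrib_left case_prod_unfold)
  also have "\<dots> = (\<Sum>(C, T1, T2)\<in>\<S>. (\<Prod>l\<in>C. w l) * ((\<Prod>l\<in>T1. w l) * (\<Prod>l\<in>T2. w l)))"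
    unfolding \<S>_def
    by (subst sum.Sigma) (use fin fin\<C> in \<open>auto intro!: finite_tilings_of\<close>)
  also have "\<dots> = tilings_sum \<Lambda> w (P \<union> Q)"
    unfolding tilings_sum_def
  proof (rule sum.reindex_bij_witness
      [where i = "\<lambda>T. (T \<inter> X, {l \<in> T. l \<subseteq> P}, {l \<in> T. l \<subseteq> Q})" and j = "\<lambda>(C, T1, T2). C \<union> T1 \<union> T2"])
    fix t assume "t \<in> \<S>"
    then obtain C T1 T2 where t: "t = (C, T1, T2)" "C \<subseteq> X" "pairwise disjnt C"
      and T1: "T1 \<subseteq> \<Lambda>" "pairwise disjnt T1" "\<Union> T1 = P - \<Union> C"
      and T2: "T2 \<subseteq> \<Lambda>" "pairwise disjnt T2" "\<Union> T2 = Q - \<Union> C"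
      unfolding \<S>_def \<C> by (auto simp: tilings_of_def)
    have T1': "l \<subseteq> P" "l \<noteq> {}" "l \<inter> \<Union> C = {}" if "l \<in> T1" for l using that T1 ne by auto
    have T2': "l \<subseteq> Q" "l \<noteq> {}" "l \<inter> \<Union> C = {}" if "l \<in> T2" for l using that T2 ne by auto
    have C': "l \<inter> P \<noteq> {}" "l \<inter> Q \<noteq> {}" "l \<subseteq> P \<union> Q" "l \<in> \<Lambda>" if "l \<in> C" for l using that t by (auto simp: X_def)
    \<comment> \<open>A nonempty tile lies in at most one of \<open>P\<close> and \<open>Q\<close>,
      so the three families can be recovered from their union.\<close>
    have sides: "l \<notin> X" "\<not> l \<subseteq> Q" if "l \<in> T1" for l
      using T1'(1,2)[OF that] PQ by (auto simp: X_def)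
    have sides': "l \<notin> X" "\<not> l \<subseteq> P" if "l \<in> T2" for l
      using T2'(1,2)[OF that] PQ by (auto simp: X_def)
    have sides'': "\<not> l \<subseteq> P" "\<not> l \<subseteq> Q" if "l \<in> C" for l
      using C'(1,2)[OF that] PQ by auto
    have "(C \<union> T1 \<union> T2) \<inter> X = C"
      using t(2) sides(1) sides'(1) by blast
    moreover have "{l \<in> C \<union> T1 \<union> T2. l \<subseteq> P} = T1"
      using T1'(1) sides'(2) sides''(1) by blast
    moreover have "{l \<in> C \<union> T1 \<union> T2. l \<subseteq> Q} = T2"
      using T2'(1) sides(2) sides''(2) by blast
    ultimately
    show "(\<lambda>T. (T \<inter> X, {l \<in> T. l \<subseteq> P}, {l \<in> T. l \<subseteq> Q})) ((\<lambda>(C, T1, T2). C \<union> T1 \<union> T2) t) = t"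
      using t(1) by simp
    have disj: "C \<inter> T1 = {}" "(C \<union> T1) \<inter> T2 = {}"
      using T1'(1) T2'(1) sides(2) sides''(1,2) unfolding disjoint_iff Un_iff by metis+
    have "pairwise disjnt (C \<union> T1 \<union> T2)"
    proof (rule pairwiseI)
      fix a b assume "a \<in> C \<union> T1 \<union> T2" "b \<in> C \<union> T1 \<union> T2" "a \<noteq> b"
      moreover have "disjnt a b" if "a \<in> T1" "b \<in> T2" for a b
        using T1'(1)[OF that(1)] T2'(1)[OF that(2)] PQ by (auto simp: disjnt_def)
      moreover have "disjnt a b" if "a \<in> T1" "b \<in> C" for a b
        using T1'(3)[OF that(1)] that(2) by (auto simp: disjnt_def)
      moreover have "disjnt a b" if "a \<in> T2" "b \<in> C" for a b
        using T2'(3)[OF that(1)] that(2) by (auto simp: disjnt_def)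
      ultimately show "disjnt a b"
        using t(3) T1(2) T2(2) unfolding pairwise_def Un_iff by (metis disjnt_sym)
    qed
    moreover
    have CU: "\<Union> C \<subseteq> P \<union> Q" "C \<subseteq> \<Lambda>" using t(2) by (auto simp: X_def)
    then have "\<Union> (C \<union> T1 \<union> T2) = P \<union> Q"
      using CU(1) by (simp only: Union_Un_distrib T1(3) T2(3)) blast
    ultimately show "(\<lambda>(C, T1, T2). C \<union> T1 \<union> T2) t \<in> tilings_of \<Lambda> (P \<union> Q)"
      using T1(1) T2(1) CU(2) t(1) by (simp add: tilings_of_def)
    have "finite (\<Union> C)" "finite (\<Union> T1)" "finite (\<Union> T2)"
      using fin CU(1) T1(3) T2(3) by (auto intro: finite_subset[of "\<Union> C" "P \<union> Q"])
    then have "finite C" "finite T1" "finite T2"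
      by (blast intro: finite_UnionD)+
    then show "(\<Prod>l\<in>(\<lambda>(C, T1, T2). C \<union> T1 \<union> T2) t. w l) =
        (case t of (C, T1, T2) \<Rightarrow> (\<Prod>l\<in>C. w l) * ((\<Prod>l\<in>T1. w l) * (\<Prod>l\<in>T2. w l)))"
      using t(1) disj by (simp add: prod.union_disjoint mult.assoc)
  next
    fix T assume "T \<in> tilings_of \<Lambda> (P \<union> Q)"
    then have T: "T \<subseteq> \<Lambda>" "pairwise disjnt T" "\<Union> T = P \<union> Q" by (auto simp: tilings_of_def)
    have cases: "l \<in> X \<or> l \<subseteq> P \<or> l \<subseteq> Q" if "l \<in> T" for l using that T by (auto simp: X_def)
    show "(\<lambda>(C, T1, T2). C \<union> T1 \<union> T2) (T \<inter> X, {l \<in> T. l \<subseteq> P}, {l \<in> T. l \<subseteq> Q}) = T"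
      using cases by auto
    have tile: "{l \<in> T. l \<subseteq> A} \<in> tilings_of \<Lambda> (A - \<Union> (T \<inter> X))" if A: "A = P \<or> A = Q" for A
    proof -
      have "\<Union> {l \<in> T. l \<subseteq> A} = A - \<Union> (T \<inter> X)"
      proof (intro equalityI subsetI)
        fix x assume "x \<in> \<Union> {l \<in> T. l \<subseteq> A}"
        then obtain l where l: "l \<in> T" "l \<subseteq> A" "x \<in> l" by auto
        have "x \<notin> l'" if "l' \<in> T \<inter> X" for l'
        proof
          assume "x \<in> l'"
          then have "l' = l" using that l T(2) by (auto simp: pairwise_def disjnt_def)
          then show False using that l A PQ by (auto simp: X_def)
        qed
        with l show "x \<in> A - \<Union> (T \<inter> X)" by auto
      next
        fix x assume x: "x \<in> A - \<Union> (T \<inter> X)"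
        then obtain l where l: "l \<in> T" "x \<in> l" using T(3) A by blast
        with x cases[OF l(1)] A PQ show "x \<in> \<Union> {l \<in> T. l \<subseteq> A}" by auto
      qed
      moreover have "pairwise disjnt {l \<in> T. l \<subseteq> A}" using T(2) by (auto simp: pairwise_def)
      ultimately show ?thesis using T(1) by (auto simp: tilings_of_def)
    qed
    have "pairwise disjnt (T \<inter> X)" using T(2) by (auto simp: pairwise_def)
    then show "(T \<inter> X, {l \<in> T. l \<subseteq> P}, {l \<in> T. l \<subseteq> Q}) \<in> \<S>"
      using tile unfolding \<S>_def \<C> by auto
  qed
  finally show ?thesis ..
qed

lemma tilings_sum_disjoint_Un:
  assumes "finite P" "finite Q" "P \<inter> Q = {}" "{} \<notin> \<Lambda>"
    and "\<And>l. l \<in> \<Lambda> \<Longrightarrow> l \<subseteq> P \<union> Q \<Longrightarrow> l \<inter> P \<noteq> {} \<Longrightarrow> l \<inter> Q = {}"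
  shows "tilings_sum \<Lambda> w (P \<union> Q) = tilings_sum \<Lambda> w P * tilings_sum \<Lambda> w Q"
proof -
  have no_crossing: "{l \<in> \<Lambda>. l \<subseteq> P \<union> Q \<and> l \<inter> P \<noteq> {} \<and> l \<inter> Q \<noteq> {}} = {}"
    using assms(5) by blast
  have "{C. C \<subseteq> {} \<and> pairwise disjnt C} = {{} :: 'a set set}"
    by auto
  then show ?thesis by (simp add: tilings_sum_split[OF assms(1-4)] no_crossing)
qed

section \<open>Domino tilings of a strip and interlacing\<close>

definition dominoes :: "int set set" where
  "dominoes = range (\<lambda>y. {y, y + 1})"

definition tileable :: "int set \<Rightarrow> bool" where
  "tileable U \<longleftrightarrow> tilings_of dominoes U \<noteq> {}"

text \<open>The smallest element can only be the lower end of its domino; removing this domino gives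
  an induction. Hence a column between two sets of dents contributes 0 or 1.\<close>

lemma domino_tiling_unique:
  assumes "finite U" "T \<in> tilings_of dominoes U" "T' \<in> tilings_of dominoes U"
  shows "T = T'"
  using assms
proof (induction "card U" arbitrary: U T T' rule: less_induct)
  case less
  show ?case
  proof (cases "U = {}")
    case True
    with less.prems show ?thesis by (auto simp: tilings_of_def dominoes_def)
  next
    case False
    define d where "d = {Min U, Min U + 1}"
    have *: "d \<in> S \<and> S - {d} \<in> tilings_of dominoes (U - d)" if S: "S \<in> tilings_of dominoes U" for S
    proof -
      have "Min U \<in> \<Union> S" using S False less.prems(1) by (simp add: tilings_of_def)
      then obtain y where y: "{y, y + 1} \<in> S" "Min U \<in> {y, y + 1}"
        using S by (auto simp: tilings_of_def dominoes_def)
      have "y \<in> U" using S y by (auto simp: tilings_of_def)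
      then have "Min U \<le> y" using less.prems(1) by simp
      with y have d: "d \<in> S" by (auto simp: d_def)
      moreover have "\<Union> (S - {d}) = U - d"
        using S d by (auto simp: tilings_of_def pairwise_def disjnt_def)
      moreover have "pairwise disjnt (S - {d})" using S by (auto simp: tilings_of_def pairwise_def)
      ultimately show ?thesis using S by (auto simp: tilings_of_def)
    qed
    have "card (U - d) < card U"
    proof (rule psubset_card_mono[OF less.prems(1)])
      have "Min U \<in> U" using less.prems(1) False by simp
      then show "U - d \<subset> U" unfolding d_def by blast
    qed
    then have "T - {d} = T' - {d}"
      using less.hyps[of "U - d"] less.prems * by blast
    with * less.prems show ?thesis by blast
  qed
qed

lemma tileable_Un: "tileable A \<Longrightarrow> tileable B \<Longrightarrow> A \<inter> B = {} \<Longrightarrow> tileable (A \<union> B)"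
proof -
  assume "tileable A" "tileable B" and AB: "A \<inter> B = {}"
  then obtain S T where S: "S \<subseteq> dominoes" "pairwise disjnt S" "\<Union> S = A"
    and T: "T \<subseteq> dominoes" "pairwise disjnt T" "\<Union> T = B"
    unfolding tileable_def tilings_of_def by blast
  have "disjnt a b" if "a \<in> S" "b \<in> T" for a b
    using that AB S(3) T(3) by (auto simp: disjnt_def)
  then have "pairwise disjnt (S \<union> T)"
    using S(2) T(2) unfolding pairwise_def by (auto simp: disjnt_sym)
  then have "S \<union> T \<in> tilings_of dominoes (A \<union> B)"
    using S T by (auto simp: tilings_of_def)
  then show ?thesis by (auto simp: tileable_def)
qed

lemma tileable_empty: "tileable {}"
proof -
  have "{} \<notin> dominoes" by (auto simp: dominoes_def)
  then show ?thesis by (simp add: tileable_def tilings_of_empty)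
qed

lemma tileable_interval:
  assumes "even (b - a)" "a \<le> b"
  shows "tileable {a..<b}"
proof -
  define n where "n = nat ((b - a) div 2)"
  have "b = a + 2 * int n"
    using assms by (simp add: n_def)
  moreover have "tileable {a..<a + 2 * int n}"
  proof (induction n)
    case (Suc n)
    have "{{a + 2 * int n, a + 2 * int n + 1}} \<in> tilings_of dominoes {a + 2 * int n, a + 2 * int n + 1}"
      by (auto simp: tilings_of_def dominoes_def)
    then have "tileable {a + 2 * int n, a + 2 * int n + 1}" by (auto simp: tileable_def)
    with Suc have "tileable ({a..<a + 2 * int n} \<union> {a + 2 * int n, a + 2 * int n + 1})"
      by (rule tileable_Un) auto
    also have "{a..<a + 2 * int n} \<union> {a + 2 * int n, a + 2 * int n + 1} = {a..<a + 2 * int (Suc n)}"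
      by auto
    finally show ?case .
  qed (simp add: tileable_empty)
  ultimately show ?thesis by simp
qed

text \<open>No domino reaches across a hole, so a tiling falls apart into its restrictions below and
  above.\<close>

lemma tileable_restrict:
  assumes "tileable U" "e \<notin> U"
  shows "tileable (U \<inter> {..<e})" "tileable (U \<inter> {e<..})"
proof -
  obtain T where T: "T \<subseteq> dominoes" "pairwise disjnt T" "\<Union> T = U"
    using assms(1) unfolding tileable_def tilings_of_def by blast
  have side: "l \<subseteq> {..<e} \<or> l \<subseteq> {e<..}" if l: "l \<in> T" for l
  proof -
    obtain y where y: "l = {y, y + 1}" using l T(1) by (auto simp: dominoes_def)
    then have "y \<in> U" "y + 1 \<in> U" using l T(3) by auto
    then have "y \<noteq> e" "y + 1 \<noteq> e" using assms(2) by auto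
    then show ?thesis using y by auto
  qed
  have "{l \<in> T. l \<subseteq> A} \<in> tilings_of dominoes (U \<inter> A)" if A: "A = {..<e} \<or> A = {e<..}" for A
  proof -
    have "\<Union> {l \<in> T. l \<subseteq> A} = U \<inter> A"
    proof (intro equalityI subsetI)
      fix x assume x: "x \<in> U \<inter> A"
      then obtain l where "l \<in> T" "x \<in> l" using T(3) by blast
      with side[of l] A x show "x \<in> \<Union> {l \<in> T. l \<subseteq> A}" by fastforce
    qed (use T(3) in auto)
    then show ?thesis using T by (auto simp: tilings_of_def pairwise_def)
  qed
  then show "tileable (U \<inter> {..<e})" "tileable (U \<inter> {e<..})"
    unfolding tileable_def by blast+
qed

section \<open>Counting dents by the two-colouring of a column\<close>

definition parity_sign :: "int \<Rightarrow> int" where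
  "parity_sign y = (if even y then 1 else - 1)"

lemma tileable_balanced:
  assumes "tileable U" "finite U"
  shows "(\<Sum>y\<in>U. parity_sign y) = 0"
proof -
  obtain T where T: "T \<subseteq> dominoes" "pairwise disjnt T" "\<Union> T = U"
    using assms(1) unfolding tileable_def tilings_of_def by blast
  have "(\<Sum>y\<in>\<Union> T. parity_sign y) = (\<Sum>l\<in>T. \<Sum>y\<in>l. parity_sign y)"
    unfolding T(3) using T by (subst T(3)[symmetric], subst sum.Union_disjoint)
      (auto simp: dominoes_def pairwise_def disjnt_def)
  also have "\<dots> = 0"
    using T(1) by (intro sum.neutral) (auto simp: dominoes_def parity_sign_def)
  finally show ?thesis using T(3) by simp
qed

lemma parity_sign_cong: "even (a - b) \<Longrightarrow> parity_sign a = parity_sign b"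
  and parity_sign_odd: "odd (a - b) \<Longrightarrow> parity_sign a = - parity_sign b"
  by (auto simp: parity_sign_def)

lemma parity_sign_nonzero: "parity_sign a \<noteq> 0"
  by (simp add: parity_sign_def)

text \<open>The tiled rest is balanced between even and odd rows, so the imbalance of the full
  interval counts the dents, all of which have one parity.\<close>

lemma card_removed:
  assumes "tileable (I - D)" "finite I" "\<And>y. y \<in> D \<Longrightarrow> odd (y - a)"
  shows "(\<Sum>y\<in>I. parity_sign y) = - int (card (D \<inter> I)) * parity_sign a"
proof -
  have "(\<Sum>y\<in>I. parity_sign y) = (\<Sum>y\<in>I - D. parity_sign y) + (\<Sum>y\<in>D \<inter> I. parity_sign y)"
    using assms(2) by (subst sum.union_disjoint[symmetric]) (auto intro!: sum.cong)
  also have "(\<Sum>y\<in>I - D. parity_sign y) = 0"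
    using assms by (intro tileable_balanced) auto
  also have "(\<Sum>y\<in>D \<inter> I. parity_sign y) = (\<Sum>y\<in>D \<inter> I. - parity_sign a)"
    using assms(3) by (intro sum.cong) (auto intro: parity_sign_odd)
  finally show ?thesis by simp
qed

lemma sum_parity_sign_interval: "even (b - a) \<Longrightarrow> a \<le> b \<Longrightarrow> (\<Sum>y\<in>{a..<b}. parity_sign y) = 0"
  by (rule tileable_balanced[OF tileable_interval]) auto

lemma sum_parity_sign_open_interval:
  assumes "even (b - a)" "a < b"
  shows "(\<Sum>y\<in>{a<..<b}. parity_sign y) = - parity_sign a"
proof -
  have "{a..<b} = insert a {a<..<b}" using assms by auto
  with sum_parity_sign_interval[of b a] assms show ?thesis by simp
qed

text \<open>The possible rows of the dent between two neighbouring dents of the other line. The two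
  sides of a column carry triangles of opposite orientation, hence the opposite parity.\<close>

definition gap :: "(nat \<Rightarrow> int) \<Rightarrow> nat \<Rightarrow> int set" where
  "gap e i = {y. e i < y \<and> y < e (Suc i) \<and> odd (y - e i)}"

lemma finite_gap: "finite (gap e i)"
  by (rule finite_subset[of _ "{e i..e (Suc i)}"]) (auto simp: gap_def)

lemma interlacing_strict:
  assumes "\<And>i. i < k \<Longrightarrow> d i \<in> gap e i" "i < j" "j < k"
  shows "d i < d j"
  using assms(2,3)
proof (induction j)
  case (Suc j)
  have "d j < d (Suc j)"
    using assms(1)[of j] assms(1)[of "Suc j"] Suc.prems by (auto simp: gap_def)
  with Suc show ?case by (cases "i = j") auto
qed simp

context
  fixes e :: "nat \<Rightarrow> int" and k :: nat and lo hi :: int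
  assumes mono: "\<And>i. i < k \<Longrightarrow> e i < e (Suc i)"
    and parity: "\<And>i. i \<le> k \<Longrightarrow> even (e i - lo)"
    and lo: "lo \<le> e 0" and hi: "e k \<le> hi" "even (hi - lo)"
begin

lemma e_strict: "i < j \<Longrightarrow> j \<le> k \<Longrightarrow> e i < e j"
proof (induction j)
  case (Suc j)
  then show ?case using mono[of j] by (cases "i = j") auto
qed simp

lemma e_mono: "i \<le> j \<Longrightarrow> j \<le> k \<Longrightarrow> e i \<le> e j"
  using e_strict[of i j] by (cases "i = j") auto

lemma e_not_between: "i < k \<Longrightarrow> j \<le> k \<Longrightarrow> \<not> (e i < e j \<and> e j < e (Suc i))"
  using e_mono[of j i] e_mono[of "Suc i" j] by (cases "j \<le> i") auto

text \<open>The pieces between consecutive holes, below the first and above the last all have even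
  length, because holes alternate in parity and both ends of the column have the parity of
  \<open>e\<close>.\<close>

lemma interlacing_tileable:
  assumes d: "\<And>i. i < k \<Longrightarrow> d i \<in> gap e i"
  shows "tileable ({lo..hi} - e ` {..k} - d ` {..<k})"
proof -
  have "tileable ({lo..<e j} - e ` {..<j} - d ` {..<j})" if "j \<le> k" for j
    using that
  proof (induction j)
    case 0
    then show ?case using tileable_interval[of "e 0" lo] parity[of 0] lo by simp
  next
    case (Suc j)
    have dj: "e j < d j" "d j < e (Suc j)" "odd (d j - e j)" using d[of j] Suc.prems by (auto simp: gap_def)
    have below: "e i < e j" "d i < e j" if "i < j" for i
      using e_strict[of i j] e_mono[of "Suc i" j] d[of i] Suc.prems that by (auto simp: gap_def)
    have "even (e (Suc j) - e j)"
      using parity[of j] parity[of "Suc j"] Suc.prems by auto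
    then have "tileable ({lo..<e j} - e ` {..<j} - d ` {..<j} \<union> {e j + 1..<d j} \<union> {d j + 1..<e (Suc j)})"
      using Suc dj by (intro tileable_Un tileable_interval Suc.IH) auto
    moreover have "{lo..<e j} - e ` {..<j} - d ` {..<j} \<union> {e j + 1..<d j} \<union> {d j + 1..<e (Suc j)} =
      {lo..<e (Suc j)} - e ` {..<Suc j} - d ` {..<Suc j}"
      using dj below e_mono[of 0 j] lo Suc.prems
      by (auto simp: lessThan_Suc dest: below)
    ultimately show ?case by simp
  qed
  from this[of k] have "tileable ({lo..<e k} - e ` {..<k} - d ` {..<k} \<union> {e k + 1..<hi + 1})"
    using hi parity[of k] by (intro tileable_Un tileable_interval) auto
  moreover have "{lo..<e k} - e ` {..<k} - d ` {..<k} \<union> {e k + 1..<hi + 1} =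
    {lo..hi} - e ` {..k} - d ` {..<k}"
  proof -
    have dk: "d i < e k" if "i < k" for i
      using e_mono[of "Suc i" k] d[of i] that by (auto simp: gap_def)
    show ?thesis
      using e_mono[of 0 k] lo hi
      by (auto simp: lessThan_Suc_atMost[symmetric] lessThan_Suc dest: dk e_strict[of _ k, simplified])
  qed
  ultimately show ?thesis by simp
qed

text \<open>The open interval between two consecutive \<open>e\<close> has one row too many of the
  opposite parity, which forces exactly one element of \<open>D\<close> there. The parts of the
  column below \<open>e 0\<close> and above \<open>e k\<close> are balanced already and admit
  none.\<close>

lemma tileable_interlacing:
  assumes D: "D \<subseteq> {lo..hi}" "\<And>y. y \<in> D \<Longrightarrow> odd (y - lo)"
    and tile: "tileable ({lo..hi} - e ` {..k} - D)"
  shows "\<exists>d \<in> PiE {..<k} (gap e). D = d ` {..<k}"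
proof -
  let ?U = "{lo..hi} - e ` {..k} - D"
  have one: "card (D \<inter> {e i<..<e (Suc i)}) = 1" if i: "i < k" for i :: nat
  proof -
    have "tileable (?U \<inter> {e i<..} \<inter> {..<e (Suc i)})"
      using i by (intro tileable_restrict tile) auto
    also have "?U \<inter> {e i<..} \<inter> {..<e (Suc i)} = {e i<..<e (Suc i)} - D"
      using e_not_between[OF i] e_mono[of 0 i] e_mono[of "Suc i" k] lo hi i by auto
    finally have "(\<Sum>y\<in>{e i<..<e (Suc i)}. parity_sign y) =
        - int (card (D \<inter> {e i<..<e (Suc i)})) * parity_sign lo"
      by (rule card_removed) (use D in auto)
    moreover have "even (e (Suc i) - e i)" using parity[of i] parity[of "Suc i"] i by auto
    ultimately have "parity_sign lo = int (card (D \<inter> {e i<..<e (Suc i)})) * parity_sign lo"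
      using mono[OF i] sum_parity_sign_open_interval[of "e (Suc i)" "e i"]
        parity_sign_cong[OF parity[of i]] i by auto
    then show ?thesis using parity_sign_nonzero[of lo] by simp
  qed
  have "card (D \<inter> {lo..<e 0}) = 0"
  proof -
    have "tileable (?U \<inter> {..<e 0})" by (intro tileable_restrict tile) auto
    also have "?U \<inter> {..<e 0} = {lo..<e 0} - D"
      using e_mono[of 0] hi by fastforce
    finally have "(\<Sum>y\<in>{lo..<e 0}. parity_sign y) = - int (card (D \<inter> {lo..<e 0})) * parity_sign lo"
      by (rule card_removed) (use D in auto)
    then show ?thesis
      using sum_parity_sign_interval[of "e 0" lo] lo parity[of 0] parity_sign_nonzero[of lo] by auto
  qed
  then have below: "D \<inter> {lo..<e 0} = {}" by simp
  have "card (D \<inter> {e k + 1..<hi + 1}) = 0"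
  proof -
    have "tileable (?U \<inter> {e k<..})" by (intro tileable_restrict tile) auto
    also have "?U \<inter> {e k<..} = {e k + 1..<hi + 1} - D"
      using e_mono[of _ k] e_mono[of 0 k] lo hi by fastforce
    finally have "(\<Sum>y\<in>{e k + 1..<hi + 1}. parity_sign y) =
        - int (card (D \<inter> {e k + 1..<hi + 1})) * parity_sign lo"
      by (rule card_removed) (use D in auto)
    then show ?thesis
      using sum_parity_sign_interval[of "hi + 1" "e k + 1"] hi parity[of k] parity_sign_nonzero[of lo] by auto
  qed
  then have above: "D \<inter> {e k + 1..<hi + 1} = {}" by simp
  have locate: "y \<in> e ` {..j} \<or> (\<exists>i<j. e i < y \<and> y < e (Suc i))" if "e 0 \<le> y" "y \<le> e j" for y j
    using that
  proof (induction j)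
    case (Suc j)
    show ?case
    proof (cases "y \<le> e j")
      case True
      then show ?thesis using Suc by (auto simp: less_Suc_eq atMost_Suc)
    next
      case False
      then show ?thesis using Suc.prems by (cases "y = e (Suc j)") auto
    qed
  qed auto
  have inside: "\<exists>i<k. e i < y \<and> y < e (Suc i)" if "y \<in> D" for y
  proof -
    have "y \<notin> e ` {..k}" using D(2)[OF that] parity by auto
    moreover have "e 0 \<le> y" "y \<le> e k" using that below above D(1) by force+
    ultimately show ?thesis using locate[of y k] by blast
  qed
  define d where "d = (\<lambda>i\<in>{..<k}. THE y. y \<in> D \<inter> {e i<..<e (Suc i)})"
  have d: "D \<inter> {e i<..<e (Suc i)} = {d i}" if i: "i < k" for i
  proof -
    obtain y where "D \<inter> {e i<..<e (Suc i)} = {y}"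
      using one[OF i] card_1_singletonE by blast
    with i show ?thesis by (simp add: d_def del: Int_iff greaterThanLessThan_iff)
  qed
  have "D = d ` {..<k}"
    using inside d by (fastforce simp: set_eq_iff)
  moreover have "d \<in> PiE {..<k} (gap e)"
  proof (rule PiE_I)
    fix i assume i: "i \<in> {..<k}"
    then have "d i \<in> D" "e i < d i" "d i < e (Suc i)" using d[of i] by auto
    then show "d i \<in> gap e i" using D(2)[of "d i"] parity[of i] i by (auto simp: gap_def)
  qed (simp add: d_def)
  ultimately show ?thesis by blast
qed

text \<open>Interlacing sets correspond to choice functions over the disjoint gaps, and a sum over
  \<open>PiE\<close> is what \<open>sum_PiE_det\<close> can turn into a determinant.\<close>

lemma sum_tileable_interlacing:
  fixes \<Phi> :: "int set \<Rightarrow> 'a :: comm_monoid_add"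
  shows "(\<Sum>D\<in>Pow {y\<in>{lo..hi}. odd (y - lo)}. if tileable ({lo..hi} - e ` {..k} - D) then \<Phi> D else 0) =
    (\<Sum>d\<in>PiE {..<k} (gap e). \<Phi> (d ` {..<k}))"
proof -
  let ?S = "{D. D \<subseteq> {y\<in>{lo..hi}. odd (y - lo)} \<and> tileable ({lo..hi} - e ` {..k} - D)}"
  have gap: "y \<in> {lo..hi} \<and> odd (y - lo)" if "y \<in> gap e i" "i < k" for y i
    using that e_mono[of 0 i] e_mono[of "Suc i" k] lo hi parity[of i] by (auto simp: gap_def)
  have "?S = (\<lambda>d. d ` {..<k}) ` PiE {..<k} (gap e)"
  proof (intro equalityI subsetI)
    fix D assume "D \<in> ?S"
    then have "\<exists>d\<in>PiE {..<k} (gap e). D = d ` {..<k}"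
      by (intro tileable_interlacing) auto
    then show "D \<in> (\<lambda>d. d ` {..<k}) ` PiE {..<k} (gap e)"
      by blast
  next
    fix D assume "D \<in> (\<lambda>d. d ` {..<k}) ` PiE {..<k} (gap e)"
    then obtain d where d: "D = d ` {..<k}" "\<And>i. i < k \<Longrightarrow> d i \<in> gap e i" by auto
    show "D \<in> ?S"
      using interlacing_tileable[OF d(2)] gap[OF d(2)] d(1) by auto
  qed
  moreover have "inj_on (\<lambda>d. d ` {..<k}) (PiE {..<k} (gap e))"
  proof (rule inj_onI)
    fix d d' assume dd: "d \<in> PiE {..<k} (gap e)" "d' \<in> PiE {..<k} (gap e)" "d ` {..<k} = d' ` {..<k}"
    have "d i = d' i" if i: "i < k" for i
    proof -
      obtain j where j: "j < k" "d i = d' j" using dd(3) i by blast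
      have "d i \<in> gap e i" "d' j \<in> gap e j" using dd(1,2) i j(1) by auto
      then have "i = j"
        using j e_mono[of "Suc i" j] e_mono[of "Suc j" i] i
        by (cases i j rule: linorder_cases) (auto simp: gap_def)
      with j show ?thesis by simp
    qed
    then show "d = d'" using dd(1,2) by (intro PiE_ext[of d "{..<k}" _ d']) auto
  qed
  moreover have "(\<Sum>D\<in>Pow {y\<in>{lo..hi}. odd (y - lo)}.
      if tileable ({lo..hi} - e ` {..k} - D) then \<Phi> D else 0) = sum \<Phi> ?S"
    by (subst sum.inter_filter[symmetric])
      (auto intro!: sum.cong intro: finite_subset[of _ "{lo..hi}"])
  ultimately show ?thesis by (simp add: sum.reindex)
qed

end

text \<open>The column has a surplus row of the parity of its ends, and removing rows of the other
  parity only adds to the imbalance. This settles the column without dents on its outer side, where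
  there is no \<open>e 0\<close> to start from.\<close>

lemma not_tileable_unbalanced:
  assumes "lo \<le> hi" "even (hi - lo)" "\<And>y. y \<in> D \<Longrightarrow> odd (y - lo)"
  shows "\<not> tileable ({lo..hi} - D)"
proof
  assume "tileable ({lo..hi} - D)"
  then have "(\<Sum>y\<in>{lo..hi}. parity_sign y) = - int (card (D \<inter> {lo..hi})) * parity_sign lo"
    by (rule card_removed) (use assms in auto)
  moreover have "{lo..hi} = insert hi {lo..<hi}" using assms by auto
  ultimately have "parity_sign lo * (1 + int (card (D \<inter> {lo..hi}))) = 0"
    using sum_parity_sign_interval[of hi lo] assms parity_sign_cong[of hi lo] by (simp add: algebra_simps)
  then show False using parity_sign_nonzero[of lo] by simp
qed

section \<open>Lozenges\<close>

text \<open>Covers both non-horizontal directions of lozenges; the parity of \<open>c + y\<close>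
  tells which one it is.\<close>

definition vertical_domino :: "int \<Rightarrow> int \<Rightarrow> lozenge" where
  "vertical_domino c y = {(c, y), (c, y + 1)}"

definition horizontal_lozenge :: "int \<Rightarrow> int \<Rightarrow> lozenge" where
  "horizontal_lozenge c y = {(c - 1, y), (c, y)}"

lemma mem_vertices: "(x, h) \<in> vertices (c, y) \<longleftrightarrow> (x = c \<or> x = c + 1) \<and> \<bar>h - y\<bar> \<le> 1 \<and> even (x + h)"
proof -
  have "\<bar>h - y\<bar> \<le> 1 \<longleftrightarrow> h = y \<or> h = y - 1 \<or> h = y + 1" by arith
  then show ?thesis by (auto simp: vertices_def left_pointing_def)
qed

lemma shared_edge_pair: "shared_edge {s, t} = vertices s \<inter> vertices t"
  by (simp add: shared_edge_def)

lemma shared_edge_horizontal_lozenge: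
  assumes "odd (c + y)"
  shows "shared_edge (horizontal_lozenge c y) = vertical_segment (c, y)"
proof -
  have "(x, h) \<in> shared_edge (horizontal_lozenge c y) \<longleftrightarrow> (x, h) \<in> vertical_segment (c, y)" for x h
    using assms unfolding horizontal_lozenge_def shared_edge_pair Int_iff mem_vertices vertical_segment_def
    by simp presburger
  then show ?thesis by (auto simp del: split_paired_All)
qed

lemma shared_edge_vertical_domino:
  obtains a b where "shared_edge (vertical_domino c y) = {(c, a), (c + 1, b)}"
proof (cases "even (c + y)")
  case True
  have "(x, h) \<in> shared_edge (vertical_domino c y) \<longleftrightarrow> (x, h) \<in> {(c, y), (c + 1, y + 1)}" for x h
    using True unfolding vertical_domino_def shared_edge_pair Int_iff mem_vertices by simp presburger
  then show ?thesis by (intro that[of y "y + 1"]) (auto simp del: split_paired_All)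
next
  case False
  have "(x, h) \<in> shared_edge (vertical_domino c y) \<longleftrightarrow> (x, h) \<in> {(c, y + 1), (c + 1, y)}" for x h
    using False unfolding vertical_domino_def shared_edge_pair Int_iff mem_vertices by simp presburger
  then show ?thesis by (intro that[of "y + 1" y]) (auto simp del: split_paired_All)
qed

text \<open>If the common vertices lie on one vertical line, they span a vertical side and fix the
  height of both triangles; otherwise the two triangles share a column and are vertical
  neighbours.\<close>

lemma adjacent_triangles:
  assumes "p \<noteq> r" "p \<in> vertices (c, y)" "p \<in> vertices (c', y')" "r \<in> vertices (c, y)" "r \<in> vertices (c', y')"
    and "(c, y) \<noteq> (c', y')"
  shows "c' = c \<and> (y' = y + 1 \<or> y = y' + 1) \<or> c' = c + 1 \<and> y' = y \<and> odd (c' + y) \<or>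
    c = c' + 1 \<and> y' = y \<and> odd (c + y)"
proof -
  obtain x1 h1 x2 h2 where pr: "p = (x1, h1)" "r = (x2, h2)" by fastforce
  have x: "x1 = c \<or> x1 = c + 1" "x1 = c' \<or> x1 = c' + 1" "x2 = c \<or> x2 = c + 1" "x2 = c' \<or> x2 = c' + 1"
    and h: "\<bar>h1 - y\<bar> \<le> 1" "\<bar>h1 - y'\<bar> \<le> 1" "\<bar>h2 - y\<bar> \<le> 1" "\<bar>h2 - y'\<bar> \<le> 1"
    and even: "even (x1 + h1)" "even (x2 + h2)"
    using assms(2-5) by (auto simp: pr mem_vertices)
  \<comment> \<open>Lattice points on a vertical line have heights of one parity.\<close>
  have far: "h1 \<ge> h2 + 2 \<or> h2 \<ge> h1 + 2" if "x1 = x2"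
  proof -
    have "h1 \<noteq> h2" "even (h1 - h2)" using that even assms(1) by (auto simp: pr)
    then show ?thesis by presburger
  qed
  consider "c' = c" | "c' = c + 1" | "c = c' + 1" using x(1,2) by auto
  then show ?thesis
  proof cases
    case 1
    then have y: "y \<noteq> y'" using assms(6) by auto
    have "x1 \<noteq> x2"
      using far h y by auto
    then have "odd (h1 - h2)" using x(1,3) even by auto
    then have "h1 \<noteq> h2" by auto
    then have "y' = y + 1 \<or> y = y' + 1" using h y by arith
    then show ?thesis using 1 by blast
  next
    case 2
    then have x': "x1 = c + 1" "x2 = c + 1" using x by auto
    then have "h1 \<ge> h2 + 2 \<or> h2 \<ge> h1 + 2" by (intro far) simp
    then have "y' = y" "h1 = y + 1 \<or> h1 = y - 1" using h by arith+
    then show ?thesis using 2 even x' by auto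
  next
    case 3
    then have x': "x1 = c" "x2 = c" using x by auto
    then have "h1 \<ge> h2 + 2 \<or> h2 \<ge> h1 + 2" by (intro far) simp
    then have "y' = y" "h1 = y + 1 \<or> h1 = y - 1" using h by arith+
    then show ?thesis using 3 even x' by auto
  qed
qed

lemma lozenges_eq:
  "lozenges = {vertical_domino c y | c y. True} \<union> {horizontal_lozenge c y | c y. odd (c + y)}"
    (is "_ = ?V \<union> ?H")
proof (intro equalityI subsetI)
  fix l assume "l \<in> lozenges"
  then obtain c y c' y' where l: "l = {(c, y), (c', y')}" "(c, y) \<noteq> (c', y')"
    and card: "card (vertices (c, y) \<inter> vertices (c', y')) = 2"
    by (auto simp: lozenges_def)
  from card obtain p r where "p \<noteq> r" "vertices (c, y) \<inter> vertices (c', y') = {p, r}"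
    by (auto simp: card_2_iff)
  then have "p \<noteq> r" "p \<in> vertices (c, y)" "p \<in> vertices (c', y')" "r \<in> vertices (c, y)" "r \<in> vertices (c', y')"
    by blast+
  from adjacent_triangles[OF this l(2)] show "l \<in> ?V \<union> ?H"
  proof (elim disjE conjE)
    assume "c' = c + 1" "y' = y" "odd (c' + y)"
    then have "l = horizontal_lozenge c' y" using l by (auto simp: horizontal_lozenge_def)
    with \<open>odd (c' + y)\<close> show ?thesis by blast
  next
    assume "c = c' + 1" "y' = y" "odd (c + y)"
    then have "l = horizontal_lozenge c y" using l by (auto simp: horizontal_lozenge_def)
    with \<open>odd (c + y)\<close> show ?thesis by blast
  next
    assume "c' = c" "y' = y + 1"
    then have "l = vertical_domino c y" using l by (auto simp: vertical_domino_def)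
    then show ?thesis by blast
  next
    assume "c' = c" "y = y' + 1"
    then have "l = vertical_domino c y'" using l by (auto simp: vertical_domino_def)
    then show ?thesis by blast
  qed
next
  fix l assume "l \<in> ?V \<union> ?H"
  then consider c y where "l = vertical_domino c y" | c y where "l = horizontal_lozenge c y" "odd (c + y)"
    by blast
  then show "l \<in> lozenges"
  proof cases
    case 1
    obtain a b where "shared_edge l = {(c, a), (c + 1, b)}" unfolding 1 by (rule shared_edge_vertical_domino)
    then have "card (vertices (c, y) \<inter> vertices (c, y + 1)) = 2"
      by (simp add: 1 vertical_domino_def shared_edge_pair)
    then show ?thesis unfolding lozenges_def 1 vertical_domino_def
      by (intro CollectI exI[of _ "(c, y)"] exI[of _ "(c, y + 1)"]) auto
  next
    case 2
    have "card (vertices (c - 1, y) \<inter> vertices (c, y)) = 2"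
      using shared_edge_horizontal_lozenge[OF 2(2)]
      by (simp add: horizontal_lozenge_def shared_edge_pair vertical_segment_def)
    then show ?thesis unfolding lozenges_def 2 horizontal_lozenge_def
      by (intro CollectI exI[of _ "(c - 1, y)"] exI[of _ "(c, y)"]) auto
  qed
qed

lemma vertical_domino_in_lozenges: "vertical_domino c y \<in> lozenges"
  and horizontal_lozenge_in_lozenges: "odd (c + y) \<Longrightarrow> horizontal_lozenge c y \<in> lozenges"
  unfolding lozenges_eq by blast+

lemma empty_notin_lozenges: "{} \<notin> lozenges"
  by (auto simp: lozenges_eq vertical_domino_def horizontal_lozenge_def)

lemma lozenge_weight_vertical_domino [simp]: "lozenge_weight q (vertical_domino c y) = 1"
proof -
  obtain a b where ab: "shared_edge (vertical_domino c y) = {(c, a), (c + 1, b)}"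
    by (rule shared_edge_vertical_domino)
  have "\<not> horizontal (vertical_domino c y)"
    unfolding horizontal_def ab by (auto simp: vertical_segment_def doubleton_eq_iff)
  then show ?thesis by (simp add: lozenge_weight_def)
qed

lemma lozenge_weight_horizontal_lozenge [simp]:
  assumes "odd (c + y)"
  shows "lozenge_weight q (horizontal_lozenge c y) = qplus q y"
proof -
  note e = shared_edge_horizontal_lozenge[OF assms]
  have "horizontal (horizontal_lozenge c y)"
    unfolding horizontal_def e by blast
  moreover have "center_i_coordinate (horizontal_lozenge c y) = y"
    unfolding center_i_coordinate_def e by (simp add: vertical_segment_def)
  ultimately show ?thesis by (simp add: lozenge_weight_def)
qed

text \<open>No horizontal lozenge fits into a single column, so only weight 1 dominoes remain, and
  these tile it in at most one way.\<close>

lemma tilings_sum_column: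
  assumes "finite U"
  shows "tilings_sum lozenges (lozenge_weight q) (Pair c ` U) = (if tileable U then 1 else 0)"
proof -
  have "tilings_sum lozenges (lozenge_weight q) (Pair c ` U) =
    tilings_sum ((`) (Pair c) ` dominoes) (\<lambda>_. 1) (Pair c ` U)"
  proof (rule tilings_sum_cong)
    have "{l \<in> lozenges. l \<subseteq> Pair c ` U} = {vertical_domino c y | y. {y, y + 1} \<subseteq> U}"
      by (auto simp: lozenges_eq vertical_domino_def horizontal_lozenge_def)
    moreover have "{l \<in> (`) (Pair c) ` dominoes. l \<subseteq> Pair c ` U} = {vertical_domino c y | y. {y, y + 1} \<subseteq> U}"
    proof -
      have "(`) (Pair c) ` dominoes = range (vertical_domino c)"
        by (simp add: dominoes_def vertical_domino_def image_image)
      moreover have "vertical_domino c y \<subseteq> Pair c ` U \<longleftrightarrow> {y, y + 1} \<subseteq> U" for y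
        by (auto simp: vertical_domino_def)
      moreover have "{l \<in> range h. l \<subseteq> A} = {h y | y. h y \<subseteq> A}" for h :: "int \<Rightarrow> lozenge" and A
        by blast
      ultimately show ?thesis by (simp only:)
    qed
    ultimately show "{l \<in> lozenges. l \<subseteq> Pair c ` U} = {l \<in> (`) (Pair c) ` dominoes. l \<subseteq> Pair c ` U}"
      by simp
    fix l assume "l \<in> lozenges" "l \<subseteq> Pair c ` U"
    then have "l \<in> {vertical_domino c y | y. {y, y + 1} \<subseteq> U}"
      by (auto simp: lozenges_eq vertical_domino_def horizontal_lozenge_def)
    then show "lozenge_weight q l = 1" by auto
  qed
  also have "\<dots> = tilings_sum dominoes (\<lambda>_. 1) U"
    by (rule tilings_sum_image) (auto intro: injI)
  also have "\<dots> = (if tileable U then 1 else 0)"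
  proof (cases "tileable U")
    case True
    then obtain T where "T \<in> tilings_of dominoes U" by (auto simp: tileable_def)
    then have "tilings_of dominoes U = {T}" using domino_tiling_unique[OF assms] by blast
    with True show ?thesis by (simp add: tilings_sum_def)
  qed (simp add: tilings_sum_def tileable_def)
  finally show ?thesis .
qed

text \<open>Column \<open>c\<close> spans \<open>x = c\<close> to \<open>x = c + 1\<close>, hence
  its mirror image is column \<open>- 1 - c\<close>. The first reflection keeps i-coordinates, the
  second negates them, and \<open>qplus\<close> is even.\<close>

lemma tilings_sum_reflect:
  shows "tilings_sum lozenges (lozenge_weight q) ((\<lambda>(c, y). (- 1 - c, y)) ` U) =
      tilings_sum lozenges (lozenge_weight q) U" (is ?x)
    and "tilings_sum lozenges (lozenge_weight q) ((\<lambda>(c, y). (c, - y)) ` U) =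
      tilings_sum lozenges (lozenge_weight q) U" (is ?y)
proof -
  have image: "(`) f ` lozenges = lozenges"
    if "\<And>t. f (f t) = t" "\<And>l. l \<in> lozenges \<Longrightarrow> f ` l \<in> lozenges" for f
  proof (intro equalityI subsetI)
    fix l assume l: "l \<in> lozenges"
    have "f ` f ` l = l" using that(1) by (simp add: image_image)
    then show "l \<in> (`) f ` lozenges" using that(2)[OF l] by (metis image_eqI)
  qed (use that(2) in auto)
  let ?f = "\<lambda>(c, y). (- 1 - c, y) :: triangle" and ?g = "\<lambda>(c, y). (c, - y) :: triangle"
  have f: "?f ` vertical_domino c y = vertical_domino (- 1 - c) y"
    "?f ` horizontal_lozenge c y = horizontal_lozenge (- c) y" for c y
    by (auto simp: vertical_domino_def horizontal_lozenge_def)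
  have g: "?g ` vertical_domino c y = vertical_domino c (- y - 1)"
    "?g ` horizontal_lozenge c y = horizontal_lozenge c (- y)" for c y
    by (auto simp: vertical_domino_def horizontal_lozenge_def)
  have fl: "?f ` l \<in> lozenges \<and> lozenge_weight q (?f ` l) = lozenge_weight q l" if "l \<in> lozenges" for l
  proof -
    from that consider c y where "l = vertical_domino c y" | c y where "l = horizontal_lozenge c y" "odd (c + y)"
      unfolding lozenges_eq by blast
    then show ?thesis
    proof cases
      case 1
      then show ?thesis unfolding 1 f by (simp add: vertical_domino_in_lozenges)
    next
      case 2
      then have "odd (- c + y)" by simp
      with 2(2) show ?thesis unfolding 2(1) f by (simp add: horizontal_lozenge_in_lozenges)
    qed
  qed
  have gl: "?g ` l \<in> lozenges \<and> lozenge_weight q (?g ` l) = lozenge_weight q l" if "l \<in> lozenges" for l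
  proof -
    from that consider c y where "l = vertical_domino c y" | c y where "l = horizontal_lozenge c y" "odd (c + y)"
      unfolding lozenges_eq by blast
    then show ?thesis
    proof cases
      case 1
      then show ?thesis unfolding 1 g by (simp add: vertical_domino_in_lozenges)
    next
      case 2
      then have "odd (c + - y)" by simp
      with 2(2) show ?thesis unfolding 2(1) g
        by (simp add: horizontal_lozenge_in_lozenges qplus_def add.commute)
    qed
  qed
  have "tilings_sum ((`) ?f ` lozenges) (lozenge_weight q) (?f ` U) = tilings_sum lozenges (lozenge_weight q) U"
    using fl by (intro tilings_sum_image) (auto intro!: injI)
  moreover have "(`) ?f ` lozenges = lozenges" by (rule image) (use fl in auto)
  ultimately show ?x by simp
  have "tilings_sum ((`) ?g ` lozenges) (lozenge_weight q) (?g ` U) = tilings_sum lozenges (lozenge_weight q) U"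
    using gl by (intro tilings_sum_image) (auto intro!: injI)
  moreover have "(`) ?g ` lozenges = lozenges" by (rule image) (use gl in auto)
  ultimately show ?y by simp
qed

text \<open>Only horizontal lozenges cross a vertical lattice line, and distinct ones on the same
  line are disjoint. So every subset of the admissible rows is a possible set of crossing
  lozenges.\<close>

lemma tilings_sum_line_split:
  assumes \<Lambda>: "\<Lambda> \<subseteq> lozenges" and fin: "finite P" "finite Q"
    and P: "\<And>t. t \<in> P \<Longrightarrow> fst t < c" and Q: "\<And>t. t \<in> Q \<Longrightarrow> c \<le> fst t"
  defines "Y \<equiv> {y. odd (c + y) \<and> horizontal_lozenge c y \<in> \<Lambda> \<and> (c - 1, y) \<in> P \<and> (c, y) \<in> Q}"
  shows "tilings_sum \<Lambda> (lozenge_weight q) (P \<union> Q) = (\<Sum>D\<in>Pow Y. (\<Prod>y\<in>D. qplus q y) *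
    (tilings_sum \<Lambda> (lozenge_weight q) (P - Pair (c - 1) ` D) *
     tilings_sum \<Lambda> (lozenge_weight q) (Q - Pair c ` D)))"
proof -
  have PQ: "P \<inter> Q = {}" using P Q by fastforce
  have ne: "{} \<notin> \<Lambda>" using \<Lambda> empty_notin_lozenges by blast
  have inj: "inj (horizontal_lozenge c)"
    by (rule injI) (auto simp: horizontal_lozenge_def doubleton_eq_iff)
  have crossing: "{l \<in> \<Lambda>. l \<subseteq> P \<union> Q \<and> l \<inter> P \<noteq> {} \<and> l \<inter> Q \<noteq> {}} = horizontal_lozenge c ` Y"
  proof (intro equalityI subsetI)
    fix l assume "l \<in> {l \<in> \<Lambda>. l \<subseteq> P \<union> Q \<and> l \<inter> P \<noteq> {} \<and> l \<inter> Q \<noteq> {}}"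
    then have l: "l \<in> \<Lambda>" "l \<subseteq> P \<union> Q" "l \<inter> P \<noteq> {}" "l \<inter> Q \<noteq> {}" by auto
    obtain s t where st: "s \<in> l" "fst s < c" "t \<in> l" "c \<le> fst t" using l P Q by fast
    from l(1) \<Lambda> consider c' y where "l = vertical_domino c' y" | c' y where "l = horizontal_lozenge c' y" "odd (c' + y)"
      unfolding lozenges_eq by blast
    then show "l \<in> horizontal_lozenge c ` Y"
    proof cases
      case 1
      with st show ?thesis by (auto simp: vertical_domino_def)
    next
      case 2
      with st have "c' = c" by (auto simp: horizontal_lozenge_def)
      moreover have "(c - 1, y) \<in> P" "(c, y) \<in> Q"
        using l(2) P[of "(c, y)"] Q[of "(c - 1, y)"] 2 \<open>c' = c\<close> by (auto simp: horizontal_lozenge_def)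
      ultimately show ?thesis using 2 l(1) by (auto simp: Y_def)
    qed
  next
    fix l assume "l \<in> horizontal_lozenge c ` Y"
    then show "l \<in> {l \<in> \<Lambda>. l \<subseteq> P \<union> Q \<and> l \<inter> P \<noteq> {} \<and> l \<inter> Q \<noteq> {}}"
      by (auto simp: Y_def horizontal_lozenge_def)
  qed
  have sets: "{C. C \<subseteq> horizontal_lozenge c ` Y \<and> pairwise disjnt C} = (`) (horizontal_lozenge c) ` Pow Y"
  proof (intro equalityI subsetI)
    fix C assume "C \<in> (`) (horizontal_lozenge c) ` Pow Y"
    then obtain D where "D \<subseteq> Y" "C = horizontal_lozenge c ` D" by auto
    then show "C \<in> {C. C \<subseteq> horizontal_lozenge c ` Y \<and> pairwise disjnt C}"
      by (auto simp: pairwise_def disjnt_def horizontal_lozenge_def)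
  next
    fix C assume "C \<in> {C. C \<subseteq> horizontal_lozenge c ` Y \<and> pairwise disjnt C}"
    then show "C \<in> (`) (horizontal_lozenge c) ` Pow Y" by (auto simp: subset_image_iff)
  qed
  have "inj_on ((`) (horizontal_lozenge c)) (Pow Y)"
    using inj by (auto intro!: inj_onI simp: inj_image_eq_iff)
  then have "tilings_sum \<Lambda> (lozenge_weight q) (P \<union> Q) =
    (\<Sum>D\<in>Pow Y. (\<Prod>l\<in>horizontal_lozenge c ` D. lozenge_weight q l) *
      (tilings_sum \<Lambda> (lozenge_weight q) (P - \<Union> (horizontal_lozenge c ` D)) *
       tilings_sum \<Lambda> (lozenge_weight q) (Q - \<Union> (horizontal_lozenge c ` D))))"
    unfolding tilings_sum_split[OF fin PQ ne] crossing sets by (simp add: sum.reindex)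
  also have "\<dots> = (\<Sum>D\<in>Pow Y. (\<Prod>y\<in>D. qplus q y) *
    (tilings_sum \<Lambda> (lozenge_weight q) (P - Pair (c - 1) ` D) *
     tilings_sum \<Lambda> (lozenge_weight q) (Q - Pair c ` D)))"
  proof (rule sum.cong[OF refl])
    fix D assume D: "D \<in> Pow Y"
    have "(\<Prod>l\<in>horizontal_lozenge c ` D. lozenge_weight q l) = (\<Prod>y\<in>D. lozenge_weight q (horizontal_lozenge c y))"
      using inj by (subst prod.reindex) (auto intro: inj_on_subset)
    also have "\<dots> = (\<Prod>y\<in>D. qplus q y)"
      using D by (intro prod.cong) (auto simp: Y_def)
    finally have 1: "(\<Prod>l\<in>horizontal_lozenge c ` D. lozenge_weight q l) = (\<Prod>y\<in>D. qplus q y)" .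
    have 2: "P - \<Union> (horizontal_lozenge c ` D) = P - Pair (c - 1) ` D"
      using P by (fastforce simp: horizontal_lozenge_def)
    have 3: "Q - \<Union> (horizontal_lozenge c ` D) = Q - Pair c ` D"
      using Q by (fastforce simp: horizontal_lozenge_def)
    show "(\<Prod>l\<in>horizontal_lozenge c ` D. lozenge_weight q l) *
      (tilings_sum \<Lambda> (lozenge_weight q) (P - \<Union> (horizontal_lozenge c ` D)) *
       tilings_sum \<Lambda> (lozenge_weight q) (Q - \<Union> (horizontal_lozenge c ` D))) =
      (\<Prod>y\<in>D. qplus q y) * (tilings_sum \<Lambda> (lozenge_weight q) (P - Pair (c - 1) ` D) *
       tilings_sum \<Lambda> (lozenge_weight q) (Q - Pair c ` D))"
      unfolding 1 2 3 ..
  qed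
  finally show ?thesis .
qed

section \<open>Sums over interlacing sets\<close>

definition Vdm :: "(int \<Rightarrow> 'a :: comm_ring_1) \<Rightarrow> int set \<Rightarrow> 'a" where
  "Vdm f S = (\<Prod>(s, t)\<in>{(s, t). s \<in> S \<and> t \<in> S \<and> s < t}. f t - f s)"

lemma Vdm_enumerated:
  fixes e :: "nat \<Rightarrow> int"
  assumes "\<And>i j. i < j \<Longrightarrow> j < k \<Longrightarrow> e i < e j"
  shows "Vdm f (e ` {..<k}) = vandermonde k (\<lambda>i. f (e i))"
proof -
  let ?A = "Sigma {..<k} (\<lambda>j. {..<j})"
  have inj: "e i = e j \<longleftrightarrow> i = j" "e i < e j \<longleftrightarrow> i < j" if "i < k" "j < k" for i j
    using assms[of i j] assms[of j i] that by (cases i j rule: linorder_cases; auto)+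
  have "{(s, t). s \<in> e ` {..<k} \<and> t \<in> e ` {..<k} \<and> s < t} = (\<lambda>(j, i). (e i, e j)) ` ?A"
    using inj(2) by (force simp: image_iff)
  moreover have "inj_on (\<lambda>(j, i). (e i, e j)) ?A"
    using inj(1) by (auto intro!: inj_onI)
  ultimately have "Vdm f (e ` {..<k}) = (\<Prod>(j, i)\<in>?A. f (e j) - f (e i))"
    unfolding Vdm_def by (simp add: prod.reindex case_prod_unfold)
  also have "\<dots> = vandermonde k (\<lambda>i. f (e i))"
    unfolding vandermonde_def by (subst prod.Sigma) auto
  finally show ?thesis .
qed

lemma finite_int_set_enumerate:
  fixes S :: "int set"
  assumes "finite S"
  shows "\<exists>e :: nat \<Rightarrow> int. S = e ` {..<card S} \<and> (\<forall>i j. i < j \<longrightarrow> j < card S \<longrightarrow> e i < e j)"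
proof (intro exI conjI allI impI)
  let ?e = "\<lambda>i. sorted_list_of_set S ! i"
  have "S = {?e i | i. i < card S}"
    using assms set_conv_nth[of "sorted_list_of_set S"] by simp
  then show "S = ?e ` {..<card S}" by blast
  show "?e i < ?e j" if "i < j" "j < card S" for i j
    using that strict_sorted_list_of_set[of S] by (simp add: sorted_wrt_nth_less)
qed

lemma sum_gap:
  fixes G :: "int \<Rightarrow> 'a :: ab_group_add"
  assumes g: "\<And>y. g y = G (y + 1) - G (y - 1)" and e: "e i < e (Suc i)" "even (e (Suc i) - e i)"
  shows "(\<Sum>y\<in>gap e i. g y) = G (e (Suc i)) - G (e i)"
proof -
  define n where "n = nat ((e (Suc i) - e i) div 2)"
  have n: "e (Suc i) = e i + 2 * int n" using e by (simp add: n_def)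
  have "gap e i = (\<lambda>j. e i + 2 * int j + 1) ` {..<n}"
  proof (intro equalityI subsetI)
    fix y assume y: "y \<in> gap e i"
    then have "odd (y - e i)" unfolding gap_def by blast
    then obtain r where r: "y - e i = 2 * r + 1" by (rule oddE)
    then have "y = e i + 2 * int (nat r) + 1" "nat r < n" using y n by (auto simp: gap_def)
    then show "y \<in> (\<lambda>j. e i + 2 * int j + 1) ` {..<n}" by blast
  qed (use n in \<open>auto simp: gap_def\<close>)
  then have "(\<Sum>y\<in>gap e i. g y) = (\<Sum>j<n. g (e i + 2 * int j + 1))"
    by (simp add: sum.reindex inj_on_def)
  also have "\<dots> = (\<Sum>j<n. G (e i + 2 * int (Suc j)) - G (e i + 2 * int j))"
    by (simp add: g add_ac)
  also have "\<dots> = G (e (Suc i)) - G (e i)"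
    using sum_lessThan_telescope[of "\<lambda>j. G (e i + 2 * int j)" n] n by simp
  finally show ?thesis .
qed

text \<open>Times the top coefficients, the Vandermonde product of \<open>d\<close> is the
  determinant of the values of the \<open>p j\<close>. Summing row \<open>i\<close> over its gap
  telescopes to differences of \<open>G j\<close>, which \<open>det_row_differences\<close> converts
  to the bordered determinant. Here \<open>w\<close> is the lozenge weight and \<open>u\<close> a
  factor that each dent brings from the preceding column.\<close>

lemma interlacing_sum:
  fixes w u f :: "int \<Rightarrow> 'a :: idom" and G :: "nat \<Rightarrow> int \<Rightarrow> 'a" and p :: "nat \<Rightarrow> 'a poly"
  assumes e: "\<And>i. i < k \<Longrightarrow> e i < e (Suc i)" "\<And>i. i < k \<Longrightarrow> even (e (Suc i) - e i)"
    and step: "\<And>y j. w y * u y * poly (p j) (f y) = G j (y + 1) - G j (y - 1)"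
    and deg: "\<And>j. degree (p j) \<le> j"
  shows "(\<Sum>d\<in>PiE {..<k} (gap e). (\<Prod>y\<in>d ` {..<k}. w y) *
      ((\<Prod>y\<in>d ` {..<k}. u y) * Vdm f (d ` {..<k}))) * (\<Prod>j<k. coeff (p j) j) =
    det (mat (Suc k) (Suc k) (\<lambda>(i, j). if j = 0 then 1 else G (j - 1) (e i)))"
proof -
  have "(\<Prod>y\<in>d ` {..<k}. w y) * ((\<Prod>y\<in>d ` {..<k}. u y) * Vdm f (d ` {..<k})) * (\<Prod>j<k. coeff (p j) j) =
    (\<Prod>i<k. w (d i) * u (d i)) * det (mat k k (\<lambda>(i, j). poly (p j) (f (d i))))"
    if d: "d \<in> PiE {..<k} (gap e)" for d
  proof -
    have strict: "d i < d j" if "i < j" "j < k" for i j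
      using interlacing_strict[of k d e i j] d that by auto
    have "inj_on d {..<k}"
      using strict by (intro linorder_inj_onI) (auto simp: less_le)
    then show ?thesis
      using det_polys[of k p "\<lambda>i. f (d i)"] deg Vdm_enumerated[where e = d and k = k and f = f, OF strict]
      by (simp add: prod.reindex prod.distrib mult_ac)
  qed
  then have "(\<Sum>d\<in>PiE {..<k} (gap e). (\<Prod>y\<in>d ` {..<k}. w y) *
      ((\<Prod>y\<in>d ` {..<k}. u y) * Vdm f (d ` {..<k}))) * (\<Prod>j<k. coeff (p j) j) =
    (\<Sum>d\<in>PiE {..<k} (gap e). (\<Prod>i<k. w (d i) * u (d i)) * det (mat k k (\<lambda>(i, j). poly (p j) (f (d i)))))"
    unfolding sum_distrib_right by (intro sum.cong) auto
  also have "\<dots> = det (mat k k (\<lambda>(i, j). \<Sum>y\<in>gap e i. w y * u y * poly (p j) (f y)))"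
    by (rule sum_PiE_det[where w = "\<lambda>y. w y * u y"]) (rule finite_gap)
  also have "mat k k (\<lambda>(i, j). \<Sum>y\<in>gap e i. w y * u y * poly (p j) (f y)) =
    mat k k (\<lambda>(i, j). G j (e (Suc i)) - G j (e i))"
    by (rule eq_matI) (use e in \<open>auto intro!: sum_gap step\<close>)
  also have "det \<dots> = det (mat (Suc k) (Suc k) (\<lambda>(i, j). if j = 0 then 1 else G (j - 1) (e i)))"
    by (rule det_row_differences)
  finally show ?thesis .
qed

text \<open>The same sum in the form that arises when a column is cut off: over all sets of rows,
  with a product formula that vanishes unless \<open>card D = k\<close>.\<close>

lemma strip_sum:
  fixes w u f :: "int \<Rightarrow> 'a :: idom" and G :: "nat \<Rightarrow> int \<Rightarrow> 'a" and p :: "nat \<Rightarrow> 'a poly"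
  assumes e: "\<And>i j. i < j \<Longrightarrow> j \<le> k \<Longrightarrow> e i < e j" "\<And>i. i \<le> k \<Longrightarrow> even (e i - lo)"
    and range: "e ` {..k} \<subseteq> {lo..hi}" "even (hi - lo)"
    and step: "\<And>y j. w y * u y * poly (p j) (f y) = G j (y + 1) - G j (y - 1)"
    and deg: "\<And>j. degree (p j) \<le> j"
  shows "(\<Sum>D\<in>Pow {y\<in>{lo..hi}. odd (y - lo)}. if tileable ({lo..hi} - e ` {..k} - D)
      then (\<Prod>y\<in>D. w y) * (if card D = k then (\<Prod>y\<in>D. u y) * Vdm f D else 0) else 0) *
      (\<Prod>j<k. coeff (p j) j) =
    det (mat (Suc k) (Suc k) (\<lambda>(i, j). if j = 0 then 1 else G (j - 1) (e i)))"
proof -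
  have ev: "even (e (Suc i) - e i)" if "i < k" for i
    using e(2)[of i] e(2)[of "Suc i"] that by auto
  have "lo \<le> e 0" "e k \<le> hi" using range by auto
  then have "(\<Sum>D\<in>Pow {y\<in>{lo..hi}. odd (y - lo)}. if tileable ({lo..hi} - e ` {..k} - D)
      then (\<Prod>y\<in>D. w y) * (if card D = k then (\<Prod>y\<in>D. u y) * Vdm f D else 0) else 0) =
    (\<Sum>d\<in>PiE {..<k} (gap e). (\<Prod>y\<in>d ` {..<k}. w y) *
      (if card (d ` {..<k}) = k then (\<Prod>y\<in>d ` {..<k}. u y) * Vdm f (d ` {..<k}) else 0))"
    using e range by (intro sum_tileable_interlacing) auto
  also have "\<dots> = (\<Sum>d\<in>PiE {..<k} (gap e). (\<Prod>y\<in>d ` {..<k}. w y) *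
      ((\<Prod>y\<in>d ` {..<k}. u y) * Vdm f (d ` {..<k})))"
  proof (rule sum.cong[OF refl])
    fix d assume d: "d \<in> PiE {..<k} (gap e)"
    have "d i < d j" if "i < j" "j < k" for i j
      using interlacing_strict[of k d e i j] d that by auto
    then have "inj_on d {..<k}"
      by (intro linorder_inj_onI) (auto simp: less_le)
    then have "card (d ` {..<k}) = k" by (simp add: card_image)
    then show "(\<Prod>y\<in>d ` {..<k}. w y) *
      (if card (d ` {..<k}) = k then (\<Prod>y\<in>d ` {..<k}. u y) * Vdm f (d ` {..<k}) else 0) =
      (\<Prod>y\<in>d ` {..<k}. w y) * ((\<Prod>y\<in>d ` {..<k}. u y) * Vdm f (d ` {..<k}))" by simp
  qed
  also have "\<dots> * (\<Prod>j<k. coeff (p j) j) =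
      det (mat (Suc k) (Suc k) (\<lambda>(i, j). if j = 0 then 1 else G (j - 1) (e i)))"
    using e ev by (intro interlacing_sum[OF _ _ step deg]) auto
  finally show ?thesis .
qed

text \<open>Interlacing forces \<open>D\<close> to have one element less than \<open>E\<close>, so a
  wrong number of dents is passed on to the preceding column, where the weight is 0.\<close>

lemma strip_sum_card:
  fixes \<Phi> :: "int set \<Rightarrow> 'a :: comm_monoid_add"
  assumes E: "finite E" "E \<subseteq> {lo..hi}" "\<And>y. y \<in> E \<Longrightarrow> even (y - lo)"
    and hi: "lo \<le> hi" "even (hi - lo)" and k: "card E \<noteq> Suc k"
  shows "(\<Sum>D\<in>Pow {y\<in>{lo..hi}. odd (y - lo)}. if tileable ({lo..hi} - E - D)
      then if card D = k then \<Phi> D else 0 else 0) = 0"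
proof (cases "E = {}")
  case True
  then show ?thesis
    using not_tileable_unbalanced[OF hi] by (intro sum.neutral) auto
next
  case False
  then obtain k' where k': "card E = Suc k'" using E(1) by (metis card_eq_0_iff not0_implies_Suc)
  obtain e where e: "E = e ` {..<card E}" "\<And>i j. i < j \<Longrightarrow> j < card E \<Longrightarrow> e i < e j"
    using finite_int_set_enumerate[OF E(1)] by blast
  have e': "E = e ` {..k'}" "\<And>i j. i < j \<Longrightarrow> j \<le> k' \<Longrightarrow> e i < e j"
    using e unfolding k' lessThan_Suc_atMost by auto
  have "(\<Sum>D\<in>Pow {y\<in>{lo..hi}. odd (y - lo)}. if tileable ({lo..hi} - e ` {..k'} - D)
      then if card D = k then \<Phi> D else 0 else 0) =
    (\<Sum>d\<in>PiE {..<k'} (gap e). if card (d ` {..<k'}) = k then \<Phi> (d ` {..<k'}) else 0)"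
    using E e' hi by (intro sum_tileable_interlacing) auto
  also have "\<dots> = 0"
  proof (rule sum.neutral, rule ballI)
    fix d assume d: "d \<in> PiE {..<k'} (gap e)"
    have "d i < d j" if "i < j" "j < k'" for i j
      using interlacing_strict[of k' d e i j] d that by auto
    then have "inj_on d {..<k'}"
      by (intro linorder_inj_onI) (auto simp: less_le)
    then have "card (d ` {..<k'}) = k'" by (simp add: card_image)
    then show "(if card (d ` {..<k'}) = k then \<Phi> (d ` {..<k'}) else 0) = 0" using k k' by simp
  qed
  finally show ?thesis using e'(1) by simp
qed

section \<open>Trapezoids and half hexagons\<close>

definition staircase :: "int \<Rightarrow> nat \<Rightarrow> (nat \<Rightarrow> int) \<Rightarrow> (nat \<Rightarrow> int) \<Rightarrow> triangle set" where
  "staircase i k lo hi = (\<Union>j<k. Pair (i + int j) ` {lo j..hi j})"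

text \<open>There is no column to cut the dents from if \<open>k = 0\<close>; the convention for this case makes the
  recursion over the columns start at 0.\<close>

definition dented_sum :: "'a :: field \<Rightarrow> int \<Rightarrow> nat \<Rightarrow> (nat \<Rightarrow> int) \<Rightarrow> (nat \<Rightarrow> int) \<Rightarrow> int set \<Rightarrow> 'a" where
  "dented_sum q i k lo hi E = (if k = 0 then if E = {} then 1 else 0
    else tilings_sum lozenges (lozenge_weight q) (staircase i k lo hi - Pair (i + int k - 1) ` E))"

text \<open>The piece of the left half above the intrusion, which fills row 0; \<open>h\<close> is
  the length of the left side of the hexagon.\<close>

definition half_hexagon_sum :: "'a :: field \<Rightarrow> int \<Rightarrow> nat \<Rightarrow> int set \<Rightarrow> 'a" where
  "half_hexagon_sum q h c E = dented_sum q 0 c (\<lambda>_. 1) (\<lambda>j. h + int j) E"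

lemma finite_staircase: "finite (staircase i k lo hi)"
  by (simp add: staircase_def)

text \<open>Cutting along the line before the last column. \<open>J\<close> is prescribed for
  \<open>k \<ge> 1\<close> only: for \<open>k = 0\<close> the convention on
  \<open>dented_sum\<close> keeps just \<open>D = {}\<close>, so any finite \<open>J\<close> gives
  the same sum and the first column can be treated like the others.\<close>

lemma dented_sum_Suc:
  fixes q :: "'a :: field"
  assumes J: "k \<ge> 1 \<Longrightarrow> J = {y. odd (i + int k + y) \<and> lo (k - 1) \<le> y \<and> y \<le> hi (k - 1) \<and> lo k \<le> y \<and> y \<le> hi k}"
    and fin: "finite J" and E: "\<And>y. y \<in> E \<Longrightarrow> even (i + int k + y)"
  shows "dented_sum q i (Suc k) lo hi E =
    (\<Sum>D\<in>Pow J. if tileable ({lo k..hi k} - E - D) then (\<Prod>y\<in>D. qplus q y) * dented_sum q i k lo hi D else 0)"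
proof (cases "k = 0")
  case True
  have col: "staircase i (Suc 0) lo hi - Pair i ` E = Pair i ` ({lo 0..hi 0} - E)"
    by (auto simp: staircase_def)
  have "dented_sum q i (Suc k) lo hi E = (if tileable ({lo 0..hi 0} - E) then 1 else 0)"
    unfolding True dented_sum_def by (simp add: col tilings_sum_column)
  also have "\<dots> = (\<Sum>D\<in>Pow J. if D = {} then if tileable ({lo 0..hi 0} - E) then 1 else 0 else 0)"
    using fin by simp
  also have "\<dots> = (\<Sum>D\<in>Pow J. if tileable ({lo k..hi k} - E - D) then (\<Prod>y\<in>D. qplus q y) * dented_sum q i k lo hi D else 0)"
    by (rule sum.cong) (auto simp: True dented_sum_def)
  finally show ?thesis .
next
  case False
  define c where "c = i + int k"
  let ?P = "staircase i k lo hi" and ?Q = "Pair c ` ({lo k..hi k} - E)"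
  have union: "staircase i (Suc k) lo hi - Pair c ` E = ?P \<union> ?Q"
    by (auto simp: staircase_def c_def lessThan_Suc)
  have last: "(c - 1, y) \<in> ?P \<longleftrightarrow> lo (k - 1) \<le> y \<and> y \<le> hi (k - 1)" for y
  proof
    assume "(c - 1, y) \<in> ?P"
    then obtain j where "j < k" "c - 1 = i + int j" "lo j \<le> y" "y \<le> hi j" by (auto simp: staircase_def)
    moreover from this have "j = k - 1" by (simp add: c_def)
    ultimately show "lo (k - 1) \<le> y \<and> y \<le> hi (k - 1)" by simp
  next
    assume "lo (k - 1) \<le> y \<and> y \<le> hi (k - 1)"
    then have "(i + int (k - 1), y) \<in> Pair (i + int (k - 1)) ` {lo (k - 1)..hi (k - 1)}" by auto
    then have "(i + int (k - 1), y) \<in> ?P"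
      unfolding staircase_def using False by (intro UN_I[of "k - 1"]) auto
    also have "i + int (k - 1) = c - 1" using False by (simp add: c_def of_nat_diff)
    finally show "(c - 1, y) \<in> ?P" .
  qed
  have Y: "{y. odd (c + y) \<and> horizontal_lozenge c y \<in> lozenges \<and> (c - 1, y) \<in> ?P \<and> (c, y) \<in> ?Q} = J"
    unfolding last using J False E by (auto simp: horizontal_lozenge_in_lozenges c_def)
  have "dented_sum q i (Suc k) lo hi E = tilings_sum lozenges (lozenge_weight q) (?P \<union> ?Q)"
    unfolding union[symmetric] by (simp add: dented_sum_def c_def)
  also have "\<dots> = (\<Sum>D\<in>Pow J. (\<Prod>y\<in>D. qplus q y) *
    (tilings_sum lozenges (lozenge_weight q) (?P - Pair (c - 1) ` D) *
     tilings_sum lozenges (lozenge_weight q) (?Q - Pair c ` D)))"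
    unfolding Y[symmetric]
    by (rule tilings_sum_line_split) (auto simp: finite_staircase, auto simp: staircase_def c_def)
  also have "\<dots> = (\<Sum>D\<in>Pow J. if tileable ({lo k..hi k} - E - D) then (\<Prod>y\<in>D. qplus q y) * dented_sum q i k lo hi D else 0)"
  proof (rule sum.cong[OF refl])
    fix D
    have "?Q - Pair c ` D = Pair c ` ({lo k..hi k} - E - D)" by auto
    then show "(\<Prod>y\<in>D. qplus q y) *
    (tilings_sum lozenges (lozenge_weight q) (?P - Pair (c - 1) ` D) *
     tilings_sum lozenges (lozenge_weight q) (?Q - Pair c ` D)) =
     (if tileable ({lo k..hi k} - E - D) then (\<Prod>y\<in>D. qplus q y) * dented_sum q i k lo hi D else 0)"
      using False by (simp add: tilings_sum_column dented_sum_def c_def)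
  qed
  finally show ?thesis .
qed

lemma det_bordered_powers:
  fixes z :: "nat \<Rightarrow> 'a :: idom"
  shows "det (mat k k (\<lambda>(i, j). if j = 0 then 1 else z i ^ (j - 1 + 1))) = vandermonde k z"
proof -
  have "mat k k (\<lambda>(i, j). if j = 0 then 1 else z i ^ (j - 1 + 1)) = mat k k (\<lambda>(i, j). z i ^ j)"
    by (rule eq_matI) auto
  then show ?thesis by (simp add: det_powers)
qed

lemma eq_divideI: "s * a = v \<Longrightarrow> a \<noteq> 0 \<Longrightarrow> s = v / a" for a :: "'a :: field"
  by (simp add: nonzero_eq_divide_eq)

lemma qfact_eq: "qfact q k = (\<Prod>j<k. qnum q (int j + 1))"
  by (simp add: qfact_def prod.atLeast1_atMost_eq atLeast0LessThan add.commute)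

section \<open>Product formulas for the trapezoid and the half hexagon\<close>

context
  fixes q :: "'a :: field_char_0"
  assumes q0: "q \<noteq> 0" and q1: "q - inverse q \<noteq> 0"
    and qnum_nonzero: "\<And>k :: nat. k > 0 \<Longrightarrow> qnum q (int k) \<noteq> 0"
begin

lemma qnum_nonzero': "k > 0 \<Longrightarrow> qnum q k \<noteq> 0"
  using qnum_nonzero[of "nat k"] by simp

lemma qfact_nonzero: "qfact q k \<noteq> 0"
  by (simp add: qfact_eq qnum_nonzero')

text \<open>The parity of \<open>i + s\<close> makes every column end in left-pointing triangles at
  both ends, so each column needs one dent more than its predecessor. The strip with
  \<open>k\<close> inner dents divides by the top coefficients [1], ..., [k], that is by
  \<open>qfact q k\<close>.\<close>

lemma dented_sum_trapezoid:
  assumes "even (i + s)" "0 \<le> s" "E \<subseteq> {y. odd (i + int k + y) \<and> \<bar>y\<bar> \<le> s + int k - 1}"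
  shows "dented_sum q i k (\<lambda>j. - (s + int j)) (\<lambda>j. s + int j) E =
    (if card E = k then Vdm (qx q) E / (\<Prod>j<k. qfact q j) else 0)"
  using assms(3)
proof (induction k arbitrary: E)
  case 0
  have "E \<subseteq> {- s..s}"
  proof
    fix y assume "y \<in> E"
    then have "\<bar>y\<bar> \<le> s - 1" using 0 by auto
    then show "y \<in> {- s..s}" by auto
  qed
  then have "finite E" by (rule finite_subset) simp
  then show ?case by (auto simp: dented_sum_def Vdm_def)
next
  case (Suc k)
  define lo hi where "lo = - (s + int k)" and "hi = s + int k"
  define J where "J = {y\<in>{lo..hi}. odd (y - lo)}"
  have mem: "even (i + int k + y) \<and> lo \<le> y \<and> y \<le> hi \<and> even (y - lo)" if "y \<in> E" for y
  proof -
    have "odd (i + int (Suc k) + y)" "\<bar>y\<bar> \<le> s + int k" using that Suc.prems by auto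
    then show ?thesis using assms(1) by (auto simp: lo_def hi_def)
  qed
  then have E: "E \<subseteq> {lo..hi}" "\<And>y. y \<in> E \<Longrightarrow> even (y - lo)"
    and E': "\<And>y. y \<in> E \<Longrightarrow> even (i + int k + y)"
    by auto
  have finE: "finite E" by (rule finite_subset[OF E(1)]) simp
  have lohi: "lo \<le> hi" "even (hi - lo)" using assms(2) by (auto simp: lo_def hi_def)
  \<comment> \<open>The rows that carry crossing lozenges have the parity opposite to the ends of
    the new column, so they already fit into the shorter preceding column.\<close>
  have J: "odd (i + int k + y) \<and> \<bar>y\<bar> \<le> s + int k - 1" if "y \<in> J" for y
  proof -
    have "y \<noteq> hi" "y \<noteq> lo" using that lohi by (auto simp: J_def)
    then show ?thesis using that assms(1) by (auto simp: J_def lo_def hi_def)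
  qed
  have "dented_sum q i (Suc k) (\<lambda>j. - (s + int j)) (\<lambda>j. s + int j) E =
    (\<Sum>D\<in>Pow J. if tileable ({lo..hi} - E - D) then (\<Prod>y\<in>D. qplus q y) *
      dented_sum q i k (\<lambda>j. - (s + int j)) (\<lambda>j. s + int j) D else 0)"
    unfolding lo_def hi_def
  proof (rule dented_sum_Suc)
    show "finite J" by (rule finite_subset[of _ "{lo..hi}"]) (auto simp: J_def)
    assume k: "1 \<le> k"
    show "J = {y. odd (i + int k + y) \<and> - (s + int (k - 1)) \<le> y \<and> y \<le> s + int (k - 1) \<and>
        - (s + int k) \<le> y \<and> y \<le> s + int k}"
    proof (intro equalityI subsetI)
      fix y assume "y \<in> J"
      from J[OF this] k show "y \<in> {y. odd (i + int k + y) \<and> - (s + int (k - 1)) \<le> y \<and> y \<le> s + int (k - 1) \<and>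
        - (s + int k) \<le> y \<and> y \<le> s + int k}" by (auto simp: of_nat_diff)
    qed (use assms(1) in \<open>auto simp: J_def lo_def hi_def\<close>)
  qed (use E' in auto)
  also have "\<dots> = (\<Sum>D\<in>Pow J. if tileable ({lo..hi} - E - D) then (\<Prod>y\<in>D. qplus q y) *
      (if card D = k then (\<Prod>y\<in>D. 1) * Vdm (qx q) D else 0) else 0) / (\<Prod>j<k. qfact q j)"
    unfolding sum_divide_distrib
  proof (rule sum.cong[OF refl])
    fix D assume "D \<in> Pow J"
    then have "dented_sum q i k (\<lambda>j. - (s + int j)) (\<lambda>j. s + int j) D =
      (if card D = k then Vdm (qx q) D / (\<Prod>j<k. qfact q j) else 0)"
      using J by (intro Suc.IH) blast
    then show "(if tileable ({lo..hi} - E - D) then (\<Prod>y\<in>D. qplus q y) *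
      dented_sum q i k (\<lambda>j. - (s + int j)) (\<lambda>j. s + int j) D else 0) =
      (if tileable ({lo..hi} - E - D) then (\<Prod>y\<in>D. qplus q y) *
      (if card D = k then (\<Prod>y\<in>D. 1) * Vdm (qx q) D else 0) else 0) / (\<Prod>j<k. qfact q j)"
      by simp
  qed
  also have "\<dots> = (if card E = Suc k then Vdm (qx q) E / (\<Prod>j<Suc k. qfact q j) else 0)"
  proof (cases "card E = Suc k")
    case True
    obtain e where e: "E = e ` {..<Suc k}" "\<And>i j. i < j \<Longrightarrow> j < Suc k \<Longrightarrow> e i < e j"
      using finite_int_set_enumerate[OF finE] True by auto
    have e': "E = e ` {..k}" using e(1) by (simp add: lessThan_Suc_atMost)
    have "(\<Sum>D\<in>Pow J. if tileable ({lo..hi} - e ` {..k} - D) then (\<Prod>y\<in>D. qplus q y) *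
      (if card D = k then (\<Prod>y\<in>D. 1) * Vdm (qx q) D else 0) else 0) * (\<Prod>j<k. coeff (step_poly q j) j) =
      det (mat (Suc k) (Suc k) (\<lambda>(i, j). if j = 0 then 1 else qx q (e i) ^ (j - 1 + 1)))"
      unfolding J_def
      by (rule strip_sum[where G = "\<lambda>j y. qx q y ^ (j + 1)"])
        (use e E e' lohi poly_step_poly[OF q0 q1] degree_step_polys in auto)
    also have "\<dots> = Vdm (qx q) E"
      unfolding det_bordered_powers e(1) by (rule Vdm_enumerated[symmetric]) (use e(2) in auto)
    finally have *: "(\<Sum>D\<in>Pow J. if tileable ({lo..hi} - E - D) then (\<Prod>y\<in>D. qplus q y) *
      (if card D = k then (\<Prod>y\<in>D. 1) * Vdm (qx q) D else 0) else 0) * qfact q k = Vdm (qx q) E"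
      by (simp add: e' coeff_step_poly[OF q0 q1] qfact_eq)
    show ?thesis
      unfolding eq_divideI[OF * qfact_nonzero] using True by (simp add: mult.commute)
  next
    case False
    have "(\<Sum>D\<in>Pow J. if tileable ({lo..hi} - E - D) then
      (if card D = k then (\<Prod>y\<in>D. qplus q y) * ((\<Prod>y\<in>D. 1) * Vdm (qx q) D) else 0) else 0) = 0"
      unfolding J_def by (rule strip_sum_card[OF finE E lohi False])
    then show ?thesis using False by (simp add: if_distrib[of "(*) _"] cong: if_cong)
  qed
  finally show ?case .
qed

text \<open>The denominators of the two kinds of strips of the half hexagon are products of odd and
  of even q-numbers; this merges them.\<close>

lemma qfact_odd_split:
  "qfact q (2 * Suc k - 1) = (\<Prod>j<Suc k. qnum q (2 * int j + 1)) * (\<Prod>j<k. qnum q (2 * int j + 2))"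
proof (induction k)
  case (Suc k)
  have "qfact q (2 * Suc (Suc k) - 1) = qfact q (2 * Suc k - 1) * qnum q (2 * int k + 2) * qnum q (2 * int k + 3)"
    by (simp add: qfact_eq add_ac)
  with Suc show ?case by (simp add: add_ac mult_ac)
qed (simp add: qfact_eq)

text \<open>In the even columns the lowest triangle points right. A phantom dent in row 0 restores the
  interlacing pattern of a trapezoid; it contributes the unit row of the bordered determinant.\<close>

lemma half_hexagon_sum_odd_step:
  assumes h: "even h" "0 \<le> h"
    and IH: "\<And>D. D \<subseteq> {y. odd y \<and> 1 \<le> y \<and> y \<le> h + 2 * int k - 1} \<Longrightarrow> half_hexagon_sum q h (2 * k) D =
      (if card D = k then Vdm (\<lambda>y. (qx q y)\<^sup>2) D * a else 0)"
    and E: "E \<subseteq> {y. even y \<and> 1 \<le> y \<and> y \<le> h + 2 * int k}"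
  shows "half_hexagon_sum q h (Suc (2 * k)) E =
    (if card E = k then (\<Prod>y\<in>E. qx q y) * Vdm (\<lambda>y. (qx q y)\<^sup>2) E * a / (\<Prod>j<k. qnum q (2 * int j + 1)) else 0)"
proof -
  define hi where "hi = h + 2 * int k"
  define J where "J = {y\<in>{0..hi}. odd (y - 0)}"
  let ?f = "\<lambda>y. (qx q y)\<^sup>2"
  have finE: "finite E" by (rule finite_subset[of _ "{0..hi}"]) (use E in \<open>auto simp: hi_def\<close>)
  have hi: "0 \<le> hi" "even (hi - 0)" using h by (auto simp: hi_def)
  have J: "odd y \<and> 1 \<le> y \<and> y \<le> hi - 1" if "y \<in> J" for y
  proof -
    have "y \<noteq> 0" "y \<noteq> hi" using that hi by (auto simp: J_def)
    then show ?thesis using that by (auto simp: J_def)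
  qed
  have strip: "{1..hi} - E - D = {0..hi} - insert 0 E - D" for D
    by auto
  have "half_hexagon_sum q h (Suc (2 * k)) E = (\<Sum>D\<in>Pow J. if tileable ({0..hi} - insert 0 E - D)
      then (\<Prod>y\<in>D. qplus q y) * half_hexagon_sum q h (2 * k) D else 0)"
    unfolding strip[symmetric] unfolding half_hexagon_sum_def hi_def
  proof (subst dented_sum_Suc[where J = J])
    show "finite J" by (rule finite_subset[of _ "{0..hi}"]) (auto simp: J_def)
    assume k: "1 \<le> 2 * k"
    show "J = {y. odd (0 + int (2 * k) + y) \<and> 1 \<le> y \<and> y \<le> h + int (2 * k - 1) \<and> 1 \<le> y \<and> y \<le> h + int (2 * k)}"
    proof (intro equalityI subsetI)
      fix y assume "y \<in> J"
      from J[OF this] k show "y \<in> {y. odd (0 + int (2 * k) + y) \<and> 1 \<le> y \<and> y \<le> h + int (2 * k - 1) \<and>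
        1 \<le> y \<and> y \<le> h + int (2 * k)}" by (auto simp: hi_def of_nat_diff)
    qed (auto simp: J_def hi_def)
  qed (use E in auto)
  also have "\<dots> = (\<Sum>D\<in>Pow J. if tileable ({0..hi} - insert 0 E - D) then (\<Prod>y\<in>D. qplus q y) *
      (if card D = k then (\<Prod>y\<in>D. 1) * Vdm ?f D else 0) else 0) * a"
    unfolding sum_distrib_right
  proof (rule sum.cong[OF refl])
    fix D assume "D \<in> Pow J"
    then have "half_hexagon_sum q h (2 * k) D = (if card D = k then Vdm ?f D * a else 0)"
      using J by (intro IH) (auto simp: hi_def)
    then show "(if tileable ({0..hi} - insert 0 E - D) then (\<Prod>y\<in>D. qplus q y) * half_hexagon_sum q h (2 * k) D else 0) =
      (if tileable ({0..hi} - insert 0 E - D) then (\<Prod>y\<in>D. qplus q y) *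
      (if card D = k then (\<Prod>y\<in>D. 1) * Vdm ?f D else 0) else 0) * a"
      by simp
  qed
  also have "\<dots> = (if card E = k then (\<Prod>y\<in>E. qx q y) * Vdm ?f E * a / (\<Prod>j<k. qnum q (2 * int j + 1)) else 0)"
  proof (cases "card E = k")
    case True
    have card: "card (insert 0 E) = Suc k" using True finE E by (subst card_insert_disjoint) auto
    obtain e where e: "insert 0 E = e ` {..<Suc k}" "\<And>i j. i < j \<Longrightarrow> j < Suc k \<Longrightarrow> e i < e j"
      using finite_int_set_enumerate[of "insert 0 E"] finE card by auto
    have e': "insert 0 E = e ` {..k}" using e(1) by (simp add: lessThan_Suc_atMost)
    have e0: "e 0 = 0"
    proof -
      have "0 \<in> e ` {..<Suc k}" unfolding e(1)[symmetric] by simp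
      then obtain j where j: "j < Suc k" "e j = 0" by auto
      have "e 0 \<in> insert 0 E" unfolding e(1) by simp
      then have "e 0 \<ge> 0" using E by auto
      with j show ?thesis using e(2)[of 0 j] by (cases j) auto
    qed
    have E_eq: "E = (\<lambda>i. e (Suc i)) ` {..<k}"
    proof -
      have "e ` {..<Suc k} = insert 0 ((\<lambda>i. e (Suc i)) ` {..<k})"
        by (simp add: lessThan_Suc_eq_insert_0 e0 image_image)
      moreover have "0 \<notin> (\<lambda>i. e (Suc i)) ` {..<k}" using e(2)[of 0] e0 by force
      moreover have "0 \<notin> E" using E by auto
      ultimately show ?thesis using e(1) by (metis Diff_insert_absorb)
    qed
    have inj: "inj_on (\<lambda>i. e (Suc i)) {..<k}"
      using e(2) by (intro linorder_inj_onI) (auto simp: less_le)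
    have "(\<Sum>D\<in>Pow J. if tileable ({0..hi} - e ` {..k} - D) then (\<Prod>y\<in>D. qplus q y) *
      (if card D = k then (\<Prod>y\<in>D. 1) * Vdm ?f D else 0) else 0) * (\<Prod>j<k. coeff (step_poly_even q j) j) =
      det (mat (Suc k) (Suc k) (\<lambda>(i, j). if j = 0 then 1 else qx q (e i) ^ (2 * (j - 1) + 1)))"
      unfolding J_def
    proof (rule strip_sum[where G = "\<lambda>j y. qx q y ^ (2 * j + 1)"])
      show "e ` {..k} \<subseteq> {0..hi}" unfolding e'[symmetric] using E hi by (auto simp: hi_def)
      show "even (e i - 0)" if "i \<le> k" for i
      proof -
        have "e i \<in> insert 0 E" unfolding e' using that by blast
        then show ?thesis using E by auto
      qed
    qed (use e hi poly_step_poly_even[OF q0 q1] degree_step_polys in auto)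
    \<comment> \<open>The powers are odd: they vanish in the phantom row, and in every other row
      they split off one factor \<open>qx\<close>. This is the origin of the product of x over the
      dents.\<close>
    also have "\<dots> = det (mat k k (\<lambda>(i, j). qx q (e (Suc i)) * (qx q (e (Suc i)))\<^sup>2 ^ j))"
      by (subst det_first_row_unit[where A = "\<lambda>i j. if j = 0 then 1 else qx q (e i) ^ (2 * (j - 1) + 1)"])
        (simp_all add: e0 power_mult)
    also have "\<dots> = (\<Prod>y\<in>E. qx q y) * Vdm ?f E"
      unfolding det_scale_rows det_powers E_eq
      by (subst Vdm_enumerated) (use e(2) inj in \<open>auto simp: prod.reindex\<close>)
    finally have *: "(\<Sum>D\<in>Pow J. if tileable ({0..hi} - insert 0 E - D) then (\<Prod>y\<in>D. qplus q y) *
      (if card D = k then (\<Prod>y\<in>D. 1) * Vdm ?f D else 0) else 0) * (\<Prod>j<k. qnum q (2 * int j + 1)) =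
      (\<Prod>y\<in>E. qx q y) * Vdm ?f E"
      by (simp add: e' coeff_step_poly_even[OF q0 q1])
    have "(\<Prod>j<k. qnum q (2 * int j + 1)) \<noteq> 0" by (simp add: qnum_nonzero')
    from eq_divideI[OF * this] show ?thesis using True by (simp only: if_True simp_thms times_divide_eq_left)
  next
    case False
    have card: "card (insert 0 E) \<noteq> Suc k" using False finE E by (subst card_insert_disjoint) auto
    have "(\<Sum>D\<in>Pow J. if tileable ({0..hi} - insert 0 E - D) then
      (if card D = k then (\<Prod>y\<in>D. qplus q y) * ((\<Prod>y\<in>D. 1) * Vdm ?f D) else 0) else 0) = 0"
      unfolding J_def by (rule strip_sum_card[OF _ _ _ hi card]) (use finE E hi in \<open>auto simp: hi_def\<close>)
    then show ?thesis using False by (simp add: if_distrib[of "(*) _"] cong: if_cong)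
  qed
  finally show ?thesis .
qed

text \<open>In the odd columns row 1 points left like the top row, so the column gains a dent as in
  a trapezoid. The factor \<open>qx\<close> that each inner dent carries is consumed by the
  antidifference: weight times \<open>qx\<close> times \<open>step_poly_odd\<close> is a difference
  of even powers.\<close>

lemma half_hexagon_sum_even_step:
  assumes h: "even h" "0 \<le> h"
    and IH: "\<And>D. D \<subseteq> {y. even y \<and> 1 \<le> y \<and> y \<le> h + 2 * int k} \<Longrightarrow> half_hexagon_sum q h (Suc (2 * k)) D =
      (if card D = k then (\<Prod>y\<in>D. qx q y) * Vdm (\<lambda>y. (qx q y)\<^sup>2) D * a else 0)"
    and E: "E \<subseteq> {y. odd y \<and> 1 \<le> y \<and> y \<le> h + 2 * int k + 1}"
  shows "half_hexagon_sum q h (Suc (Suc (2 * k))) E =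
    (if card E = Suc k then Vdm (\<lambda>y. (qx q y)\<^sup>2) E * a / (\<Prod>j<k. qnum q (2 * int j + 2)) else 0)"
proof -
  define hi where "hi = h + 2 * int k + 1"
  define J where "J = {y\<in>{1..hi}. odd (y - 1)}"
  let ?f = "\<lambda>y. (qx q y)\<^sup>2"
  have E': "E \<subseteq> {1..hi}" "\<And>y. y \<in> E \<Longrightarrow> even (y - 1)"
    using E by (auto simp: hi_def)
  have finE: "finite E" by (rule finite_subset[OF E'(1)]) simp
  have hi: "1 \<le> hi" "even (hi - 1)" using h by (auto simp: hi_def)
  have J: "even y \<and> 1 \<le> y \<and> y \<le> hi - 1" if "y \<in> J" for y
  proof -
    have "y \<noteq> hi" using that hi by (auto simp: J_def)
    then show ?thesis using that by (auto simp: J_def)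
  qed
  have "half_hexagon_sum q h (Suc (Suc (2 * k))) E = (\<Sum>D\<in>Pow J. if tileable ({1..hi} - E - D)
      then (\<Prod>y\<in>D. qplus q y) * half_hexagon_sum q h (Suc (2 * k)) D else 0)"
    unfolding half_hexagon_sum_def hi_def
  proof (subst dented_sum_Suc[where J = J])
    show "finite J" by (rule finite_subset[of _ "{1..hi}"]) (auto simp: J_def)
    show "J = {y. odd (0 + int (Suc (2 * k)) + y) \<and> 1 \<le> y \<and> y \<le> h + int (Suc (2 * k) - 1) \<and>
        1 \<le> y \<and> y \<le> h + int (Suc (2 * k))}"
      using J by (auto simp: J_def hi_def)
  qed (use E in \<open>auto simp: add_ac\<close>)
  also have "\<dots> = (\<Sum>D\<in>Pow J. if tileable ({1..hi} - E - D) then (\<Prod>y\<in>D. qplus q y) *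
      (if card D = k then (\<Prod>y\<in>D. qx q y) * Vdm ?f D else 0) else 0) * a"
    unfolding sum_distrib_right
  proof (rule sum.cong[OF refl])
    fix D assume "D \<in> Pow J"
    then have "half_hexagon_sum q h (Suc (2 * k)) D =
      (if card D = k then (\<Prod>y\<in>D. qx q y) * Vdm ?f D * a else 0)"
      using J by (intro IH) (auto simp: hi_def)
    then show "(if tileable ({1..hi} - E - D) then (\<Prod>y\<in>D. qplus q y) * half_hexagon_sum q h (Suc (2 * k)) D else 0) =
      (if tileable ({1..hi} - E - D) then (\<Prod>y\<in>D. qplus q y) *
      (if card D = k then (\<Prod>y\<in>D. qx q y) * Vdm ?f D else 0) else 0) * a"
      by simp
  qed
  also have "\<dots> = (if card E = Suc k then Vdm ?f E * a / (\<Prod>j<k. qnum q (2 * int j + 2)) else 0)"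
  proof (cases "card E = Suc k")
    case True
    obtain e where e: "E = e ` {..<Suc k}" "\<And>i j. i < j \<Longrightarrow> j < Suc k \<Longrightarrow> e i < e j"
      using finite_int_set_enumerate[OF finE] True by auto
    have e': "E = e ` {..k}" using e(1) by (simp add: lessThan_Suc_atMost)
    have "(\<Sum>D\<in>Pow J. if tileable ({1..hi} - e ` {..k} - D) then (\<Prod>y\<in>D. qplus q y) *
      (if card D = k then (\<Prod>y\<in>D. qx q y) * Vdm ?f D else 0) else 0) * (\<Prod>j<k. coeff (step_poly_odd q j) j) =
      det (mat (Suc k) (Suc k) (\<lambda>(i, j). if j = 0 then 1 else ?f (e i) ^ (j - 1 + 1)))"
      unfolding J_def
    proof (rule strip_sum[where G = "\<lambda>j y. ?f y ^ (j + 1)"])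
      show "qplus q y * qx q y * poly (step_poly_odd q j) (?f y) = ?f (y + 1) ^ (j + 1) - ?f (y - 1) ^ (j + 1)" for y j
        using poly_step_poly_odd[OF q0 q1, of y j]
        by (simp only: power_mult[symmetric] distrib_left mult_1_right)
    qed (use e E' e' hi degree_step_polys in auto)
    also have "\<dots> = Vdm ?f E"
      unfolding det_bordered_powers e(1) by (rule Vdm_enumerated[symmetric]) (use e(2) in auto)
    finally have *: "(\<Sum>D\<in>Pow J. if tileable ({1..hi} - E - D) then (\<Prod>y\<in>D. qplus q y) *
      (if card D = k then (\<Prod>y\<in>D. qx q y) * Vdm ?f D else 0) else 0) * (\<Prod>j<k. qnum q (2 * int j + 2)) = Vdm ?f E"
      by (simp add: e' coeff_step_poly_odd[OF q0 q1])
    have "(\<Prod>j<k. qnum q (2 * int j + 2)) \<noteq> 0" by (simp add: qnum_nonzero')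
    from eq_divideI[OF * this] show ?thesis using True by (simp only: if_True simp_thms times_divide_eq_left)
  next
    case False
    have "(\<Sum>D\<in>Pow J. if tileable ({1..hi} - E - D) then
      (if card D = k then (\<Prod>y\<in>D. qplus q y) * ((\<Prod>y\<in>D. qx q y) * Vdm ?f D) else 0) else 0) = 0"
      unfolding J_def by (rule strip_sum_card[OF finE E' hi False])
    then show ?thesis using False by (simp add: if_distrib[of "(*) _"] cong: if_cong)
  qed
  finally show ?thesis .
qed

text \<open>The odd q-numbers in the numerator are the part of the odd q-factorials that is still to
  be divided out; the next strip divides by exactly this product, which leaves the clean formula of
  \<open>half_hexagon_sum_odd\<close>.\<close>

lemma half_hexagon_sum_even:
  assumes h: "even h" "0 \<le> h" and E: "E \<subseteq> {y. odd y \<and> 1 \<le> y \<and> y \<le> h + 2 * int k - 1}"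
  shows "half_hexagon_sum q h (2 * k) E = (if card E = k then
    Vdm (\<lambda>y. (qx q y)\<^sup>2) E * ((\<Prod>j<k. qnum q (2 * int j + 1)) / (\<Prod>i = 1..k. qfact q (2 * i - 1))) else 0)"
  using E
proof (induction k arbitrary: E)
  case 0
  have "E \<subseteq> {1..h}" using 0 by auto
  then have "finite E" by (rule finite_subset) simp
  then show ?case by (auto simp: half_hexagon_sum_def dented_sum_def Vdm_def)
next
  case (Suc k)
  define c where "c = (\<Prod>j<k. qnum q (2 * int j + 1)) / (\<Prod>i = 1..k. qfact q (2 * i - 1))"
  define c' where "c' = c / (\<Prod>j<k. qnum q (2 * int j + 1))"
  have nz: "(\<Prod>j<k. qnum q (2 * int j + 1)) \<noteq> 0" "(\<Prod>j<k. qnum q (2 * int j + 2)) \<noteq> 0" "qnum q (2 * int k + 1) \<noteq> 0" "(\<Prod>i = 1..k. qfact q (2 * i - 1)) \<noteq> 0"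
    by (simp_all add: qnum_nonzero' qfact_nonzero)
  have "half_hexagon_sum q h (Suc (2 * k)) D =
      (if card D = k then (\<Prod>y\<in>D. qx q y) * Vdm (\<lambda>y. (qx q y)\<^sup>2) D * c' else 0)"
    if "D \<subseteq> {y. even y \<and> 1 \<le> y \<and> y \<le> h + 2 * int k}" for D
    using half_hexagon_sum_odd_step[OF h Suc.IH that] by (simp add: c_def c'_def)
  moreover have "E \<subseteq> {y. odd y \<and> 1 \<le> y \<and> y \<le> h + 2 * int k + 1}"
    using Suc.prems by auto
  ultimately have "half_hexagon_sum q h (Suc (Suc (2 * k))) E = (if card E = Suc k then
      Vdm (\<lambda>y. (qx q y)\<^sup>2) E * c' / (\<Prod>j<k. qnum q (2 * int j + 2)) else 0)"
    by (rule half_hexagon_sum_even_step[OF h])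
  then have "half_hexagon_sum q h (2 * Suc k) E = (if card E = Suc k then
      Vdm (\<lambda>y. (qx q y)\<^sup>2) E * (c' / (\<Prod>j<k. qnum q (2 * int j + 2))) else 0)"
    by simp
  also have "c' / (\<Prod>j<k. qnum q (2 * int j + 2)) = (\<Prod>j<Suc k. qnum q (2 * int j + 1)) / (\<Prod>i = 1..Suc k. qfact q (2 * i - 1))"
    using nz qfact_odd_split[of k] by (simp add: c_def c'_def)
  finally show ?case .
qed

lemma half_hexagon_sum_odd:
  assumes h: "even h" "0 \<le> h" and E: "E \<subseteq> {y. even y \<and> 1 \<le> y \<and> y \<le> h + 2 * int k}"
  shows "half_hexagon_sum q h (Suc (2 * k)) E =
    (if card E = k then (\<Prod>y\<in>E. qx q y) * Vdm (\<lambda>y. (qx q y)\<^sup>2) E / (\<Prod>i = 1..k. qfact q (2 * i - 1)) else 0)"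
proof -
  have "(\<Prod>j<k. qnum q (2 * int j + 1)) \<noteq> 0" by (simp add: qnum_nonzero')
  then show ?thesis
    using half_hexagon_sum_odd_step[OF h half_hexagon_sum_even[OF h] E] by simp
qed

end

section \<open>Products of differences over symmetric sets\<close>

text \<open>Absolute values remove the dependence on the order of the labels, so that the product
  splits over unions. For increasing \<open>f\<close> it agrees with \<open>Vdm\<close>.\<close>

definition Vabs :: "(int \<Rightarrow> 'a :: linordered_field) \<Rightarrow> int set \<Rightarrow> 'a" where
  "Vabs f S = (\<Prod>(s, t)\<in>{(s, t). s \<in> S \<and> t \<in> S \<and> s < t}. \<bar>f t - f s\<bar>)"

definition cross :: "(int \<Rightarrow> 'a :: linordered_field) \<Rightarrow> int set \<Rightarrow> int set \<Rightarrow> 'a" where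
  "cross f A F = (\<Prod>x\<in>A. \<Prod>y\<in>F. \<bar>f y - f x\<bar>)"

lemma Vabs_empty [simp]: "Vabs f {} = 1"
  by (simp add: Vabs_def)

lemma Vabs_insert:
  assumes "finite S" "x \<notin> S"
  shows "Vabs f (insert x S) = Vabs f S * (\<Prod>y\<in>S. \<bar>f y - f x\<bar>)"
proof -
  let ?A = "{y \<in> S. y < x}" and ?B = "{y \<in> S. x < y}"
  let ?g = "\<lambda>(s, t). \<bar>f t - f s\<bar>"
  have pairs: "{(s, t). s \<in> insert x S \<and> t \<in> insert x S \<and> s < t} =
    {(s, t). s \<in> S \<and> t \<in> S \<and> s < t} \<union> ((\<lambda>y. (y, x)) ` ?A \<union> Pair x ` ?B)"
    by auto
  have fin: "finite {(s, t). s \<in> S \<and> t \<in> S \<and> s < t}"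
    by (rule finite_subset[of _ "S \<times> S"]) (use assms in auto)
  have "Vabs f (insert x S) = Vabs f S * (prod ?g ((\<lambda>y. (y, x)) ` ?A) * prod ?g (Pair x ` ?B))"
  proof -
    have "prod ?g ({(s, t). s \<in> S \<and> t \<in> S \<and> s < t} \<union> ((\<lambda>y. (y, x)) ` ?A \<union> Pair x ` ?B)) =
      prod ?g {(s, t). s \<in> S \<and> t \<in> S \<and> s < t} * prod ?g ((\<lambda>y. (y, x)) ` ?A \<union> Pair x ` ?B)"
      by (rule prod.union_disjoint) (use fin assms in auto)
    also have "prod ?g ((\<lambda>y. (y, x)) ` ?A \<union> Pair x ` ?B) =
      prod ?g ((\<lambda>y. (y, x)) ` ?A) * prod ?g (Pair x ` ?B)"
      by (rule prod.union_disjoint) (use assms in auto)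
    finally show ?thesis unfolding Vabs_def pairs .
  qed
  also have "prod ?g ((\<lambda>y. (y, x)) ` ?A) = (\<Prod>y\<in>?A. \<bar>f y - f x\<bar>)"
    by (subst prod.reindex) (auto simp: inj_on_def abs_minus_commute)
  also have "prod ?g (Pair x ` ?B) = (\<Prod>y\<in>?B. \<bar>f y - f x\<bar>)"
    by (subst prod.reindex) (auto simp: inj_on_def)
  also have "(\<Prod>y\<in>?A. \<bar>f y - f x\<bar>) * (\<Prod>y\<in>?B. \<bar>f y - f x\<bar>) = (\<Prod>y\<in>?A \<union> ?B. \<bar>f y - f x\<bar>)"
    by (rule prod.union_disjoint[symmetric]) (use assms in auto)
  also have "?A \<union> ?B = S" using assms by auto (metis linorder_cases)
  finally show ?thesis .
qed

lemma Vabs_Un: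
  assumes "finite A" "finite F" "A \<inter> F = {}"
  shows "Vabs f (A \<union> F) = Vabs f A * Vabs f F * cross f A F"
  using assms(2,3)
proof (induction F rule: finite_induct)
  case empty
  then show ?case by (simp add: cross_def)
next
  case (insert x F)
  have "Vabs f (A \<union> insert x F) = Vabs f (A \<union> F) * (\<Prod>y\<in>A \<union> F. \<bar>f y - f x\<bar>)"
    using insert assms(1) Vabs_insert[of "A \<union> F" x f] by simp
  also have "(\<Prod>y\<in>A \<union> F. \<bar>f y - f x\<bar>) = (\<Prod>y\<in>A. \<bar>f x - f y\<bar>) * (\<Prod>y\<in>F. \<bar>f y - f x\<bar>)"
    using insert assms(1) by (subst prod.union_disjoint) (auto simp: abs_minus_commute)
  finally show ?case
    using insert by (simp add: Vabs_insert cross_def prod.distrib mult_ac)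
qed

lemma cross_Un: "finite A \<Longrightarrow> finite S \<Longrightarrow> A \<inter> S = {} \<Longrightarrow> cross f (A \<union> S) F = cross f A F * cross f S F"
  by (simp add: cross_def prod.union_disjoint)

lemma Vabs_uminus_image:
  assumes "finite S"
  shows "Vabs f (uminus ` S) = Vabs (\<lambda>z. f (- z)) S"
  using assms
proof (induction S rule: finite_induct)
  case (insert x S)
  moreover have "- x \<notin> uminus ` S" using insert(2) by auto
  ultimately show ?case
    by (simp add: Vabs_insert prod.reindex)
qed simp

lemma Vabs_eq_Vdm: "(\<And>s t. s \<in> S \<Longrightarrow> t \<in> S \<Longrightarrow> s < t \<Longrightarrow> f s < f t) \<Longrightarrow> Vdm f S = Vabs f S"
  unfolding Vabs_def Vdm_def by (rule prod.cong) (auto simp: less_imp_le)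

lemma Vdm_image:
  assumes "strict_mono g"
  shows "Vdm f (g ` S) = Vdm (\<lambda>z. f (g z)) S"
proof -
  have "{(s, t). s \<in> g ` S \<and> t \<in> g ` S \<and> s < t} =
    (\<lambda>(s, t). (g s, g t)) ` {(s, t). s \<in> S \<and> t \<in> S \<and> s < t}"
    using strict_mono_less[OF assms] by auto
  moreover have "inj_on (\<lambda>(s, t). (g s, g t)) {(s, t). s \<in> S \<and> t \<in> S \<and> s < t}"
    using strict_mono_eq[OF assms] by (auto simp: inj_on_def)
  ultimately show ?thesis
    unfolding Vdm_def by (simp add: prod.reindex case_prod_unfold)
qed

section \<open>Positive and negative labels\<close>

definition pos_part :: "int set \<Rightarrow> int set" where
  "pos_part A = {z \<in> A. 0 < z}"

definition neg_part :: "int set \<Rightarrow> int set" where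
  "neg_part A = {z \<in> A. z < 0}"

lemma finite_parts [simp]: "finite A \<Longrightarrow> finite (pos_part A)" "finite A \<Longrightarrow> finite (neg_part A)"
  by (simp_all add: pos_part_def neg_part_def)

lemma parts_Un: "pos_part (A \<union> F) = pos_part A \<union> pos_part F" "neg_part (A \<union> F) = neg_part A \<union> neg_part F"
  by (auto simp: pos_part_def neg_part_def)

lemma parts_disjoint: "A \<inter> F = {} \<Longrightarrow> pos_part A \<inter> pos_part F = {}" "A \<inter> F = {} \<Longrightarrow> neg_part A \<inter> neg_part F = {}"
  by (auto simp: pos_part_def neg_part_def)

lemma parts_cover: "0 \<notin> A \<Longrightarrow> pos_part A \<union> neg_part A = A" "pos_part A \<inter> neg_part A = {}"
proof -
  have "0 < x \<or> x < 0" if "0 \<notin> A" "x \<in> A" for x :: int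
    using that by (cases "x = 0") auto
  then show "0 \<notin> A \<Longrightarrow> pos_part A \<union> neg_part A = A" by (auto simp: pos_part_def neg_part_def)
qed (auto simp: pos_part_def neg_part_def)

lemma prod_parts:
  assumes "0 \<notin> A" "finite A"
  shows "prod g A = prod g (pos_part A) * prod g (neg_part A)"
proof -
  have "prod g (pos_part A \<union> neg_part A) = prod g (pos_part A) * prod g (neg_part A)"
    using assms(2) parts_cover(2) by (intro prod.union_disjoint) auto
  then show ?thesis using parts_cover(1)[OF assms(1)] by simp
qed

lemma neg_part_symmetric: "F = uminus ` F \<Longrightarrow> neg_part F = uminus ` pos_part F"
proof -
  assume F: "F = uminus ` F"
  have "- x \<in> F" if "x \<in> F" for x
    using F that by (metis imageI)
  then show ?thesis by (force simp: pos_part_def neg_part_def)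
qed

text \<open>Negation pairs the elements, with 0 as the only fixed point; thus an even cardinality
  excludes 0.\<close>

lemma card_symmetric:
  assumes "F = uminus ` F" "finite F"
  shows "0 \<in> F \<Longrightarrow> odd (card F)" and "0 \<notin> F \<Longrightarrow> card F = 2 * card (pos_part F)"
    and "card (neg_part F) = card (pos_part F)"
proof -
  show neg: "card (neg_part F) = card (pos_part F)"
    by (simp add: neg_part_symmetric[OF assms(1)] card_image)
  have parts: "card (pos_part F \<union> neg_part F) = 2 * card (pos_part F)"
    using assms(2) neg parts_cover(2)[of F] by (simp add: card_Un_disjoint)
  then show "0 \<notin> F \<Longrightarrow> card F = 2 * card (pos_part F)"
    using parts_cover(1)[of F] by simp
  show "odd (card F)" if "0 \<in> F"
  proof -
    have "F = insert 0 (pos_part F \<union> neg_part F)" using that by (auto simp: pos_part_def neg_part_def)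
    moreover have "0 \<notin> pos_part F \<union> neg_part F" by (auto simp: pos_part_def neg_part_def)
    ultimately have "card F = Suc (card (pos_part F \<union> neg_part F))"
      using assms(2) by (metis card_insert_disjoint finite_Un finite_parts)
    with parts show ?thesis by simp
  qed
qed

definition left_weight :: "(int \<Rightarrow> 'a :: linordered_field) \<Rightarrow> int set \<Rightarrow> 'a" where
  "left_weight X A = (\<Prod>z\<in>A. \<bar>X z\<bar>) * (Vabs (\<lambda>z. (X z)\<^sup>2) (pos_part A) * Vabs (\<lambda>z. (X z)\<^sup>2) (neg_part A))"

text \<open>For symmetric \<open>F\<close> without 0 this is the positive square root of the product
  of \<open>\<bar>X z\<bar> / 2\<close> over all of \<open>F\<close>, see
  \<open>root_weight_square\<close>.\<close>

definition root_weight :: "(int \<Rightarrow> 'a :: linordered_field) \<Rightarrow> int set \<Rightarrow> 'a" where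
  "root_weight X F = (\<Prod>z\<in>pos_part F. \<bar>X z\<bar> / 2)"

lemma prod_eq_0D: "prod f A = 0 \<Longrightarrow> \<exists>a\<in>A. f a = 0" for f :: "'b \<Rightarrow> 'a :: linordered_field"
  by (cases "finite A") auto

section \<open>Contribution of a symmetric set of dents\<close>

context
  fixes X :: "int \<Rightarrow> 'a :: linordered_field"
  assumes strict: "strict_mono X" and odd: "\<And>z. X (- z) = - X z"
begin

lemma strict_odd_0: "X 0 = 0"
  using odd[of 0] by simp

lemma strict_odd_pos: "0 < z \<Longrightarrow> 0 < X z"
  using strict_monoD[OF strict, of 0 z] strict_odd_0 by simp

lemma strict_odd_nonzero: "z \<noteq> 0 \<Longrightarrow> X z \<noteq> 0"
  using strict_mono_eq[OF strict, of z 0] strict_odd_0 by simp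

lemma strict_odd_diff_eq_0: "X y - X x = 0 \<longleftrightarrow> y = x"
  using strict_mono_eq[OF strict] by simp

lemma Vabs_nonzero: "Vabs X S \<noteq> 0"
proof
  assume "Vabs X S = 0"
  then obtain p where "p \<in> {(s, t). s \<in> S \<and> t \<in> S \<and> s < t}" "(case p of (s, t) \<Rightarrow> \<bar>X t - X s\<bar>) = 0"
    unfolding Vabs_def by (blast dest: prod_eq_0D)
  then obtain s t where "s < t" "\<bar>X t - X s\<bar> = 0" by auto
  then show False using strict_odd_diff_eq_0[of t s] by simp
qed

lemma cross_nonzero:
  assumes "A \<inter> F = {}"
  shows "cross X A F \<noteq> 0"
proof
  assume "cross X A F = 0"
  then obtain x where x: "x \<in> A" "(\<Prod>y\<in>F. \<bar>X y - X x\<bar>) = 0"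
    unfolding cross_def by (blast dest: prod_eq_0D)
  then obtain y where "y \<in> F" "\<bar>X y - X x\<bar> = 0"
    by (blast dest: prod_eq_0D)
  with assms x(1) show False using strict_odd_diff_eq_0[of y x] by auto
qed

lemma root_weight_pos: "finite F \<Longrightarrow> 0 < root_weight X F"
  unfolding root_weight_def by (rule prod_pos) (auto simp: pos_part_def strict_odd_nonzero)

lemma prod_symmetric:
  fixes g :: "int \<Rightarrow> 'a"
  assumes "F = uminus ` F" "0 \<notin> F" "finite F" and g: "\<And>z. g (- z) = g z"
  shows "(\<Prod>z\<in>F. g z) = (\<Prod>z\<in>pos_part F. g z)\<^sup>2"
proof -
  have "(\<Prod>z\<in>F. g z) = (\<Prod>z\<in>pos_part F. g z) * (\<Prod>z\<in>neg_part F. g z)"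
    by (rule prod_parts[OF assms(2,3)])
  also have "(\<Prod>z\<in>neg_part F. g z) = (\<Prod>z\<in>pos_part F. g z)"
    unfolding neg_part_symmetric[OF assms(1)] by (simp add: prod.reindex g)
  finally show ?thesis by (simp add: power2_eq_square)
qed

lemma root_weight_square:
  assumes "F = uminus ` F" "0 \<notin> F" "finite F"
  shows "(\<Prod>z\<in>F. \<bar>X z\<bar> / 2) = (root_weight X F)\<^sup>2"
  unfolding root_weight_def by (rule prod_symmetric[OF assms]) (simp add: odd)

text \<open>Every unordered pair contributes its difference twice and, through the double product,
  its sum twice, hence twice the difference of squares; the diagonal contributes the factors
  \<open>2 * \<bar>X z\<bar>\<close>.\<close>

lemma Vabs_squares:
  assumes "finite P"
  shows "Vabs X P * Vabs X P * (\<Prod>x\<in>P. \<Prod>y\<in>P. \<bar>X y + X x\<bar>) =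
    Vabs (\<lambda>z. (X z)\<^sup>2) P * Vabs (\<lambda>z. (X z)\<^sup>2) P * (\<Prod>z\<in>P. 2 * \<bar>X z\<bar>)"
  using assms
proof (induction P rule: finite_induct)
  case (insert x P)
  define d where "d = (\<Prod>y\<in>P. \<bar>X y - X x\<bar>)"
  define s where "s = (\<Prod>y\<in>P. \<bar>X y + X x\<bar>)"
  have sq: "(\<Prod>y\<in>P. \<bar>(X y)\<^sup>2 - (X x)\<^sup>2\<bar>) = d * s"
    unfolding d_def s_def
    by (simp add: prod.distrib[symmetric] abs_mult[symmetric] power2_eq_square square_diff_square_factored mult.commute)
  have s': "(\<Prod>y\<in>P. \<bar>X x + X y\<bar>) = s" by (simp add: s_def add.commute)
  have two: "\<bar>X x + X x\<bar> = 2 * \<bar>X x\<bar>" by (simp add: mult_2[symmetric] abs_mult)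
  have "Vabs X (insert x P) * Vabs X (insert x P) * (\<Prod>u\<in>insert x P. \<Prod>y\<in>insert x P. \<bar>X y + X u\<bar>) =
    (Vabs X P * Vabs X P * (\<Prod>u\<in>P. \<Prod>y\<in>P. \<bar>X y + X u\<bar>)) * (d * s) * (d * s) * (2 * \<bar>X x\<bar>)"
    using insert(1,2) by (simp add: Vabs_insert prod.distrib d_def[symmetric] s_def[symmetric] s' two abs_mult mult_ac)
  also have "\<dots> = Vabs (\<lambda>z. (X z)\<^sup>2) (insert x P) * Vabs (\<lambda>z. (X z)\<^sup>2) (insert x P) * (\<Prod>z\<in>insert x P. 2 * \<bar>X z\<bar>)"
    unfolding insert.IH using insert(1,2) by (simp add: Vabs_insert sq mult_ac)
  finally show ?case .
qed simp

text \<open>Pairs of equal sign give differences. Pairs of opposite sign give sums, one for each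
  ordered pair of positive labels, including the pairs \<open>z, - z\<close> on the diagonal. Then
  \<open>Vabs_squares\<close> applies.\<close>

lemma Vabs_symmetric:
  assumes "F = uminus ` F" "0 \<notin> F" "finite F"
  shows "Vabs X F = Vabs (\<lambda>z. (X z)\<^sup>2) (pos_part F) * Vabs (\<lambda>z. (X z)\<^sup>2) (neg_part F) *
    (\<Prod>z\<in>pos_part F. 2 * \<bar>X z\<bar>)"
proof -
  let ?P = "pos_part F"
  note neg = neg_part_symmetric[OF assms(1)]
  have finP: "finite ?P" using assms(3) by simp
  have "Vabs X F = Vabs X ?P * Vabs X (neg_part F) * cross X ?P (neg_part F)"
    using parts_cover(1)[OF assms(2)] parts_cover(2)[of F] assms(3) Vabs_Un[of ?P "neg_part F" X] by simp
  also have "Vabs X (neg_part F) = Vabs X ?P"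
    unfolding neg Vabs_uminus_image[OF finP] by (simp add: odd Vabs_def abs_minus_commute)
  also have "cross X ?P (neg_part F) = (\<Prod>x\<in>?P. \<Prod>y\<in>?P. \<bar>X y + X x\<bar>)"
  proof -
    have "\<bar>- X y - X x\<bar> = \<bar>X y + X x\<bar>" for x y
      by (metis abs_minus_cancel minus_add_distrib uminus_add_conv_diff add.commute)
    then show ?thesis
      unfolding cross_def neg by (simp add: prod.reindex odd)
  qed
  also have "Vabs (\<lambda>z. (X z)\<^sup>2) ?P = Vabs (\<lambda>z. (X z)\<^sup>2) (neg_part F)"
    unfolding neg Vabs_uminus_image[OF finP] by (simp add: odd)
  then have "Vabs X ?P * Vabs X ?P * (\<Prod>x\<in>?P. \<Prod>y\<in>?P. \<bar>X y + X x\<bar>) =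
    Vabs (\<lambda>z. (X z)\<^sup>2) ?P * Vabs (\<lambda>z. (X z)\<^sup>2) (neg_part F) * (\<Prod>z\<in>?P. 2 * \<bar>X z\<bar>)"
    using Vabs_squares[OF finP] by simp
  finally show ?thesis .
qed

text \<open>The reason for requiring symmetric sets: up to sign, the factors of \<open>f\<close> and
  \<open>- f\<close> multiply to the difference of squares, whatever the sign of the other label. So
  the left pieces, which see only squares and only their own side, interact with \<open>F\<close>
  just as the right half does.\<close>

lemma cross_symmetric:
  assumes F: "F = uminus ` F" "0 \<notin> F" "finite F" and A: "0 \<notin> A" "finite A"
  shows "cross (\<lambda>z. (X z)\<^sup>2) (pos_part A) (pos_part F) * cross (\<lambda>z. (X z)\<^sup>2) (neg_part A) (neg_part F) = cross X A F"
proof -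
  note neg = neg_part_symmetric[OF F(1)]
  have point: "(\<Prod>y\<in>pos_part F. \<bar>(X y)\<^sup>2 - (X x)\<^sup>2\<bar>) = (\<Prod>y\<in>F. \<bar>X y - X x\<bar>)" for x
  proof -
    have "(\<Prod>y\<in>F. \<bar>X y - X x\<bar>) = (\<Prod>y\<in>pos_part F. \<bar>X y - X x\<bar>) * (\<Prod>y\<in>neg_part F. \<bar>X y - X x\<bar>)"
      by (rule prod_parts[OF F(2,3)])
    also have "(\<Prod>y\<in>neg_part F. \<bar>X y - X x\<bar>) = (\<Prod>y\<in>pos_part F. \<bar>X y + X x\<bar>)"
    proof -
      have "\<bar>- X y - X x\<bar> = \<bar>X y + X x\<bar>" for y
        by (metis abs_minus_cancel minus_add_distrib uminus_add_conv_diff add.commute)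
      then show ?thesis unfolding neg by (simp add: prod.reindex odd)
    qed
    finally show ?thesis
      by (simp add: prod.distrib[symmetric] abs_mult[symmetric] power2_eq_square square_diff_square_factored mult.commute)
  qed
  have "(\<Prod>y\<in>neg_part F. \<bar>(X y)\<^sup>2 - (X x)\<^sup>2\<bar>) = (\<Prod>y\<in>pos_part F. \<bar>(X y)\<^sup>2 - (X x)\<^sup>2\<bar>)" for x
    unfolding neg by (simp add: prod.reindex odd)
  then have "cross (\<lambda>z. (X z)\<^sup>2) (pos_part A) (pos_part F) * cross (\<lambda>z. (X z)\<^sup>2) (neg_part A) (neg_part F) =
    cross X (pos_part A) F * cross X (neg_part A) F"
    by (simp add: cross_def point)
  also have "\<dots> = cross X A F"
    using parts_cover(1)[OF A(1)] parts_cover(2)[of A] A(2) cross_Un[of "pos_part A" "neg_part A" X F] by simp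
  finally show ?thesis .
qed

lemma left_weight_Un:
  assumes F: "F = uminus ` F" "0 \<notin> F" "finite F" and A: "0 \<notin> A" "finite A" and AF: "A \<inter> F = {}"
  shows "left_weight X (A \<union> F) = left_weight X A * (Vabs X F * root_weight X F * cross X A F)"
proof -
  let ?V = "Vabs (\<lambda>z. (X z)\<^sup>2)"
  \<comment> \<open>The product of \<open>\<bar>X z\<bar>\<close> over \<open>F\<close> is a square
    over the positive labels. One share, doubled, is what \<open>Vabs_symmetric\<close> needs to
    complete \<open>Vabs X F\<close>; the other share, halved, remains as
    \<open>root_weight\<close>.\<close>
  have 1: "(\<Prod>z\<in>F. \<bar>X z\<bar>) = (\<Prod>z\<in>pos_part F. 2 * \<bar>X z\<bar>) * root_weight X F"
  proof -
    have "(\<Prod>z\<in>F. \<bar>X z\<bar>) = (\<Prod>z\<in>pos_part F. \<bar>X z\<bar>)\<^sup>2"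
      by (rule prod_symmetric[OF F]) (simp add: odd)
    then show ?thesis
      unfolding root_weight_def by (simp add: power2_eq_square flip: prod.distrib)
  qed
  have "left_weight X (A \<union> F) = (\<Prod>z\<in>A. \<bar>X z\<bar>) * (\<Prod>z\<in>F. \<bar>X z\<bar>) *
    ((?V (pos_part A) * ?V (pos_part F) * cross (\<lambda>z. (X z)\<^sup>2) (pos_part A) (pos_part F)) *
     (?V (neg_part A) * ?V (neg_part F) * cross (\<lambda>z. (X z)\<^sup>2) (neg_part A) (neg_part F)))"
    unfolding left_weight_def parts_Un
    using F(3) A(2) AF by (simp add: Vabs_Un parts_disjoint prod.union_disjoint)
  also have "\<dots> = left_weight X A * ((?V (pos_part F) * ?V (neg_part F) * (\<Prod>z\<in>pos_part F. 2 * \<bar>X z\<bar>)) *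
    root_weight X F * (cross (\<lambda>z. (X z)\<^sup>2) (pos_part A) (pos_part F) * cross (\<lambda>z. (X z)\<^sup>2) (neg_part A) (neg_part F)))"
    unfolding 1 left_weight_def by (simp add: mult_ac)
  also have "\<dots> = left_weight X A * (Vabs X F * root_weight X F * cross X A F)"
    unfolding Vabs_symmetric[OF F, symmetric] cross_symmetric[OF F A] ..
  finally show ?thesis .
qed

end

section \<open>The region H and its expansion over the diagonal\<close>

lemma tiling_gf_eq_tilings_sum:
  "tiling_gf q G = (if removed G \<subseteq> ambient G
    then tilings_sum {l \<in> lozenges. shared_edge l \<notin> barriers G} (lozenge_weight q) (ambient G - removed G) else 0)"
proof -
  have "tilings G = (if removed G \<subseteq> ambient G
    then tilings_of {l \<in> lozenges. shared_edge l \<notin> barriers G} (ambient G - removed G) else {})"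
    unfolding tilings_def tilings_of_def by (auto split: if_splits)
  then show ?thesis by (simp add: tiling_gf_def tilings_sum_def)
qed

definition left_part :: "int \<Rightarrow> int \<Rightarrow> triangle set" where
  "left_part h a = {(c, y). 0 \<le> c \<and> c < a \<and> \<bar>y\<bar> \<le> h + c}"

definition right_part :: "int \<Rightarrow> int \<Rightarrow> int \<Rightarrow> triangle set" where
  "right_part h a b = {(c, y). a \<le> c \<and> c < a + b \<and> \<bar>y\<bar> \<le> h + 2 * a - c - 1}"

lemma finite_parts_hexagon: "finite (left_part h a)" "finite (right_part h a b)"
  by (rule finite_subset[of _ "{0..a} \<times> {- (h + a)..h + a}"], auto simp: left_part_def)
    (rule finite_subset[of _ "{a..a + b} \<times> {- (h + a)..h + a}"], auto simp: right_part_def)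

lemma hexagon_triangles:
  assumes "even h" "0 \<le> h" "0 \<le> a" "0 \<le> b"
  shows "{t. vertices t \<subseteq> hexagon h a b} = left_part h a \<union> right_part h a b"
proof -
  have "vertices (c, y) \<subseteq> hexagon h a b \<longleftrightarrow> (c, y) \<in> left_part h a \<union> right_part h a b" for c y
  proof (cases "even (c + y)")
    case True
    then have v: "vertices (c, y) = {(c, y), (c + 1, y - 1), (c + 1, y + 1)}"
      by (simp add: vertices_def left_pointing_def)
    \<comment> \<open>The right vertices of a left-pointing triangle demand |y| at most
      \<open>h + 2 * a - c - 2\<close>; parity excludes the one further value that
      \<open>right_part\<close> would allow. The other orientation is the same at the left
      boundary.\<close>
    have "h + 2 * a - c - 1 \<noteq> \<bar>y\<bar>" using True assms(1) by presburger
    then show ?thesis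
      unfolding v hexagon_def left_part_def right_part_def using assms by auto
  next
    case False
    then have v: "vertices (c, y) = {(c + 1, y), (c, y - 1), (c, y + 1)}"
      by (simp add: vertices_def left_pointing_def)
    have "h + c \<noteq> \<bar>y\<bar>" using False assms(1) by presburger
    then show ?thesis
      unfolding v hexagon_def left_part_def right_part_def using assms by auto
  qed
  then show ?thesis by auto
qed

lemma diagonal_segment_subset:
  "left_pointing t \<and> diagonal_segment a z \<subseteq> vertices t \<longleftrightarrow> t = (a - 1, 2 * z) \<and> odd a"
  "\<not> left_pointing t \<and> diagonal_segment a z \<subseteq> vertices t \<longleftrightarrow> t = (a, 2 * z) \<and> odd a"
proof -
  obtain c y where t: "t = (c, y)" by (cases t)
  have "diagonal_segment a z \<subseteq> vertices t \<longleftrightarrow> (a = c \<or> a = c + 1) \<and> y = 2 * z \<and> odd a"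
  proof -
    have "\<bar>2 * z - 1 - y\<bar> \<le> 1 \<and> \<bar>2 * z + 1 - y\<bar> \<le> 1 \<longleftrightarrow> y = 2 * z" by arith
    then show ?thesis by (auto simp: t diagonal_segment_def vertical_segment_def mem_vertices)
  qed
  then show "left_pointing t \<and> diagonal_segment a z \<subseteq> vertices t \<longleftrightarrow> t = (a - 1, 2 * z) \<and> odd a"
    and "\<not> left_pointing t \<and> diagonal_segment a z \<subseteq> vertices t \<longleftrightarrow> t = (a, 2 * z) \<and> odd a"
    by (auto simp: t left_pointing_def)
qed

lemma vertical_segment_eq_iff: "vertical_segment p = vertical_segment p' \<longleftrightarrow> p = p'"
  by (cases p, cases p') (auto simp: vertical_segment_def doubleton_eq_iff)

lemma shared_edge_vertical_segment:
  assumes "l \<in> lozenges" "shared_edge l = vertical_segment (c, y)"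
  shows "l = horizontal_lozenge c y"
proof -
  from assms(1) consider c' y' where "l = vertical_domino c' y'"
    | c' y' where "l = horizontal_lozenge c' y'" "odd (c' + y')"
    unfolding lozenges_eq by blast
  then show ?thesis
  proof cases
    case 1
    obtain a b where "shared_edge l = {(c', a), (c' + 1, b)}"
      unfolding 1 by (rule shared_edge_vertical_domino)
    with assms(2) show ?thesis by (auto simp: vertical_segment_def doubleton_eq_iff)
  next
    case 2
    with assms(2) shared_edge_horizontal_lozenge[OF 2(2)] show ?thesis
      by (simp add: vertical_segment_eq_iff)
  qed
qed

text \<open>The triangles of a lozenge differ by at most 1 in height, so none joins rows above and
  below the removed row 0. The lower piece is reflected in \<open>\<ell>\<close> to become an upper
  one.\<close>

lemma tilings_sum_left_half:
  assumes h: "0 \<le> h" and A: "0 \<notin> A"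
  shows "tilings_sum lozenges (lozenge_weight q)
      (left_part h (2 * int k + 1) - {(c, 0) | c. 0 \<le> c \<and> c < 2 * int k + 1} - Pair (2 * int k) ` (*) 2 ` A) =
    dented_sum q 0 (Suc (2 * k)) (\<lambda>_. 1) (\<lambda>j. h + int j) ((*) 2 ` pos_part A) *
    dented_sum q 0 (Suc (2 * k)) (\<lambda>_. 1) (\<lambda>j. h + int j) ((*) 2 ` uminus ` neg_part A)"
proof -
  let ?S = "staircase 0 (Suc (2 * k)) (\<lambda>_. 1) (\<lambda>j. h + int j)"
  let ?P = "\<lambda>E. ?S - Pair (2 * int k) ` (*) 2 ` E"
  let ?r = "\<lambda>(c, y). (c, - y) :: triangle"
  have S: "?S = {(c, y). 0 \<le> c \<and> c \<le> 2 * int k \<and> 1 \<le> y \<and> y \<le> h + c}"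
  proof -
    have "\<exists>j<Suc (2 * k). c = int j" if "0 \<le> c" "c \<le> 2 * int k" for c
      using that by (intro exI[of _ "nat c"]) auto
    then show ?thesis by (fastforce simp: staircase_def)
  qed
  have r: "?r ` U = {(c, y). (c, - y) \<in> U}" for U
    by (force simp: image_iff)
  have union: "left_part h (2 * int k + 1) - {(c, 0) | c. 0 \<le> c \<and> c < 2 * int k + 1} - Pair (2 * int k) ` (*) 2 ` A =
    ?P (pos_part A) \<union> ?r ` ?P (uminus ` neg_part A)"
  proof -
    have "(c, y) \<in> left_part h (2 * int k + 1) - {(c, 0) | c. 0 \<le> c \<and> c < 2 * int k + 1} - Pair (2 * int k) ` (*) 2 ` A \<longleftrightarrow>
      (c, y) \<in> ?P (pos_part A) \<or> (c, - y) \<in> ?P (uminus ` neg_part A)" for c y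
      unfolding S left_part_def
      by (cases y "0 :: int" rule: linorder_cases) (auto simp: pos_part_def neg_part_def)
    note pointwise = this
    have mem_r: "(c, y) \<in> ?r ` U \<longleftrightarrow> (c, - y) \<in> U" for c y U unfolding r by simp
    show ?thesis
    proof (rule Set.set_eqI)
      fix t :: triangle
      obtain c y where t: "t = (c, y)" by (cases t)
      show "t \<in> left_part h (2 * int k + 1) - {(c, 0) | c. 0 \<le> c \<and> c < 2 * int k + 1} - Pair (2 * int k) ` (*) 2 ` A \<longleftrightarrow>
        t \<in> ?P (pos_part A) \<union> ?r ` ?P (uminus ` neg_part A)"
        unfolding t Un_iff mem_r by (rule pointwise)
    qed
  qed
  have fin: "finite ?S" by (rule finite_staircase)
  have "tilings_sum lozenges (lozenge_weight q) (?P (pos_part A) \<union> ?r ` ?P (uminus ` neg_part A)) =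
    tilings_sum lozenges (lozenge_weight q) (?P (pos_part A)) *
    tilings_sum lozenges (lozenge_weight q) (?r ` ?P (uminus ` neg_part A))"
  proof (rule tilings_sum_disjoint_Un)
    show "?P (pos_part A) \<inter> ?r ` ?P (uminus ` neg_part A) = {}" unfolding S r by auto
    fix l assume l: "l \<in> lozenges" "l \<subseteq> ?P (pos_part A) \<union> ?r ` ?P (uminus ` neg_part A)" "l \<inter> ?P (pos_part A) \<noteq> {}"
    have up: "0 < snd t" if "t \<in> ?P E" for t E using that unfolding S by auto
    have down: "snd t < 0" if "t \<in> ?r ` ?P E" for t E using that unfolding S r by auto
    have near: "\<bar>snd s - snd t\<bar> \<le> 1" if "s \<in> l" "t \<in> l" for s t
      using l(1) that by (auto simp: lozenges_eq vertical_domino_def horizontal_lozenge_def)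
    obtain s where s: "s \<in> l" "0 < snd s" using l(3) up by blast
    have "False" if "t \<in> l" "t \<in> ?r ` ?P (uminus ` neg_part A)" for t
      using down[OF that(2)] near[OF s(1) that(1)] s(2) by linarith
    then show "l \<inter> ?r ` ?P (uminus ` neg_part A) = {}" by blast
  qed (use fin empty_notin_lozenges in auto)
  then show ?thesis
    unfolding union by (simp add: tilings_sum_reflect(2) dented_sum_def)
qed

text \<open>Mirrored in \<open>x = 0\<close>, the right half widens towards the diagonal, as the
  trapezoid does, and its dents lie in the last column. The mirrored columns start at
  \<open>- (a + int b)\<close>.\<close>

lemma tilings_sum_right_half:
  assumes "b \<ge> 1"
  shows "tilings_sum lozenges (lozenge_weight q) (right_part h a (int b) - Pair a ` E) =
    dented_sum q (- (a + int b)) b (\<lambda>j. - (h + a - int b + int j)) (\<lambda>j. h + a - int b + int j) E"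
proof -
  let ?S = "staircase (- (a + int b)) b (\<lambda>j. - (h + a - int b + int j)) (\<lambda>j. h + a - int b + int j)"
  let ?r = "\<lambda>(c, y). (- 1 - c, y) :: triangle"
  have r: "?r ` U = {(c, y). (- 1 - c, y) \<in> U}" for U
    by (force simp: image_iff)
  have S: "?S = {(c, y). - (a + int b) \<le> c \<and> c < - a \<and> \<bar>y\<bar> \<le> h + 2 * a + c}"
  proof (intro equalityI subsetI)
    fix t assume "t \<in> {(c, y). - (a + int b) \<le> c \<and> c < - a \<and> \<bar>y\<bar> \<le> h + 2 * a + c}"
    then obtain c y where t: "t = (c, y)" "- (a + int b) \<le> c" "c < - a" "\<bar>y\<bar> \<le> h + 2 * a + c" by auto
    define j where "j = nat (c + a + int b)"
    have j: "j < b" "c = - (a + int b) + int j" using t by (auto simp: j_def)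
    have "y \<in> {- (h + a - int b + int j)..h + a - int b + int j}"
      using t(4) j(2) by (auto simp: abs_le_iff)
    then have "t \<in> Pair (- (a + int b) + int j) ` {- (h + a - int b + int j)..h + a - int b + int j}"
      unfolding t(1) j(2)[symmetric] by (rule imageI)
    with j(1) show "t \<in> ?S" unfolding staircase_def by blast
  qed (auto simp: staircase_def)
  have "right_part h a (int b) - Pair a ` E = ?r ` (?S - Pair (- 1 - a) ` E)"
    unfolding r S right_part_def by auto
  then have "tilings_sum lozenges (lozenge_weight q) (right_part h a (int b) - Pair a ` E) =
    tilings_sum lozenges (lozenge_weight q) (?S - Pair (- 1 - a) ` E)"
    by (simp only: tilings_sum_reflect(1))
  moreover have "- (a + int b) + int b - 1 = - 1 - a" by simp
  moreover have "b \<noteq> 0" using assms by simp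
  ultimately show ?thesis by (simp only: dented_sum_def if_False)
qed

definition node :: "'a :: field \<Rightarrow> int \<Rightarrow> 'a" where
  "node q z = qx q (2 * z)"

text \<open>The share of the tilings whose horizontal lozenges across the diagonal have exactly the
  labels \<open>S\<close>. Each left piece requires \<open>k\<close> dents and the right half
  \<open>b\<close>, counting both removed triangles and crossing lozenges.\<close>

definition term_weight :: "'a :: linordered_field \<Rightarrow> nat \<Rightarrow> nat \<Rightarrow> int set \<Rightarrow> int set \<Rightarrow> int set \<Rightarrow> 'a" where
  "term_weight q k b L R S = (\<Prod>z\<in>S. qplus q (2 * z)) *
    ((if card (pos_part (L \<union> S)) = k \<and> card (neg_part (L \<union> S)) = k
      then left_weight (node q) (L \<union> S) / (\<Prod>i = 1..k. qfact q (2 * i - 1))\<^sup>2 else 0) *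
     (if card (R \<union> S) = b then Vabs (node q) (R \<union> S) / (\<Prod>j<b. qfact q j) else 0))"

section \<open>Evaluation of the halves in an ordered field with \<open>q > 1\<close>\<close>

context
  fixes q :: "'a :: linordered_field"
  assumes q_gt_1: "1 < q"
begin

lemma q_nonzero: "q \<noteq> 0" and q_diff_pos: "0 < q - inverse q"
proof -
  show "q \<noteq> 0" using q_gt_1 by simp
  have "inverse q < 1" using q_gt_1 by (rule inverse_less_1_iff[THEN iffD2, OF disjI2])
  then show "0 < q - inverse q" using q_gt_1 by simp
qed

lemma q_diff_nonzero: "q - inverse q \<noteq> 0"
  using q_diff_pos by simp

lemma qplus_pos: "0 < qplus q y"
  using q_gt_1 by (simp add: qplus_def add_pos_pos)

lemma qx_less_add_2: "qx q y < qx q (y + 2)"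
  using qx_diff[OF q_nonzero q_diff_nonzero, of "y + 1"] qplus_pos[of "y + 1"] by (simp add: add.assoc)

text \<open>The increments are lozenge weights, which are positive for \<open>q > 1\<close>.\<close>

lemma node_strict_mono: "strict_mono (node q)"
proof (rule strict_monoI)
  fix s t :: int assume "s < t"
  then show "node q s < node q t"
  proof (induction t rule: int_gr_induct)
    case base
    then show ?case using qx_less_add_2[of "2 * s"] by (simp add: node_def algebra_simps)
  next
    case (step t)
    have "node q t < node q (t + 1)" using qx_less_add_2[of "2 * t"] by (simp add: node_def algebra_simps)
    with step show ?case by simp
  qed
qed

lemma node_minus: "node q (- z) = - node q z"
  by (simp add: node_def qx_minus)

lemma qnum_pos: "0 < k \<Longrightarrow> 0 < qnum q (int k)"
proof -
  assume "0 < k"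
  have "1 < q ^ k" using q_gt_1 \<open>0 < k\<close> by (rule one_less_power)
  moreover from this have "inverse (q ^ k) < 1" by (rule inverse_less_1_iff[THEN iffD2, OF disjI2])
  ultimately show ?thesis
    using q_diff_pos by (simp add: qnum_def power_int_minus)
qed

lemma qnum_nonzero: "0 < k \<Longrightarrow> qnum q (int k) \<noteq> 0"
  using qnum_pos[of k] by simp

lemma qfact_pos: "0 < qfact q k"
  unfolding qfact_def by (rule prod_pos) (use qnum_pos in auto)

lemma half_hexagon_value:
  assumes h: "even h" "0 \<le> h" and P: "P \<subseteq> {z. 0 < z \<and> 2 * z \<le> h + 2 * int k}"
  shows "dented_sum q 0 (Suc (2 * k)) (\<lambda>_. 1) (\<lambda>j. h + int j) ((*) 2 ` P) =
    (if card P = k then (\<Prod>z\<in>P. \<bar>node q z\<bar>) * Vabs (\<lambda>z. (node q z)\<^sup>2) P / (\<Prod>i = 1..k. qfact q (2 * i - 1)) else 0)"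
proof -
  have sm: "strict_mono ((*) (2 :: int))" by (auto intro!: strict_monoI)
  have inj: "inj_on ((*) (2 :: int)) P" by (auto intro: inj_onI)
  have pos: "0 < node q z" if "z \<in> P" for z
    using that P strict_odd_pos[OF node_strict_mono node_minus] by auto
  have "(\<Prod>y\<in>(*) 2 ` P. qx q y) = (\<Prod>z\<in>P. \<bar>node q z\<bar>)"
  proof -
    have "(\<Prod>y\<in>(*) 2 ` P. qx q y) = (\<Prod>z\<in>P. node q z)" by (simp add: prod.reindex[OF inj] node_def)
    also have "\<dots> = (\<Prod>z\<in>P. \<bar>node q z\<bar>)" by (rule prod.cong[OF refl]) (use pos in fastforce)
    finally show ?thesis .
  qed
  moreover have "Vdm (\<lambda>y. (qx q y)\<^sup>2) ((*) 2 ` P) = Vabs (\<lambda>z. (node q z)\<^sup>2) P"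
    unfolding Vdm_image[OF sm] node_def[symmetric]
    by (rule Vabs_eq_Vdm) (use pos node_strict_mono in \<open>auto simp: strict_monoD less_imp_le intro!: power_strict_mono\<close>)
  moreover have "card ((*) 2 ` P) = card P" by (rule card_image[OF inj])
  moreover have "(*) 2 ` P \<subseteq> {y. even y \<and> 1 \<le> y \<and> y \<le> h + 2 * int k}" using P by auto
  ultimately show ?thesis
    using half_hexagon_sum_odd[OF q_nonzero q_diff_nonzero qnum_nonzero h, of "(*) 2 ` P" k]
    by (simp add: half_hexagon_sum_def)
qed

lemma left_half_value:
  assumes h: "even h" "0 \<le> h" and A: "0 \<notin> A" "A \<subseteq> {z. \<bar>2 * z\<bar> \<le> h + 2 * int k}"
  shows "tilings_sum lozenges (lozenge_weight q)
      (left_part h (2 * int k + 1) - {(c, 0) | c. 0 \<le> c \<and> c < 2 * int k + 1} - Pair (2 * int k) ` (*) 2 ` A) =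
    (if card (pos_part A) = k \<and> card (neg_part A) = k
     then left_weight (node q) A / (\<Prod>i = 1..k. qfact q (2 * i - 1))\<^sup>2 else 0)"
proof -
  have "A \<subseteq> {- (h + 2 * int k)..h + 2 * int k}"
  proof
    fix z assume "z \<in> A"
    then have "\<bar>2 * z\<bar> \<le> h + 2 * int k" using A(2) by auto
    then show "z \<in> {- (h + 2 * int k)..h + 2 * int k}" by auto
  qed
  then have fin: "finite A" by (rule finite_subset) simp
  have pos: "pos_part A \<subseteq> {z. 0 < z \<and> 2 * z \<le> h + 2 * int k}"
    and neg: "uminus ` neg_part A \<subseteq> {z. 0 < z \<and> 2 * z \<le> h + 2 * int k}"
    using A(2) by (auto simp: pos_part_def neg_part_def)
  have "(\<Prod>z\<in>uminus ` neg_part A. \<bar>node q z\<bar>) = (\<Prod>z\<in>neg_part A. \<bar>node q z\<bar>)"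
    by (simp add: prod.reindex node_minus)
  moreover have "Vabs (\<lambda>z. (node q z)\<^sup>2) (uminus ` neg_part A) = Vabs (\<lambda>z. (node q z)\<^sup>2) (neg_part A)"
    using fin by (simp add: Vabs_uminus_image node_minus)
  moreover have "card (uminus ` neg_part A) = card (neg_part A)" by (simp add: card_image)
  ultimately show ?thesis
    unfolding tilings_sum_left_half[OF h(2) A(1)] half_hexagon_value[OF h pos] half_hexagon_value[OF h neg]
      left_weight_def prod_parts[OF A(1) fin]
    by (simp add: power2_eq_square)
qed

lemma right_half_value:
  assumes h: "even h" "odd a" "0 \<le> h + a - int b" and A: "A \<subseteq> {z. \<bar>2 * z\<bar> \<le> h + a - 1}"
  shows "dented_sum q (- (a + int b)) b (\<lambda>j. - (h + a - int b + int j)) (\<lambda>j. h + a - int b + int j) ((*) 2 ` A) =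
    (if card A = b then Vabs (node q) A / (\<Prod>j<b. qfact q j) else 0)"
proof -
  have sm: "strict_mono ((*) (2 :: int))" by (auto intro!: strict_monoI)
  have "Vdm (qx q) ((*) 2 ` A) = Vabs (node q) A"
    unfolding Vdm_image[OF sm] node_def[symmetric]
    by (rule Vabs_eq_Vdm) (use node_strict_mono in \<open>auto simp: strict_monoD\<close>)
  moreover have "card ((*) 2 ` A) = card A" by (rule card_image) (auto intro: inj_onI)
  moreover have "(*) 2 ` A \<subseteq> {y. odd (- (a + int b) + int b + y) \<and> \<bar>y\<bar> \<le> h + a - int b + int b - 1}"
    using A h by auto
  moreover have "even (- (a + int b) + (h + a - int b))" using h by simp
  ultimately show ?thesis
    using dented_sum_trapezoid[OF q_nonzero q_diff_nonzero qnum_nonzero, of "- (a + int b)" "h + a - int b" "(*) 2 ` A" b] h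
    by simp
qed

text \<open>A label is free for a crossing lozenge if it carries no dent and no barrier and is not
  0, where the left-pointing triangle belongs to the intrusion.\<close>

lemma tiling_gf_H_region:
  fixes m n \<alpha> \<beta> \<gamma> N :: nat
  assumes \<beta>: "\<beta> \<le> 2 * \<alpha> + 2 * \<gamma> + 1" and N: "N = m + n + \<alpha> + \<gamma>"
    and LRB: "L \<subseteq> {- int N..int N}" "R \<subseteq> {- int N..int N}" "B \<subseteq> {- int N..int N}" and L0: "0 \<notin> L"
  shows "tiling_gf q (H_region m n \<alpha> \<beta> \<gamma> L R B) =
    (\<Sum>S\<in>Pow ({- int N..int N} - {0} - L - R - B). term_weight q (m + \<alpha>) (2 * n + \<beta>) L R S)"
proof -
  define h where "h = 2 * int n + 2 * int \<gamma>"
  define k where "k = m + \<alpha>"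
  define a where "a = 2 * int k + 1"
  define b where "b = 2 * n + \<beta>"
  define I where "I = {(c, 0 :: int) | c. 0 \<le> c \<and> c < a}"
  define Z where "Z = {- int N..int N} - {0} - L - R - B"
  define \<Lambda> where "\<Lambda> = {l \<in> lozenges. shared_edge l \<notin> diagonal_segment a ` B}"
  let ?W = "lozenge_weight q"
  have h: "even h" "0 \<le> h" by (auto simp: h_def)
  have a: "odd a" "0 \<le> a" "0 < a" by (auto simp: a_def)
  have hN: "h + a = 2 * int N + 1" by (simp add: h_def a_def k_def N)
  \<comment> \<open>This number is the length of the right side of the hexagon.\<close>
  have s: "0 \<le> h + a - int b" using \<beta> by (simp add: h_def a_def k_def b_def)
  define G where "G = H_region m n \<alpha> \<beta> \<gamma> L R B"
  have G: "ambient G = left_part h a \<union> right_part h a (int b)"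
    "removed G = I \<union> Pair (a - 1) ` (*) 2 ` L \<union> Pair a ` (*) 2 ` R"
    "barriers G = diagonal_segment a ` B"
  proof -
    have H: "G = \<lparr> ambient = {t. vertices t \<subseteq> hexagon h a (int b)},
      removed = {(c, 0) | c. 0 \<le> c \<and> c < a} \<union>
        {t. left_pointing t \<and> (\<exists>z\<in>L. diagonal_segment a z \<subseteq> vertices t)} \<union>
        {t. \<not> left_pointing t \<and> (\<exists>z\<in>R. diagonal_segment a z \<subseteq> vertices t)},
      barriers = diagonal_segment a ` B \<rparr>"
      by (simp add: G_def H_region_def h_def a_def k_def b_def Let_def)
    show "ambient G = left_part h a \<union> right_part h a (int b)"
      using hexagon_triangles[OF h a(2), of "int b"] by (simp add: H)
    have "{t. left_pointing t \<and> (\<exists>z\<in>L. diagonal_segment a z \<subseteq> vertices t)} = Pair (a - 1) ` (*) 2 ` L"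
    proof -
      have "{t. left_pointing t \<and> (\<exists>z\<in>L. diagonal_segment a z \<subseteq> vertices t)} =
        {t. \<exists>z\<in>L. left_pointing t \<and> diagonal_segment a z \<subseteq> vertices t}" by blast
      then show ?thesis unfolding diagonal_segment_subset using a(1) by auto
    qed
    moreover have "{t. \<not> left_pointing t \<and> (\<exists>z\<in>R. diagonal_segment a z \<subseteq> vertices t)} = Pair a ` (*) 2 ` R"
    proof -
      have "{t. \<not> left_pointing t \<and> (\<exists>z\<in>R. diagonal_segment a z \<subseteq> vertices t)} =
        {t. \<exists>z\<in>R. \<not> left_pointing t \<and> diagonal_segment a z \<subseteq> vertices t}" by blast
      then show ?thesis unfolding diagonal_segment_subset using a(1) by auto
    qed
    ultimately show "removed G = I \<union> Pair (a - 1) ` (*) 2 ` L \<union> Pair a ` (*) 2 ` R"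
      by (simp add: H I_def)
    show "barriers G = diagonal_segment a ` B" by (simp add: H)
  qed
  define P where "P = left_part h a - I - Pair (a - 1) ` (*) 2 ` L"
  define Q where "Q = right_part h a (int b) - Pair a ` (*) 2 ` R"
  have P: "fst t < a" if "t \<in> P" for t using that by (auto simp: P_def left_part_def)
  have Q: "a \<le> fst t" if "t \<in> Q" for t using that by (auto simp: Q_def right_part_def)
  have finPQ: "finite P" "finite Q" by (simp_all add: P_def Q_def finite_parts_hexagon)
  \<comment> \<open>A barrier affects only lozenges that cross the diagonal, so within one half all
    lozenges are allowed.\<close>
  have \<Lambda>_half: "tilings_sum \<Lambda> ?W U = tilings_sum lozenges ?W U"
    if U: "(\<forall>t\<in>U. fst t < a) \<or> (\<forall>t\<in>U. a \<le> fst t)" for U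
  proof (rule tilings_sum_cong)
    have "l \<in> \<Lambda>" if l: "l \<in> lozenges" "l \<subseteq> U" for l
    proof -
      have "shared_edge l \<noteq> diagonal_segment a z" for z
      proof
        assume "shared_edge l = diagonal_segment a z"
        then have "l = horizontal_lozenge a (2 * z)"
          unfolding diagonal_segment_def by (rule shared_edge_vertical_segment[OF l(1)])
        then have "(a - 1, 2 * z) \<in> U" "(a, 2 * z) \<in> U" using l(2) by (auto simp: horizontal_lozenge_def)
        then show False using U by fastforce
      qed
      then show ?thesis using l(1) by (auto simp: \<Lambda>_def)
    qed
    then show "{l \<in> \<Lambda>. l \<subseteq> U} = {l \<in> lozenges. l \<subseteq> U}" by (auto simp: \<Lambda>_def)
  qed simp
  define Y where "Y = {y. odd (a + y) \<and> horizontal_lozenge a y \<in> \<Lambda> \<and> (a - 1, y) \<in> P \<and> (a, y) \<in> Q}"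
  have \<Lambda>_iff: "horizontal_lozenge a (2 * z) \<in> \<Lambda> \<longleftrightarrow> z \<notin> B" for z
  proof -
    have "odd (a + 2 * z)" using a by simp
    then show ?thesis
      using shared_edge_horizontal_lozenge[of a "2 * z"] horizontal_lozenge_in_lozenges[of a "2 * z"]
      by (auto simp: \<Lambda>_def diagonal_segment_def vertical_segment_eq_iff)
  qed
  have left: "tilings_sum \<Lambda> ?W (P - Pair (a - 1) ` (*) 2 ` S) =
      (if card (pos_part (L \<union> S)) = k \<and> card (neg_part (L \<union> S)) = k
       then left_weight (node q) (L \<union> S) / (\<Prod>i = 1..k. qfact q (2 * i - 1))\<^sup>2 else 0)"
    if "S \<subseteq> Z" for S
  proof -
    have eq: "P - Pair (a - 1) ` (*) 2 ` S = left_part h a - I - Pair (a - 1) ` (*) 2 ` (L \<union> S)"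
      by (auto simp: P_def)
    have "\<bar>2 * z\<bar> \<le> h + 2 * int k" if z: "z \<in> L \<union> S" for z
    proof -
      have "- int N \<le> z \<and> z \<le> int N" using z \<open>S \<subseteq> Z\<close> LRB(1) by (auto simp: Z_def)
      then show ?thesis using hN unfolding a_def by arith
    qed
    then have "0 \<notin> L \<union> S" "L \<union> S \<subseteq> {z. \<bar>2 * z\<bar> \<le> h + 2 * int k}"
      using that L0 by (auto simp: Z_def)
    note half_sum = left_half_value[OF h this]
    have "tilings_sum \<Lambda> ?W (P - Pair (a - 1) ` (*) 2 ` S) = tilings_sum lozenges ?W (P - Pair (a - 1) ` (*) 2 ` S)"
      using P by (intro \<Lambda>_half) auto
    then show ?thesis using half_sum unfolding eq by (simp add: a_def I_def)
  qed
  have right: "tilings_sum \<Lambda> ?W (Q - Pair a ` (*) 2 ` S) =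
      (if card (R \<union> S) = b then Vabs (node q) (R \<union> S) / (\<Prod>j<b. qfact q j) else 0)"
    if "S \<subseteq> Z" "1 \<le> b" for S
  proof -
    have eq: "Q - Pair a ` (*) 2 ` S = right_part h a (int b) - Pair a ` (*) 2 ` (R \<union> S)"
      by (auto simp: Q_def)
    have "\<bar>2 * z\<bar> \<le> h + a - 1" if z: "z \<in> R \<union> S" for z
    proof -
      have "- int N \<le> z \<and> z \<le> int N" using z \<open>S \<subseteq> Z\<close> LRB(2) by (auto simp: Z_def)
      then show ?thesis using hN by arith
    qed
    then have "R \<union> S \<subseteq> {z. \<bar>2 * z\<bar> \<le> h + a - 1}" by auto
    note half_sum = right_half_value[OF h(1) a(1) s this]
    have "tilings_sum \<Lambda> ?W (Q - Pair a ` (*) 2 ` S) = tilings_sum lozenges ?W (Q - Pair a ` (*) 2 ` S)"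
      using Q by (intro \<Lambda>_half) auto
    then show ?thesis using half_sum unfolding eq by (simp add: tilings_sum_right_half[OF that(2)])
  qed
  have "tiling_gf q G = (\<Sum>S\<in>Pow Z. term_weight q k b L R S)"
  proof (cases "removed G \<subseteq> ambient G")
    case True
    have "ambient G - removed G = P \<union> Q"
      unfolding G P_def Q_def I_def by (auto simp: left_part_def right_part_def)
    then have "tiling_gf q G = tilings_sum \<Lambda> ?W (P \<union> Q)"
      using True by (simp add: tiling_gf_eq_tilings_sum G(3) \<Lambda>_def)
    also have "\<dots> = (\<Sum>D\<in>Pow Y. (\<Prod>y\<in>D. qplus q y) *
      (tilings_sum \<Lambda> ?W (P - Pair (a - 1) ` D) * tilings_sum \<Lambda> ?W (Q - Pair a ` D)))"
      unfolding Y_def by (rule tilings_sum_line_split) (use finPQ P Q in \<open>auto simp: \<Lambda>_def\<close>)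
    finally have expand: "tiling_gf q G = \<dots>" .
    show ?thesis
    proof (cases "1 \<le> b")
      case b: True
      have Y: "Y = (*) 2 ` Z"
      proof (intro equalityI subsetI)
        fix y assume y: "y \<in> Y"
        then have "even y" using a by (simp add: Y_def)
        then obtain z where z: "y = 2 * z" by (rule evenE)
        have "\<bar>2 * z\<bar> \<le> 2 * int N" "z \<noteq> 0" "z \<notin> L" "z \<notin> R" "z \<notin> B"
          using y \<Lambda>_iff[of z] hN a by (auto simp: Y_def z P_def Q_def I_def left_part_def)
        moreover from this have "- int N \<le> z \<and> z \<le> int N" by arith
        ultimately have "z \<in> Z" by (simp add: Z_def)
        then show "y \<in> (*) 2 ` Z" unfolding z by (rule imageI)
      next
        fix y assume "y \<in> (*) 2 ` Z"
        then obtain z where z: "y = 2 * z" "z \<in> Z" by auto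
        then show "y \<in> Y"
          using \<Lambda>_iff[of z] hN a b by (auto simp: Y_def Z_def P_def Q_def I_def left_part_def right_part_def)
      qed
      have inj: "inj_on ((*) (2 :: int)) A" for A by (auto intro: inj_onI)
      have "inj_on ((`) ((*) (2 :: int))) (Pow Z)"
        by (rule inj_on_image_Pow) (rule inj)
      moreover have "Pow Y = (`) ((*) 2) ` Pow Z" unfolding Y by (rule image_Pow_surj[symmetric]) simp
      ultimately show ?thesis
        unfolding expand term_weight_def
        by (simp add: sum.reindex prod.reindex[OF inj] left right[OF _ b])
    next
      case False
      \<comment> \<open>Without columns on the right, \<open>dented_sum\<close> is only a convention
        and describes no tilings; both sides reduce to the term with \<open>S = {}\<close>.\<close>
      then have b0: "b = 0" by simp
      have Q0: "Q = {}" unfolding Q_def right_part_def b0 by auto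
      have "R = {}"
      proof (rule ccontr)
        assume "R \<noteq> {}"
        then obtain z where "z \<in> R" by blast
        then have "(a, 2 * z) \<in> ambient G" using True unfolding G(2) by blast
        then show False unfolding G(1) b0 by (auto simp: left_part_def right_part_def)
      qed
      have "Y = {}" by (auto simp: Y_def Q0)
      have ne: "{} \<notin> \<Lambda>" using empty_notin_lozenges by (auto simp: \<Lambda>_def)
      have "tiling_gf q G = term_weight q k b L R {}"
        unfolding expand \<open>Y = {}\<close> term_weight_def
        using left[of "{}"] by (simp add: Q0 tilings_sum_empty[OF ne] \<open>R = {}\<close> b0)
      also have "\<dots> = (\<Sum>S\<in>Pow Z. if S = {} then term_weight q k b L R {} else 0)"
        by (simp add: Z_def)
      also have "\<dots> = (\<Sum>S\<in>Pow Z. term_weight q k b L R S)"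
      proof (rule sum.cong[OF refl])
        fix S assume "S \<in> Pow Z"
        then have "finite S" by (auto simp: Z_def intro: finite_subset)
        then show "(if S = {} then term_weight q k b L R {} else 0) = term_weight q k b L R S"
          by (auto simp: term_weight_def \<open>R = {}\<close> b0)
      qed
      finally show ?thesis .
    qed
  next
    case False
    \<comment> \<open>A removed triangle can be missing from the hexagon only if
      \<open>b = 0\<close> and \<open>R\<close> is nonempty. Then
      \<open>card (R \<union> S) = b\<close> fails for every \<open>S\<close>, in agreement with the
      absence of tilings.\<close>
    have "b = 0"
    proof (rule ccontr)
      assume "b \<noteq> 0"
      then have "removed G \<subseteq> ambient G"
        unfolding G I_def using LRB(1,2) hN h(2) a(2)
        by (fastforce simp: left_part_def right_part_def a_def)
      with False show False by simp
    qed
    have "R \<noteq> {}"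
    proof
      assume "R = {}"
      then have "removed G \<subseteq> ambient G"
        unfolding G I_def using LRB(1) hN h(2) by (fastforce simp: left_part_def a_def)
      with False show False by simp
    qed
    have "term_weight q k b L R S = 0" if "S \<subseteq> Z" for S
    proof -
      have "finite (R \<union> S)"
        using that LRB(2) by (auto simp: Z_def intro: finite_subset)
      with \<open>R \<noteq> {}\<close> \<open>b = 0\<close> show ?thesis by (simp add: term_weight_def)
    qed
    with False show ?thesis by (simp add: tiling_gf_eq_tilings_sum)
  qed
  then show ?thesis by (simp add: G_def k_def b_def Z_def)
qed

text \<open>The q-analogue of the factorization of a difference of hyperbolic sines; it identifies
  \<open>Delta11\<close> as a Vandermonde product in x.\<close>

lemma node_diff: "node q t - node q s = qplus q (t + s) * qnum q (t - s)"
proof -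
  define u v where "u = q powi s" and "v = q powi t"
  have "u \<noteq> 0" "v \<noteq> 0" using q_nonzero by (simp_all add: u_def v_def)
  have pow: "q powi (2 * s) = u * u" "q powi (2 * t) = v * v" "q powi (t + s) = v * u" "q powi (t - s) = v / u"
    by (simp_all only: u_def v_def mult_2 power_int_add[OF disjI1[OF q_nonzero]]
      power_int_diff[OF disjI1[OF q_nonzero]])
  have "(v * v - inverse (v * v)) - (u * u - inverse (u * u)) =
    (v * u + inverse (v * u)) * (v / u - inverse (v / u))"
    using \<open>u \<noteq> 0\<close> \<open>v \<noteq> 0\<close> by (simp add: inverse_eq_divide divide_simps) (simp add: algebra_simps)
  then show ?thesis
    unfolding node_def qx_def qnum_def qplus_def power_int_minus pow by (simp add: diff_divide_distrib[symmetric])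
qed

lemma Delta11_eq: "Delta11 q A = Vabs (node q) A"
  unfolding Delta11_def Vabs_def
  by (rule prod.cong[OF refl]) (auto simp: node_diff[symmetric] abs_of_pos strict_monoD[OF node_strict_mono])

lemma abs_node: "\<bar>node q z\<bar> / 2 = qnum q (2 * \<bar>z\<bar>) / 4"
proof -
  have "\<bar>node q z\<bar> = node q \<bar>z\<bar>"
    using strict_odd_pos[OF node_strict_mono node_minus, of z] strict_odd_pos[OF node_strict_mono node_minus, of "- z"] node_minus[of z]
      strict_odd_0[OF node_strict_mono node_minus]
    by (cases z "0 :: int" rule: linorder_cases) auto
  then show ?thesis by (simp add: node_def qx_def)
qed

text \<open>\<open>L\<close> and \<open>R\<close> are the dents unaffected by the flip. The factors
  linking \<open>S\<close> to \<open>FL\<close> and \<open>FR\<close> are the same on both sides, so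
  the ratio does not depend on \<open>S\<close>. It is cross multiplied because the terms themselves
  may be 0.\<close>

lemma term_weight_ratio:
  assumes fin: "finite L" "finite R" "finite S"
    and F: "FL = uminus ` FL" "0 \<notin> FL" "finite FL" "card FL = 2 * m"
    and F': "FR = uminus ` FR" "0 \<notin> FR" "finite FR" "card FR = 2 * n"
    and disj: "(L \<union> S) \<inter> FL = {}" "(L \<union> S) \<inter> FR = {}" "(R \<union> S) \<inter> FL = {}" "(R \<union> S) \<inter> FR = {}"
      "L \<inter> S = {}" "R \<inter> S = {}" "0 \<notin> L \<union> S"
  shows "term_weight q (n + \<alpha>) (2 * m + \<beta>) (L \<union> FR) (R \<union> FL) S *
      ((\<Prod>i = 1..n + \<alpha>. qfact q (2 * i - 1))\<^sup>2 * (\<Prod>j<2 * m + \<beta>. qfact q j) *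
       (root_weight (node q) FL * cross (node q) L FL * cross (node q) R FR)) =
    term_weight q (m + \<alpha>) (2 * n + \<beta>) (L \<union> FL) (R \<union> FR) S *
      ((\<Prod>i = 1..m + \<alpha>. qfact q (2 * i - 1))\<^sup>2 * (\<Prod>j<2 * n + \<beta>. qfact q j) *
       (root_weight (node q) FR * cross (node q) L FR * cross (node q) R FL))"
proof -
  have card_F: "card (pos_part FL) = m" "card (neg_part FL) = m" "card (pos_part FR) = n" "card (neg_part FR) = n"
    using card_symmetric(2,3)[OF F(1,3)] card_symmetric(2,3)[OF F'(1,3)] F(2,4) F'(2,4) by auto
  have parts: "card (pos_part (L \<union> S \<union> E)) = card (pos_part (L \<union> S)) + card (pos_part E)"
    "card (neg_part (L \<union> S \<union> E)) = card (neg_part (L \<union> S)) + card (neg_part E)"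
    if "(L \<union> S) \<inter> E = {}" "finite E" for E
    using that fin parts_disjoint[OF that(1)]
    unfolding parts_Un[of "L \<union> S" E] by (auto simp: card_Un_disjoint)
  have cards: "card (R \<union> S \<union> E) = card (R \<union> S) + card E" if "(R \<union> S) \<inter> E = {}" "finite E" for E
    using that fin by (simp add: card_Un_disjoint)
  have sets: "L \<union> E \<union> S = L \<union> S \<union> E" "R \<union> E \<union> S = R \<union> S \<union> E" for E by auto
  \<comment> \<open>After subtracting the contributions of \<open>FL\<close> and \<open>FR\<close>,
    both regions impose this same condition: \<open>m\<close> and \<open>n\<close> cancel from the
    required numbers of dents.\<close>
  define cond where "cond \<longleftrightarrow> card (pos_part (L \<union> S)) = \<alpha> \<and> card (neg_part (L \<union> S)) = \<alpha> \<and> card (R \<union> S) = \<beta>"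
  define w where "w = (\<Prod>z\<in>S. qplus q (2 * z))"
  define c where "c = (\<lambda>k. (\<Prod>i = 1..k. qfact q (2 * i - 1))\<^sup>2)"
  define \<rho> where "\<rho> = (\<lambda>b. \<Prod>j<b. qfact q j)"
  have nz: "c k \<noteq> 0" "\<rho> k \<noteq> 0" for k
    using qfact_pos by (auto simp: c_def \<rho>_def less_imp_neq[symmetric])
  have fold: "(\<Prod>i = 1..k. qfact q (2 * i - 1))\<^sup>2 = c k" "(\<Prod>j<k. qfact q j) = \<rho> k" for k
    by (simp_all add: c_def \<rho>_def)
  note left_Un = left_weight_Un[OF node_strict_mono node_minus]
  have fin': "finite (L \<union> S)" "finite (R \<union> S)" using fin by auto
  note cross_split = cross_Un[OF fin(1,3) disj(5)] cross_Un[OF fin(2,3) disj(6)]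
  have 1: "term_weight q (m + \<alpha>) (2 * n + \<beta>) (L \<union> FL) (R \<union> FR) S =
    (if cond then w * (left_weight (node q) (L \<union> S) * (Vabs (node q) FL * root_weight (node q) FL * (cross (node q) L FL * cross (node q) S FL)) / c (m + \<alpha>) *
      (Vabs (node q) (R \<union> S) * Vabs (node q) FR * (cross (node q) R FR * cross (node q) S FR) / \<rho> (2 * n + \<beta>))) else 0)"
    unfolding term_weight_def sets left_Un[OF F(1-3) disj(7) fin'(1) disj(1)]
      Vabs_Un[OF fin'(2) F'(3) disj(4)] cross_split
      parts[OF disj(1) F(3)] cards[OF disj(4) F'(3)] card_F F'(4) fold w_def[symmetric]
    by (simp add: cond_def)
  have 2: "term_weight q (n + \<alpha>) (2 * m + \<beta>) (L \<union> FR) (R \<union> FL) S =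
    (if cond then w * (left_weight (node q) (L \<union> S) * (Vabs (node q) FR * root_weight (node q) FR * (cross (node q) L FR * cross (node q) S FR)) / c (n + \<alpha>) *
      (Vabs (node q) (R \<union> S) * Vabs (node q) FL * (cross (node q) R FL * cross (node q) S FL) / \<rho> (2 * m + \<beta>))) else 0)"
    unfolding term_weight_def sets left_Un[OF F'(1-3) disj(7) fin'(1) disj(2)]
      Vabs_Un[OF fin'(2) F(3) disj(3)] cross_split
      parts[OF disj(2) F'(3)] cards[OF disj(3) F(3)] card_F F(4) fold w_def[symmetric]
    by (simp add: cond_def)
  show ?thesis
    unfolding 1 2 fold using nz by (simp add: mult_ac)
qed

end

section \<open>The shuffling theorem\<close>

lemma zero_less_poly_iff: "0 < p \<longleftrightarrow> 0 < lead_coeff p" for p :: "'a :: linordered_idom poly"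
  by (simp add: less_poly_def pos_poly_def)

text \<open>A fraction is positive in the order with large indeterminate iff it has a representation
  with two positive leading coefficients; negating both parts normalises any other one. Among the
  two roots of a square exactly one is positive.\<close>

lemma rfun_sqrt_square:
  assumes "0 < r"
  shows "rfun_sqrt (r\<^sup>2) = r"
  unfolding rfun_sqrt_def
proof (rule the_equality)
  obtain u v where uv: "r = Fraction_Field.Fract u v" "v \<noteq> 0" by (cases r)
  have "\<exists>u v. r = Fraction_Field.Fract u v \<and> lead_coeff u > 0 \<and> lead_coeff v > 0"
  proof (cases "0 < v")
    case True
    then have "0 < u" using assms uv(1) by (simp add: zero_less_Fract_iff)
    with True uv(1) show ?thesis unfolding zero_less_poly_iff by blast
  next
    case False
    then have v: "0 < - v" using uv(2) by simp
    have r: "r = Fraction_Field.Fract (- u) (- v)" using uv by simp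
    then have "0 < - u" using assms v zero_less_Fract_iff[OF v] by metis
    with v r show ?thesis unfolding zero_less_poly_iff by blast
  qed
  then show "r\<^sup>2 = r\<^sup>2 \<and> (\<exists>u v. r = Fraction_Field.Fract u v \<and> lead_coeff u > 0 \<and> lead_coeff v > 0)"
    by simp
next
  fix s :: "rat poly fract"
  assume s: "s\<^sup>2 = r\<^sup>2 \<and> (\<exists>u v. s = Fraction_Field.Fract u v \<and> lead_coeff u > 0 \<and> lead_coeff v > 0)"
  then obtain u v where "s = Fraction_Field.Fract u v" "0 < u" "0 < v"
    unfolding zero_less_poly_iff by blast
  then have "0 < s" by (simp add: zero_less_Fract_iff)
  then show "s = r" using s assms by (simp add: power2_eq_iff_nonneg less_imp_le)
qed

lemma indet_gt_1: "1 < indet"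
proof -
  have "(0 :: rat poly) < 1" "(0 :: rat poly) < [:0, 1:] - 1"
    by (simp_all add: zero_less_poly_iff one_pCons)
  then show ?thesis unfolding indet_def by (simp add: one_less_Fract_iff)
qed

theorem theorem3p1:
  fixes m n \<alpha> \<beta> \<gamma> N :: nat
    and L1 R1 B FL FR L2 R2 :: "int set"
    and q :: "rat poly fract"
  assumes "q = indet"
    and "2 * \<alpha> + 2 * \<gamma> + 1 \<ge> \<beta>"
    and "N = m + n + \<alpha> + \<gamma>"
    and "L1 \<subseteq> {- int N..int N}" and "R1 \<subseteq> {- int N..int N}" and "B \<subseteq> {- int N..int N}"
    and "0 \<notin> L1"
    and "FL \<subseteq> L1 - R1" and "FL = uminus ` FL" and "card FL = 2 * m"
    and "FR \<subseteq> R1 - L1" and "FR = uminus ` FR" and "card FR = 2 * n"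
    and "L2 = (L1 - FL) \<union> FR"
    and "R2 = (R1 - FR) \<union> FL"
    and "tiling_gf q (H_region m n \<alpha> \<beta> \<gamma> L1 R1 B) \<noteq> 0"
  shows "tiling_gf q (H_region n m \<alpha> \<beta> \<gamma> L2 R2 B) / tiling_gf q (H_region m n \<alpha> \<beta> \<gamma> L1 R1 B) =
      (\<Prod>i = 1..m + \<alpha>. qfact q (2 * i - 1))\<^sup>2 / (\<Prod>i = 1..n + \<alpha>. qfact q (2 * i - 1))\<^sup>2
    * ((\<Prod>i \<in> {1..<2 * n + \<beta>}. qfact q i) / (\<Prod>i \<in> {1..<2 * m + \<beta>}. qfact q i))
    * rfun_sqrt ((\<Prod>z\<in>L2. qnum q (2 * \<bar>z\<bar>) / 4) / (\<Prod>z\<in>L1. qnum q (2 * \<bar>z\<bar>) / 4))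
    * ((Delta11 q L2 * Delta11 q R2) / (Delta11 q L1 * Delta11 q R1))"
proof -
  have q: "1 < q" using indet_gt_1 assms(1) by simp
  note strict = node_strict_mono[OF q] and minus = node_minus[OF q]
  define L R where "L = L1 - FL" and "R = R1 - FR"
  define c where "c = (\<lambda>k. (\<Prod>i = 1..k. qfact q (2 * i - 1))\<^sup>2)"
  define \<rho> where "\<rho> = (\<lambda>b. \<Prod>j<b. qfact q j)"
  have fold: "(\<Prod>i = 1..k. qfact q (2 * i - 1))\<^sup>2 = c k" "(\<Prod>j<k. qfact q j) = \<rho> k"
    "(\<Prod>i \<in> {1..<k}. qfact q i) = \<rho> k" for k
  proof -
    \<comment> \<open>The index ranges differ at most by \<open>j = 0\<close>, and
      \<open>qfact q 0\<close> is 1.\<close>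
    have "(\<Prod>j<k. qfact q j) = (\<Prod>i \<in> {1..<k}. qfact q i)"
      by (rule prod.mono_neutral_right) (auto simp: qfact_def)
    then show "(\<Prod>i = 1..k. qfact q (2 * i - 1))\<^sup>2 = c k" "(\<Prod>j<k. qfact q j) = \<rho> k"
      "(\<Prod>i \<in> {1..<k}. qfact q i) = \<rho> k" by (simp_all add: c_def \<rho>_def)
  qed
  have pos: "0 < c k" "0 < \<rho> k" for k
    unfolding c_def \<rho>_def by (intro zero_less_power prod_pos ballI qfact_pos[OF q])+
  have L1: "L1 = L \<union> FL" and R1: "R1 = R \<union> FR" and L2: "L2 = L \<union> FR" and R2: "R2 = R \<union> FL"
    using assms(8,11,14,15) by (auto simp: L_def R_def)
  have disj: "L \<inter> FL = {}" "L \<inter> FR = {}" "R \<inter> FL = {}" "R \<inter> FR = {}"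
    using assms(8,11) by (auto simp: L_def R_def)
  have fin: "finite L" "finite R" "finite FL" "finite FR"
    using assms(4,5) L1 R1 by (auto intro: finite_subset)
  \<comment> \<open>For \<open>FR\<close> this follows from symmetry and even cardinality, since
    \<open>R1\<close> may contain 0.\<close>
  have z: "0 \<notin> L" "0 \<notin> FL" "0 \<notin> FR"
    using assms(7) L1 card_symmetric(1)[OF assms(12) fin(4)] assms(13) by auto
  define Z where "Z = {- int N..int N} - {0} - L1 - R1 - B"
  \<comment> \<open>The flip keeps the union of the two dent sets, so both expansions run over the
    same sets \<open>S\<close>.\<close>
  have Z: "Z = {- int N..int N} - {0} - L2 - R2 - B" unfolding Z_def L1 R1 L2 R2 by auto
  have sum1: "tiling_gf q (H_region m n \<alpha> \<beta> \<gamma> L1 R1 B) =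
      (\<Sum>S\<in>Pow Z. term_weight q (m + \<alpha>) (2 * n + \<beta>) L1 R1 S)"
    unfolding Z_def by (rule tiling_gf_H_region[OF q assms(2-7)])
  have sum2: "tiling_gf q (H_region n m \<alpha> \<beta> \<gamma> L2 R2 B) =
      (\<Sum>S\<in>Pow Z. term_weight q (n + \<alpha>) (2 * m + \<beta>) L2 R2 S)"
    unfolding Z by (rule tiling_gf_H_region[OF q]) (use assms(2-7) L1 R1 L2 R2 z in auto)
  define K1 where "K1 = c (n + \<alpha>) * \<rho> (2 * m + \<beta>) * (root_weight (node q) FL * cross (node q) L FL * cross (node q) R FR)"
  define K2 where "K2 = c (m + \<alpha>) * \<rho> (2 * n + \<beta>) * (root_weight (node q) FR * cross (node q) L FR * cross (node q) R FL)"
  have "term_weight q (n + \<alpha>) (2 * m + \<beta>) L2 R2 S * K1 = term_weight q (m + \<alpha>) (2 * n + \<beta>) L1 R1 S * K2"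
    if "S \<in> Pow Z" for S
    unfolding L1 R1 L2 R2 K1_def K2_def fold[symmetric]
  proof (rule term_weight_ratio[OF q])
    show "finite S" using that by (auto simp: Z_def intro: finite_subset)
  qed (use that disj fin z assms(9,10,12,13) in \<open>auto simp: Z_def L1 R1\<close>)
  then have ratio: "tiling_gf q (H_region n m \<alpha> \<beta> \<gamma> L2 R2 B) * K1 = tiling_gf q (H_region m n \<alpha> \<beta> \<gamma> L1 R1 B) * K2"
    unfolding sum1 sum2 sum_distrib_right by (intro sum.cong) auto
  define \<sigma> where "\<sigma> = root_weight (node q) FR / root_weight (node q) FL"
  have root_pos: "0 < root_weight (node q) FL" "0 < root_weight (node q) FR"
    by (simp_all add: root_weight_pos[OF strict minus] fin)
  then have "0 < \<sigma>" by (simp add: \<sigma>_def)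
  have root: "rfun_sqrt ((\<Prod>z\<in>L2. qnum q (2 * \<bar>z\<bar>) / 4) / (\<Prod>z\<in>L1. qnum q (2 * \<bar>z\<bar>) / 4)) = \<sigma>"
  proof -
    have "\<bar>(node q) x\<bar> / 2 \<noteq> 0" if "x \<in> L" for x
      using strict_odd_nonzero[OF strict minus, of x] z(1) that by auto
    \<comment> \<open>The unflipped labels cancel from the quotient under the root, leaving two
      symmetric products, each a square.\<close>
    then have "(\<Prod>z\<in>L. \<bar>node q z\<bar> / 2) \<noteq> 0" using fin(1) by (simp only: prod_zero_iff) blast
    then have "(\<Prod>z\<in>L2. \<bar>node q z\<bar> / 2) / (\<Prod>z\<in>L1. \<bar>node q z\<bar> / 2) = \<sigma>\<^sup>2"
      unfolding L1 L2 \<sigma>_def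
      by (simp add: prod.union_disjoint fin disj power_divide
        root_weight_square[OF strict minus assms(9) z(2) fin(3)] root_weight_square[OF strict minus assms(12) z(3) fin(4)]
        del: prod_dividef)
    then show ?thesis
      using rfun_sqrt_square[OF \<open>0 < \<sigma>\<close>] by (simp only: abs_node[OF q])
  qed
  \<comment> \<open>All four products within \<open>L\<close>, \<open>R\<close>, \<open>FL\<close>
    and \<open>FR\<close> occur in numerator and denominator; only the interactions of flipped with
    unflipped labels survive.\<close>
  have Delta: "(Delta11 q L2 * Delta11 q R2) / (Delta11 q L1 * Delta11 q R1) =
    (cross (node q) L FR * cross (node q) R FL) / (cross (node q) L FL * cross (node q) R FR)"
    unfolding Delta11_eq[OF q] L1 R1 L2 R2
    using Vabs_nonzero[OF strict minus] by (simp add: Vabs_Un fin disj)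
  have "K1 \<noteq> 0"
    using pos[of "n + \<alpha>"] pos[of "2 * m + \<beta>"] root_pos cross_nonzero[OF strict minus disj(1)] cross_nonzero[OF strict minus disj(4)]
    by (simp add: K1_def)
  with ratio assms(16) have "tiling_gf q (H_region n m \<alpha> \<beta> \<gamma> L2 R2 B) / tiling_gf q (H_region m n \<alpha> \<beta> \<gamma> L1 R1 B) = K2 / K1"
    by (simp add: frac_eq_eq mult.commute)
  then show ?thesis
    unfolding fold root Delta by (simp add: K1_def K2_def \<sigma>_def mult_ac)
qed

end
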